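(* There exists an algorithm with the following guarantee. Given $\varepsilon\in(0,1)$ and an instance $([n],\mathcal{T})$ of the LLOC problem that admits a solution $f:[n]\to\mathbb{R}$ satisfying at least a $(1-\varepsilon)$-fraction of all constraints in $\mathcal{T}$, the algorithm outputs a solution $f:[n]\to\mathbb{R}$ that satisfies at least a $(1-O(\varepsilon^{1/8}))$-fraction of all constraints in $\mathcal{T}$, and it runs in time $O(n^7)+(1/\varepsilon)^{O(1/\varepsilon^{1/8})}\, n$.
   Context: Line Learning with Ordinal Constraints (LLOC): an instance is a pair $([n],\mathcal{T})$ where $[n]=\{1,\dots,n\}$ and $\mathcal{T}$ is a set of ordered triples of distinct elements of $[n]$, which is dense: for any distinct $u,v,w\in[n]$, exactly one of $(u,v,w)$ and $(u,w,v)$ belongs to $\mathcal{T}$. A solution is a map $f:[n]\to\mathbb{R}$; it satisfies the constraint $(u,v,w)\in\mathcal{T}$ if $|f(u)-f(v)|<|f(u)-f(w)|$, and violates it otherwise. The constants hidden in the $O(\cdot)$ notation are absolute. *)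

theory Defs imports Complex_Main begin

section \<open>Line learning with ordinal constraints\<close>

definition lloc_instance :: "nat \<Rightarrow> (nat \<times> nat \<times> nat) set \<Rightarrow> bool" where
  "lloc_instance n T \<longleftrightarrow>
     (\<forall>(u, v, w) \<in> T. {u, v, w} \<subseteq> {1..n} \<and> distinct [u, v, w]) \<and>
     (\<forall>u \<in> {1..n}. \<forall>v \<in> {1..n}. \<forall>w \<in> {1..n}. distinct [u, v, w] \<longrightarrow>
        ((u, v, w) \<in> T) \<noteq> ((u, w, v) \<in> T))"

definition lloc_satisfied :: "(nat \<Rightarrow> real) \<Rightarrow> (nat \<times> nat \<times> nat) set \<Rightarrow> (nat \<times> nat \<times> nat) set" where
  "lloc_satisfied f T = {(u, v, w) \<in> T. \<bar>f u - f v\<bar> < \<bar>f u - f w\<bar>}"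

text \<open>The product form makes every solution satisfy every fraction (at most 1) of an empty
  constraint set (which occurs exactly for \<open>n \<le> 2\<close>).\<close>

definition satisfies_fraction :: "(nat \<Rightarrow> real) \<Rightarrow> (nat \<times> nat \<times> nat) set \<Rightarrow> real \<Rightarrow> bool" where
  "satisfies_fraction f T p \<longleftrightarrow> real (card (lloc_satisfied f T)) \<ge> p * real (card T)"


section \<open>Algorithms: a unit-cost real RAM\<close>

text \<open>
  Algorithms are deterministic structured programs over an integer store and a real store, as in
  the standard real RAM without rounding. Both stores consist of arrays, named by natural numbers
  and indexed by tuples of integers; scalars are arrays accessed with the empty tuple. The number
  of indices of an access is fixed by the program text. Restrictions that matter for the strength
  of the model: integers only have addition and subtraction at unit cost, no real number is ever
  converted to an integer, and the only literals are integers, so that a program cannot carry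
  non-uniform advice in a real constant.
\<close>

datatype iexp =
    IConst int
  | IGet nat "iexp list"
  | IAdd iexp iexp
  | ISub iexp iexp

datatype rexp =
    ROfInt iexp
  | RGet nat "iexp list"
  | RAdd rexp rexp
  | RSub rexp rexp
  | RMul rexp rexp
  | RDiv rexp rexp

datatype bexp =
    ILess iexp iexp
  | RLess rexp rexp
  | BNot bexp
  | BAnd bexp bexp

datatype com =
    Skip
  | ISet nat "iexp list" iexp
  | RSet nat "iexp list" rexp
  | Seq com com
  | If bexp com com
  | While bexp com

record state =
  ints :: "nat \<Rightarrow> int list \<Rightarrow> int"
  reals :: "nat \<Rightarrow> int list \<Rightarrow> real"

primrec ival :: "state \<Rightarrow> iexp \<Rightarrow> int" where
  "ival s (IConst c) = c"
| "ival s (IGet a is) = ints s a (map (ival s) is)"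
| "ival s (IAdd e1 e2) = ival s e1 + ival s e2"
| "ival s (ISub e1 e2) = ival s e1 - ival s e2"

primrec rval :: "state \<Rightarrow> rexp \<Rightarrow> real" where
  "rval s (ROfInt e) = real_of_int (ival s e)"
| "rval s (RGet a is) = reals s a (map (ival s) is)"
| "rval s (RAdd e1 e2) = rval s e1 + rval s e2"
| "rval s (RSub e1 e2) = rval s e1 - rval s e2"
| "rval s (RMul e1 e2) = rval s e1 * rval s e2"
| "rval s (RDiv e1 e2) = rval s e1 / rval s e2"

primrec bval :: "state \<Rightarrow> bexp \<Rightarrow> bool" where
  "bval s (ILess e1 e2) \<longleftrightarrow> ival s e1 < ival s e2"
| "bval s (RLess e1 e2) \<longleftrightarrow> rval s e1 < rval s e2"
| "bval s (BNot b) \<longleftrightarrow> \<not> bval s b"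
| "bval s (BAnd b1 b2) \<longleftrightarrow> bval s b1 \<and> bval s b2"

text \<open>Every literal, memory access, operation, comparison and connective costs one unit.\<close>

primrec icost :: "iexp \<Rightarrow> nat" where
  "icost (IConst c) = 1"
| "icost (IGet a is) = 1 + sum_list (map icost is)"
| "icost (IAdd e1 e2) = 1 + icost e1 + icost e2"
| "icost (ISub e1 e2) = 1 + icost e1 + icost e2"

primrec rcost :: "rexp \<Rightarrow> nat" where
  "rcost (ROfInt e) = 1 + icost e"
| "rcost (RGet a is) = 1 + sum_list (map icost is)"
| "rcost (RAdd e1 e2) = 1 + rcost e1 + rcost e2"
| "rcost (RSub e1 e2) = 1 + rcost e1 + rcost e2"
| "rcost (RMul e1 e2) = 1 + rcost e1 + rcost e2"
| "rcost (RDiv e1 e2) = 1 + rcost e1 + rcost e2"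

primrec bcost :: "bexp \<Rightarrow> nat" where
  "bcost (ILess e1 e2) = 1 + icost e1 + icost e2"
| "bcost (RLess e1 e2) = 1 + rcost e1 + rcost e2"
| "bcost (BNot b) = 1 + bcost b"
| "bcost (BAnd b1 b2) = 1 + bcost b1 + bcost b2"

definition iset :: "nat \<Rightarrow> int list \<Rightarrow> int \<Rightarrow> state \<Rightarrow> state" where
  "iset a is x s = s\<lparr>ints := (ints s)(a := (ints s a)(is := x))\<rparr>"

definition rset :: "nat \<Rightarrow> int list \<Rightarrow> real \<Rightarrow> state \<Rightarrow> state" where
  "rset a is x s = s\<lparr>reals := (reals s)(a := (reals s a)(is := x))\<rparr>"

text \<open>\<open>exec c s t s'\<close>: started in \<open>s\<close>, the program \<open>c\<close> halts in \<open>s'\<close> after exactly \<open>t\<close> time units.\<close>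

inductive exec :: "com \<Rightarrow> state \<Rightarrow> nat \<Rightarrow> state \<Rightarrow> bool" where
  Skip: "exec Skip s 1 s"
| ISet: "exec (ISet a is e) s (1 + sum_list (map icost is) + icost e)
           (iset a (map (ival s) is) (ival s e) s)"
| RSet: "exec (RSet a is e) s (1 + sum_list (map icost is) + rcost e)
           (rset a (map (ival s) is) (rval s e) s)"
| Seq: "exec c1 s t1 s1 \<Longrightarrow> exec c2 s1 t2 s2 \<Longrightarrow> exec (Seq c1 c2) s (t1 + t2) s2"
| IfTrue: "bval s b \<Longrightarrow> exec c1 s t s1 \<Longrightarrow> exec (If b c1 c2) s (1 + bcost b + t) s1"
| IfFalse: "\<not> bval s b \<Longrightarrow> exec c2 s t s1 \<Longrightarrow> exec (If b c1 c2) s (1 + bcost b + t) s1"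
| WhileFalse: "\<not> bval s b \<Longrightarrow> exec (While b c) s (1 + bcost b) s"
| WhileTrue: "bval s b \<Longrightarrow> exec c s t1 s1 \<Longrightarrow> exec (While b c) s1 t2 s2 \<Longrightarrow>
           exec (While b c) s (1 + bcost b + t1 + t2) s2"

inductive_cases Skip_exec_elim: "exec Skip s t s'"
inductive_cases ISet_exec_elim: "exec (ISet a is e) s t s'"
inductive_cases RSet_exec_elim: "exec (RSet a is e) s t s'"
inductive_cases Seq_exec_elim: "exec (Seq c1 c2) s t s'"
inductive_cases If_exec_elim: "exec (If b c1 c2) s t s'"
inductive_cases While_exec_elim: "exec (While b c) s t s'"

lemma exec_deterministic:
  "exec c s t s' \<Longrightarrow> exec c s u s'' \<Longrightarrow> t = u \<and> s' = s''"
proof (induction arbitrary: u s'' rule: exec.induct)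
  case (Skip s)
  then show ?case by (rule Skip_exec_elim) simp
next
  case (ISet a js e s)
  then show ?case by (rule ISet_exec_elim) simp
next
  case (RSet a js e s)
  then show ?case by (rule RSet_exec_elim) simp
next
  case (Seq c1 s t1 s1 c2 t2 s2)
  from Seq.prems obtain u1 u2 r where *: "u = u1 + u2" "exec c1 s u1 r" "exec c2 r u2 s''"
    by (rule Seq_exec_elim)
  from Seq.IH(1)[OF *(2)] have 1: "t1 = u1" "s1 = r" by blast+
  from Seq.IH(2)[of u2 s''] *(3) 1(2) have 2: "t2 = u2 \<and> s2 = s''" by blast
  from 1(1) 2 *(1) show ?case by blast
next
  case (IfTrue s b c1 t s1 c2)
  obtain r where *: "u = Suc (bcost b + r)" "exec c1 s r s''"
    by (rule If_exec_elim[OF IfTrue.prems]) (use IfTrue.hyps(1) in blast)+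
  from IfTrue.IH[OF *(2)] have "t = r" "s1 = s''" by blast+
  with *(1) show ?case by simp
next
  case (IfFalse s b c2 t s1 c1)
  obtain r where *: "u = Suc (bcost b + r)" "exec c2 s r s''"
    by (rule If_exec_elim[OF IfFalse.prems]) (use IfFalse.hyps(1) in blast)+
  from IfFalse.IH[OF *(2)] have "t = r" "s1 = s''" by blast+
  with *(1) show ?case by simp
next
  case (WhileFalse s b c)
  show ?case
    by (rule While_exec_elim[OF WhileFalse.prems]) (use WhileFalse.hyps in simp_all)
next
  case (WhileTrue s b c t1 s1 t2 s2)
  obtain u1 u2 r where
    *: "u = Suc (bcost b + u1 + u2)" "exec c s u1 r" "exec (While b c) r u2 s''"
    by (rule While_exec_elim[OF WhileTrue.prems]) (use WhileTrue.hyps(1) in blast)+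
  from WhileTrue.IH(1)[OF *(2)] have 1: "t1 = u1" "s1 = r" by blast+
  from WhileTrue.IH(2)[of u2 s''] *(3) 1(2) have 2: "t2 = u2 \<and> s2 = s''" by blast
  from 1(1) 2 *(1) show ?case by (elim conjE) (simp only: plus_1_eq_Suc add_Suc)
qed


section \<open>Input and output of algorithms for LLOC\<close>

text \<open>
  Input: \<open>n\<close> is integer scalar 0, integer array 1 is the indicator table of the constraints, and
  \<open>\<epsilon>\<close> is real scalar 0; all other cells hold 0. Output: real array 1.
\<close>

definition lloc_input :: "real \<Rightarrow> nat \<Rightarrow> (nat \<times> nat \<times> nat) set \<Rightarrow> state" where
  "lloc_input \<epsilon> n T = \<lparr>
     ints = (\<lambda>a is.
       if a = 0 \<and> is = [] then int n
       else if a = 1 \<and> (\<exists>u v w. (u, v, w) \<in> T \<and> is = [int u, int v, int w]) then 1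
       else 0),
     reals = (\<lambda>a is. if a = 0 \<and> is = [] then \<epsilon> else 0)\<rparr>"

definition lloc_output :: "state \<Rightarrow> nat \<Rightarrow> real" where
  "lloc_output s i = reals s 1 [int i]"

end

(*
  Order the points by a pivot: if a is the leftmost point of the solution f, the constraints (a, v, u)
  say exactly whether v precedes u. If few constraints are violated, then some a among the leftmost
  delta^4 n points (delta = eps^(1/8)) has few violated constraints, and the number of v that a puts
  before u is within L/8 of the rank of u for all but a tiny fraction of the points u, where
  L = delta n. All pivots are tried, and the best result is kept.

  Cut the order into K = n/L buckets and look for a solution x that is constant on buckets. The values
  of f at the middle ranks of the buckets satisfy x j < x i for j < i, and they satisfy
  2 x i < x j + x k (j < i < k) whenever few constraints of the box (i, j, k) say that k is closer: by
  monotonicity in every argument, 2 x i >= x j + x k would propagate to a constant fraction of the box.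
  Conversely, a solution of these inequalities satisfies all constraints except for violated ones,
  displaced points, points in nearby buckets, and boxes in which 2 f u - f v - f w changes sign. This
  expression increases along the diagonals (u + t, v - t, w - t), so the boxes of the last kind contain
  O(n^2 L) triples.

  The inequalities are solved by the perceptron algorithm. Its number of mistakes is at most quadratic
  in the size of a solution with margin 1, which is K^O(K) for a vertex, by Cramer's rule. The running
  time is n^4 K^O(K), which is at most n^7 + K^O(K) n.
*)

theory Submission imports Defs "Jordan_Normal_Form.Determinant" begin

section \<open>Vertices of integer inequality systems\<close>

text \<open>The program never sees \<open>f\<close>: buckets, box counts and inequalities are
  computed from \<open>T\<close> alone, and ranks occur only in the analysis. The window of about
  \<open>\<delta> ^ 4 * n\<close> leftmost points balances two losses. At most
  \<open>\<delta> ^ 8 * n ^ 3\<close> constraints are violated, so averaging leaves some pivot in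
  the window with at most \<open>\<delta> ^ 4 * n ^ 2\<close> of them; and at most
  \<open>\<delta> ^ 4 * n\<close> points lie to its left, which spoils at most
  \<open>2 * \<delta> ^ 4 * n ^ 2\<close> pairs. A displaced point accounts for more than
  \<open>L / 8\<close> wrong pairs, which leaves at most \<open>128 * \<delta> ^ 2 * L\<close>
  displaced points. The other obstacle is \<open>\<delta> * n < 1\<close>. An error of order
  \<open>n ^ 2\<close> could not be charged to \<open>\<delta> * n ^ 3\<close> there, so the output
  must be exact. The same bounds then leave nothing violated or displaced, \<open>L = 1\<close>, and
  buckets are single points; the margins below are phrased so that they cover this case too.
  Integers of the program can neither be multiplied nor divided. Widths and bucket numbers are
  therefore cardinalities found by counting loops, and products are taken over the reals.\<close>

definition dot :: "nat \<Rightarrow> (nat \<Rightarrow> int) \<Rightarrow> (nat \<Rightarrow> real) \<Rightarrow> real" where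
  "dot K a y = (\<Sum>t<K. of_int (a t) * y t)"

lemma dot_add_scaled: "dot K a (\<lambda>t. y t + c * d t) = dot K a y + c * dot K a d"
  by (simp add: dot_def sum.distrib sum_distrib_left algebra_simps)

lemma dot_uminus: "dot K a (\<lambda>t. - d t) = - dot K a d"
  by (simp add: dot_def sum_negf)

text \<open>Padding the \<open>k\<close> rows with zero rows gives a singular square matrix, and a
  kernel vector can be negated. The negative coordinate ensures that moving along \<open>d\<close>
  eventually violates a bound \<open>y t \<ge> 1\<close>, so that some row becomes tight on the
  way.\<close>

lemma exists_orthogonal_direction:
  fixes r :: "nat \<Rightarrow> nat \<Rightarrow> int"
  assumes "k < K"
  shows "\<exists>d. (\<exists>t<K. d t < 0) \<and> (\<forall>i<k. dot K (r i) d = 0)"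
proof -
  define A :: "real mat" where "A = mat K K (\<lambda>(i, t). if i < k then of_int (r i t) else 0)"
  have A: "A \<in> carrier_mat K K" by (simp add: A_def)
  have row: "row A k = 0\<^sub>v K" using assms by (auto simp: A_def)
  have "A = mat\<^sub>r K K (\<lambda>i. if i = k then 0\<^sub>v K else row A i)"
    by (rule eq_matI) (use assms in \<open>auto simp: A_def\<close>)
  then have "det A = 0" using det_row_0[OF assms, of "row A"] A
    by (metis (no_types, lifting) Pi_I row_carrier_vec atLeastLessThan_iff carrier_matD)
  then obtain v where v: "v \<in> carrier_vec K" "v \<noteq> 0\<^sub>v K" "A *\<^sub>v v = 0\<^sub>v K"
    using det_0_iff_vec_prod_zero_field[OF A] by auto
  have orth: "dot K (r i) (\<lambda>t. v $ t) = 0" if "i < k" for i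
  proof -
    have "i < K" using that assms by simp
    have "(A *\<^sub>v v) $ i = 0" using v(3) \<open>i < K\<close> by simp
    moreover have "(A *\<^sub>v v) $ i = (\<Sum>t<K. of_int (r i t) * v $ t)"
      using v(1) \<open>i < K\<close> that by (simp add: A_def scalar_prod_def lessThan_atLeast0)
    ultimately show ?thesis by (simp add: dot_def)
  qed
  obtain t where t: "t < K" "v $ t \<noteq> 0"
    using v(1,2) by (metis carrier_vecD eq_vecI index_zero_vec)
  show ?thesis
  proof (cases "v $ t < 0")
    case True
    then show ?thesis using t orth by blast
  next
    case False
    then show ?thesis using t orth
      by (intro exI[of _ "\<lambda>t. - v $ t"]) (auto simp: dot_uminus intro!: exI[of _ t])
  qed
qed

text \<open>Leibniz expansion with \<open>n!\<close> terms.\<close>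

lemma abs_det_le:
  fixes A :: "real mat"
  assumes A: "A \<in> carrier_mat n n" and b: "\<And>i j. i < n \<Longrightarrow> j < n \<Longrightarrow> \<bar>A $$ (i, j)\<bar> \<le> B"
  shows "\<bar>det A\<bar> \<le> fact n * B ^ n"
proof -
  have "\<bar>det A\<bar> \<le> (\<Sum>p\<in>{p. p permutes {0..<n}}. \<bar>signof p * (\<Prod>i = 0..<n. A $$ (i, p i))\<bar>)"
    unfolding det_def'[OF A] by (rule sum_abs)
  also have "\<dots> \<le> (\<Sum>p\<in>{p. p permutes {0..<n}}. B ^ n)"
  proof (rule sum_mono)
    fix p assume "p \<in> {p. p permutes {0..<n}}"
    then have p: "p permutes {0..<n}" by simp
    have "\<bar>signof p * (\<Prod>i = 0..<n. A $$ (i, p i))\<bar> = (\<Prod>i = 0..<n. \<bar>A $$ (i, p i)\<bar>)"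
      by (simp add: abs_mult abs_prod sign_def)
    also have "\<dots> \<le> (\<Prod>i = 0..<n. B)"
      by (rule prod_mono) (use b permutes_in_image[OF p] in auto)
    finally show "\<bar>signof p * (\<Prod>i = 0..<n. A $$ (i, p i))\<bar> \<le> B ^ n" by simp
  qed
  also have "\<dots> = fact n * B ^ n" by (simp add: card_permutations[of _ n])
  finally show ?thesis .
qed

text \<open>Cramer's rule; an integer matrix that is invertible over the reals has determinant at least 1.\<close>

lemma integer_system_solution_bound:
  fixes r :: "nat \<Rightarrow> nat \<Rightarrow> int" and d :: "nat \<Rightarrow> nat \<Rightarrow> real"
  assumes y: "\<And>i. i < K \<Longrightarrow> dot K (r i) y = 1"
    and diag: "\<And>i. i < K \<Longrightarrow> dot K (r i) (d i) \<noteq> 0"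
    and tri: "\<And>i j. i < j \<Longrightarrow> j < K \<Longrightarrow> dot K (r i) (d j) = 0"
    and B: "\<And>i t. i < K \<Longrightarrow> t < K \<Longrightarrow> \<bar>r i t\<bar> \<le> 4"
    and t: "t < K"
  shows "\<bar>y t\<bar> \<le> (4 * real K) ^ K"
proof -
  define Z :: "int mat" where "Z = mat K K (\<lambda>(i, t). r i t)"
  define R :: "real mat" where "R = map_mat of_int Z"
  define D :: "real mat" where "D = mat K K (\<lambda>(t, j). d j t)"
  have R: "R \<in> carrier_mat K K" and D: "D \<in> carrier_mat K K" by (simp_all add: R_def Z_def D_def)
  have Rit: "R $$ (i, t) = of_int (r i t)" if "i < K" "t < K" for i t
    using that by (simp add: R_def Z_def)
  have RD: "(R * D) $$ (i, j) = dot K (r i) (d j)" if "i < K" "j < K" for i j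
    using that by (simp add: R_def Z_def D_def dot_def scalar_prod_def lessThan_atLeast0)
  \<comment> \<open>\<open>R\<close> is nonsingular because \<open>R * D\<close> is lower triangular
    by \<open>tri\<close> and has a nonzero diagonal by \<open>diag\<close>.\<close>
  have "det (R * D) = prod_list (diag_mat (R * D))"
    by (rule det_lower_triangular[where n = K]) (use R D RD tri in auto)
  also have "\<dots> = (\<Prod>i = 0..<K. (R * D) $$ (i, i))"
    using R D by (simp add: prod_list_diag_prod)
  also have "\<dots> \<noteq> 0" using RD diag by simp
  finally have "det R \<noteq> 0" using det_mult[OF R D] by auto
  moreover have "det R = of_int (det Z)" by (simp add: R_def of_int_hom.hom_det)
  ultimately have det: "\<bar>det R\<bar> \<ge> 1" by auto
  define yv where "yv = vec K y"
  have yv: "yv \<in> carrier_vec K" by (simp add: yv_def)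
  have Ry: "R *\<^sub>v yv = vec K (\<lambda>_. 1)"
    by (rule eq_vecI) (use y in \<open>auto simp: R_def Z_def yv_def dot_def scalar_prod_def lessThan_atLeast0\<close>)
  have adj: "adj_mat R \<in> carrier_mat K K" "adj_mat R * R = det R \<cdot>\<^sub>m 1\<^sub>m K"
    using adj_mat[OF R] by auto
  have "adj_mat R *\<^sub>v (R *\<^sub>v yv) = (det R \<cdot>\<^sub>m 1\<^sub>m K) *\<^sub>v yv"
    using assoc_mult_mat_vec[OF adj(1) R yv] adj(2) by simp
  also have "\<dots> = det R \<cdot>\<^sub>v yv"
  proof (rule eq_vecI)
    fix i assume "i < dim_vec (det R \<cdot>\<^sub>v yv)"
    then have i: "i < K" by (simp add: yv_def)
    have "((det R \<cdot>\<^sub>m 1\<^sub>m K) *\<^sub>v yv) $ i = (\<Sum>j\<in>{0..<K}. (det R * (if j = i then 1 else 0)) * y j)"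
      using i by (simp add: scalar_prod_def yv_def)
    also have "\<dots> = det R * y i" using i by (subst sum.remove[of _ i]) auto
    finally show "((det R \<cdot>\<^sub>m 1\<^sub>m K) *\<^sub>v yv) $ i = (det R \<cdot>\<^sub>v yv) $ i"
      using i by (simp add: yv_def)
  qed (simp add: yv_def)
  \<comment> \<open>Since \<open>R\<close> maps \<open>y\<close> to the all-ones vector,
    \<open>det R * y t\<close> is the sum of the cofactors of column \<open>t\<close>.\<close>
  finally have "(adj_mat R *\<^sub>v vec K (\<lambda>_. 1)) $ t = det R * y t"
    using t unfolding Ry by (simp add: yv_def)
  moreover have "(adj_mat R *\<^sub>v vec K (\<lambda>_. 1)) $ t = (\<Sum>j<K. cofactor R j t)"
    using t R by (simp add: adj_mat_def scalar_prod_def lessThan_atLeast0)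
  ultimately have "\<bar>det R\<bar> * \<bar>y t\<bar> = \<bar>\<Sum>j<K. cofactor R j t\<bar>"
    by (simp add: abs_mult)
  moreover have "\<bar>y t\<bar> \<le> \<bar>det R\<bar> * \<bar>y t\<bar>" using det by (simp add: mult_le_cancel_right1)
  ultimately have "\<bar>y t\<bar> \<le> (\<Sum>j<K. \<bar>cofactor R j t\<bar>)" using sum_abs[of "\<lambda>j. cofactor R j t"] by (metis order_trans)
  also have "\<dots> \<le> (\<Sum>j<K. fact (K - 1) * 4 ^ (K - 1))"
  proof (rule sum_mono)
    fix j assume "j \<in> {..<K}"
    then have j: "j < K" by simp
    have "\<bar>cofactor R j t\<bar> = \<bar>det (mat_delete R j t)\<bar>"
      by (simp add: cofactor_def abs_mult power_abs)
    also have "\<dots> \<le> fact (K - 1) * 4 ^ (K - 1)"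
    proof (rule abs_det_le)
      show "mat_delete R j t \<in> carrier_mat (K - 1) (K - 1)" using R by (rule mat_delete_carrier)
    next
      fix p q assume pq: "p < K - 1" "q < K - 1"
      then have "mat_delete R j t $$ (p, q) = of_int (r (if p < j then p else Suc p) (if q < t then q else Suc q))"
        using R Rit by (auto simp: mat_delete_def)
      moreover have "\<bar>r (if p < j then p else Suc p) (if q < t then q else Suc q)\<bar> \<le> 4"
        using B pq by auto
      ultimately show "\<bar>mat_delete R j t $$ (p, q)\<bar> \<le> 4"
        by (metis of_int_abs of_int_le_numeral_iff)
    qed
    finally show "\<bar>cofactor R j t\<bar> \<le> fact (K - 1) * 4 ^ (K - 1)" .
  qed
  also have "\<dots> = fact K * 4 ^ (K - 1)" using t by (simp add: fact_reduce[of K])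
  also have "\<dots> \<le> real K ^ K * 4 ^ K"
    by (intro mult_mono) (use fact_le_power[of K, where ?'a = real] in \<open>auto intro: power_increasing\<close>)
  finally show ?thesis by (simp add: power_mult_distrib mult.commute)
qed

text \<open>The bound is attained at a vertex. Tight rows \<open>r\<close> are collected one at a time, together with
  the directions \<open>d\<close> along which they were reached: each \<open>d j\<close> is orthogonal to the rows found before,
  so the products \<open>dot K (r i) (d j)\<close> form a triangular matrix, which witnesses independence.\<close>

lemma bounded_strict_solution:
  fixes A :: "(nat \<Rightarrow> int) set"
  assumes fin: "finite A" and B: "\<And>a t. a \<in> A \<Longrightarrow> \<bar>a t\<bar> \<le> 4"
    and x: "\<And>a. a \<in> A \<Longrightarrow> dot K a x > 0" "\<And>t. t < K \<Longrightarrow> x t > 0"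
  shows "\<exists>y. (\<forall>a\<in>A. dot K a y \<ge> 1) \<and> (\<forall>t<K. \<bar>y t\<bar> \<le> (4 * real K) ^ K)"
proof -
  define e :: "nat \<Rightarrow> nat \<Rightarrow> int" where "e i t = (if t = i then 1 else 0)" for i t
  have dot_e: "dot K (e i) z = z i" if "i < K" for i z
    using that unfolding dot_def e_def by (subst sum.remove[of _ i]) auto
  \<comment> \<open>The added unit rows state \<open>y t \<ge> 1\<close>. They keep lines out of the
    polyhedron, so that a vertex exists.\<close>
  define A' where "A' = A \<union> e ` {..<K}"
  have fin': "finite A'" using fin by (simp add: A'_def)
  have x': "dot K a x > 0" if "a \<in> A'" for a using that x by (auto simp: A'_def dot_e)
  have B': "\<bar>a t\<bar> \<le> 4" if "a \<in> A'" for a t using that B by (auto simp: A'_def e_def)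
  have "\<exists>y r d. (\<forall>a\<in>A'. dot K a y \<ge> 1) \<and> (\<forall>i<k. r i \<in> A' \<and> dot K (r i) y = 1 \<and> dot K (r i) (d i) \<noteq> 0)
      \<and> (\<forall>i j. i < j \<longrightarrow> j < k \<longrightarrow> dot K (r i) (d j) = 0)" if "k \<le> K" for k
    using that
  proof (induction k)
    case 0
    \<comment> \<open>A strict solution of homogeneous inequalities is scaled until every product is
      at least 1; this is the starting point, with no tight row yet.\<close>
    define c where "c = Max (insert 0 ((\<lambda>a. 1 / dot K a x) ` A'))"
    have "dot K a (\<lambda>t. 0 + c * x t) \<ge> 1" if "a \<in> A'" for a
    proof -
      have "1 / dot K a x \<le> c" unfolding c_def by (rule Max_ge) (use fin' that in auto)
      then show ?thesis using x'[OF that] unfolding dot_add_scaled by (simp add: dot_def field_simps)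
    qed
    then show ?case by (intro exI[of _ "\<lambda>t. 0 + c * x t"]) auto
  next
    case (Suc k)
    then obtain y r d where y: "\<forall>a\<in>A'. dot K a y \<ge> 1"
      and r: "\<forall>i<k. r i \<in> A' \<and> dot K (r i) y = 1 \<and> dot K (r i) (d i) \<noteq> 0"
      and tri: "\<forall>i j. i < j \<longrightarrow> j < k \<longrightarrow> dot K (r i) (d j) = 0" by force
    obtain w t where w: "t < K" "w t < 0" "\<forall>i<k. dot K (r i) w = 0"
      using exists_orthogonal_direction[of k K r] Suc.prems by auto
    \<comment> \<open>The rows that decrease along \<open>w\<close>. The unit row of its negative
      coordinate is among them.\<close>
    define N where "N = {a \<in> A'. dot K a w < 0}"
    have N: "finite N" "N \<noteq> {}"
      using fin' w dot_e[OF w(1), of w] by (auto simp: N_def A'_def)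
    \<comment> \<open>Ratio test: \<open>\<theta> a\<close> is the step length at which row
      \<open>a\<close> becomes tight, and the minimum over \<open>N\<close> is the longest step that
      keeps all rows satisfied.\<close>
    define \<theta> where "\<theta> a = (dot K a y - 1) / - dot K a w" for a
    obtain b where b: "b \<in> N" "\<And>a. a \<in> N \<Longrightarrow> \<theta> b \<le> \<theta> a"
      using ex_min_if_finite[of "\<theta> ` N"] N
      by (metis (no_types, lifting) arg_min_if_finite(1) arg_min_least)
    define y' where "y' = (\<lambda>t. y t + \<theta> b * w t)"
    have dot_y': "dot K a y' = dot K a y + \<theta> b * dot K a w" for a
      unfolding y'_def by (rule dot_add_scaled)
    have "\<theta> b \<ge> 0" using b(1) y by (auto simp: \<theta>_def N_def zero_le_divide_iff divide_le_0_iff)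
    have 1: "dot K a y' \<ge> 1" if "a \<in> A'" for a
    proof (cases "a \<in> N")
      case True
      then have neg: "dot K a w < 0" by (simp add: N_def)
      have "\<theta> b \<le> (dot K a y - 1) / - dot K a w" using b(2)[OF True] by (simp add: \<theta>_def)
      then have "\<theta> b * - dot K a w \<le> dot K a y - 1" using neg by (subst (asm) pos_le_divide_eq) auto
      then show ?thesis by (simp add: dot_y')
    next
      case False
      then have "\<theta> b * dot K a w \<ge> 0" using that \<open>\<theta> b \<ge> 0\<close> by (simp add: N_def)
      then show ?thesis using y that by (force simp: dot_y')
    qed
    have 2: "dot K b y' = 1" "b \<in> A'" "dot K b w \<noteq> 0"
      using b(1) by (auto simp: N_def dot_y' \<theta>_def)
    \<comment> \<open>Rows found earlier are orthogonal to \<open>w\<close>: they stay tight, and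
      the new column of the triangular matrix vanishes above the diagonal.\<close>
    show ?case
      by (intro exI[of _ y'] exI[of _ "r(k := b)"] exI[of _ "d(k := w)"])
        (use 1 2 r tri w in \<open>auto simp: less_Suc_eq dot_y'\<close>)
  qed
  then obtain y r d where y: "\<forall>a\<in>A'. dot K a y \<ge> 1"
    and r: "\<forall>i<K. r i \<in> A' \<and> dot K (r i) y = 1 \<and> dot K (r i) (d i) \<noteq> 0"
    and tri: "\<forall>i j. i < j \<longrightarrow> j < K \<longrightarrow> dot K (r i) (d j) = 0" by blast
  have "\<bar>y t\<bar> \<le> (4 * real K) ^ K" if "t < K" for t
    by (rule integer_system_solution_bound[where r = r and d = d]) (use r tri B' that in auto)
  then show ?thesis using y by (auto simp: A'_def)
qed

section \<open>Buckets and boxes\<close>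

lemma card_UN_le_mult:
  assumes "finite I" "\<And>i. i \<in> I \<Longrightarrow> card (F i) \<le> c"
  shows "card (\<Union>i\<in>I. F i) \<le> card I * c"
  using card_UN_le[OF assms(1), of F] sum_bounded_above[of I "\<lambda>i. card (F i)" c] assms(2) by force

lemma card_le_if_diff_less:
  fixes A :: "nat set"
  assumes "finite A" "\<And>a b. a \<in> A \<Longrightarrow> b \<in> A \<Longrightarrow> b < a + c"
  shows "card A \<le> c"
proof (cases "A = {}")
  case False
  then have "A \<subseteq> {Min A..<Min A + c}" using assms(1) assms(2)[OF Min_in[OF assms(1)]] by auto
  from card_mono[OF _ this] show ?thesis by simp
qed simp

type_synonym triples = "(nat \<times> nat \<times> nat) set"

definition violated :: "(nat \<Rightarrow> real) \<Rightarrow> triples \<Rightarrow> triples" where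
  "violated f T = T - lloc_satisfied f T"

definition box_count :: "triples \<Rightarrow> (nat \<Rightarrow> nat) \<Rightarrow> nat \<Rightarrow> nat \<Rightarrow> nat \<Rightarrow> nat" where
  "box_count T g i j k = card {(u, v, w) \<in> T. g u = i \<and> g v = j \<and> g w = k}"

text \<open>Votes in box \<open>(i, k, j)\<close> say that \<open>k\<close> is closer to
  \<open>i\<close> than \<open>j\<close>. If they are few, \<open>j\<close> should be the closer
  one, that is \<open>x i - x j < x k - x i\<close>. The threshold \<open>L ^ 3 / 128\<close> is
  half of the \<open>L ^ 3 / 64\<close> triples that would cast such votes if the sampled solution
  failed the inequality; the other half leaves room for violated constraints.\<close>

definition up_constraint :: "triples \<Rightarrow> (nat \<Rightarrow> nat) \<Rightarrow> nat \<Rightarrow> nat \<Rightarrow> nat \<Rightarrow> nat \<Rightarrow> bool" where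
  "up_constraint T g L i j k \<longleftrightarrow> j < i \<and> i < k \<and> 128 * box_count T g i k j < L ^ 3"

text \<open>The case \<open>j = k\<close> encodes monotonicity \<open>x j < x i\<close> as
  \<open>x j + x j < x i + x i\<close>, so that every inequality compares two sums of two
  values.\<close>

definition down_constraint :: "triples \<Rightarrow> (nat \<Rightarrow> nat) \<Rightarrow> nat \<Rightarrow> nat \<Rightarrow> nat \<Rightarrow> nat \<Rightarrow> bool" where
  "down_constraint T g L i j k \<longleftrightarrow>
     j < i \<and> i < k \<and> 128 * box_count T g i j k < L ^ 3 \<or> j < i \<and> j = k"

text \<open>The number type is left open: the program stores integer values, while existence is
  shown over the reals.\<close>

definition feasible :: "triples \<Rightarrow> (nat \<Rightarrow> nat) \<Rightarrow> nat \<Rightarrow> nat \<Rightarrow> (nat \<Rightarrow> 'a :: linordered_idom) \<Rightarrow> bool" where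
  "feasible T g L K x \<longleftrightarrow> (\<forall>i<K. \<forall>j<K. \<forall>k<K.
     (up_constraint T g L i j k \<longrightarrow> x i + x i < x j + x k) \<and>
     (down_constraint T g L i j k \<longrightarrow> x j + x k < x i + x i))"

lemma feasibleD:
  assumes "feasible T g L K x" "i < K" "j < K" "k < K"
  shows "up_constraint T g L i j k \<Longrightarrow> x i + x i < x j + x k"
    and "down_constraint T g L i j k \<Longrightarrow> x j + x k < x i + x i"
  using assms unfolding feasible_def by blast+

text \<open>This is \<open>min (K - 1) (z div L)\<close>, written as a count because the program
  cannot divide. The fewer than \<open>L\<close> leftover ranks join the last bucket.\<close>

definition bucket :: "nat \<Rightarrow> nat \<Rightarrow> nat \<Rightarrow> nat" where
  "bucket L K z = card {j. 0 < j \<and> j < K \<and> j * L \<le> z}"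

lemma bucket_bounds:
  assumes "L > 0" "K > 0"
  shows "bucket L K z < K" "bucket L K z * L \<le> z" "bucket L K z + 1 < K \<Longrightarrow> z < (bucket L K z + 1) * L"
proof -
  have eq: "{j. 0 < j \<and> j < K \<and> j * L \<le> z} = {1..min (K - 1) (z div L)}"
    using assms by (auto simp: less_eq_div_iff_mult_less_eq)
  have b: "bucket L K z = min (K - 1) (z div L)" by (simp add: bucket_def eq)
  show "bucket L K z < K" using b assms by simp
  have "bucket L K z * L \<le> z div L * L" by (rule mult_le_mono1) (simp add: b)
  then show "bucket L K z * L \<le> z" using div_times_less_eq_dividend order_trans by blast
  assume "bucket L K z + 1 < K"
  then have "bucket L K z = z div L" using b by auto
  then show "z < (bucket L K z + 1) * L" using assms
    by (metis add.commute dividend_less_div_times mult.commute mult_Suc_right plus_1_eq_Suc add.left_commute)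
qed

section \<open>Ranks, displaced points and the order of buckets\<close>

locale bucketing =
  fixes n L K :: nat and T :: triples and f :: "nat \<Rightarrow> real" and s :: "nat \<Rightarrow> nat"
  assumes inst: "lloc_instance n T"
    and inj: "inj_on f {1..n}"
    and L: "L > 0" and K: "K > 0" and KL: "K * L \<le> n" "n < (K + 1) * L"
begin

definition r :: "nat \<Rightarrow> nat" where "r u = card {v \<in> {1..n}. f v < f u}"
text \<open>The tolerated displacement. Rounding down makes it 0 for \<open>L < 8\<close>, where
  points outside \<open>W\<close> have exact scores.\<close>

definition h :: nat where "h = L div 8"
definition W :: "nat set" where "W = {u \<in> {1..n}. s u + h < r u \<or> r u + h < s u}"
definition g :: "nat \<Rightarrow> nat" where "g u = bucket L K (s u)"
abbreviation G :: "nat set" where "G \<equiv> {1..n} - W"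

lemma h8: "8 * h \<le> L" by (simp add: h_def)

lemma TD: "(u, v, w) \<in> T \<Longrightarrow> u \<in> {1..n} \<and> v \<in> {1..n} \<and> w \<in> {1..n} \<and> u \<noteq> v \<and> u \<noteq> w \<and> v \<noteq> w"
  using inst by (force simp: lloc_instance_def)

lemma T_total:
  "u \<in> {1..n} \<Longrightarrow> v \<in> {1..n} \<Longrightarrow> w \<in> {1..n} \<Longrightarrow> distinct [u, v, w] \<Longrightarrow> (u, v, w) \<notin> T \<Longrightarrow> (u, w, v) \<in> T"
  using inst unfolding lloc_instance_def by blast

lemma T_sub: "T \<subseteq> {1..n} \<times> {1..n} \<times> {1..n}" using TD by auto

lemma finite_T: "finite T" using T_sub by (rule finite_subset) auto

lemma not_violatedD: "(u, v, w) \<in> T \<Longrightarrow> (u, v, w) \<notin> violated f T \<Longrightarrow> \<bar>f u - f v\<bar> < \<bar>f u - f w\<bar>"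
  by (simp add: violated_def lloc_satisfied_def)

lemma violatedI: "(u, v, w) \<in> T \<Longrightarrow> \<not> \<bar>f u - f v\<bar> < \<bar>f u - f w\<bar> \<Longrightarrow> (u, v, w) \<in> violated f T"
  by (simp add: violated_def lloc_satisfied_def)

lemma r_less:
  assumes "u \<in> {1..n}" "f u < f v"
  shows "r u < r v"
  unfolding r_def by (rule psubset_card_mono) (use assms in auto)

lemma r_less_iff: "u \<in> {1..n} \<Longrightarrow> v \<in> {1..n} \<Longrightarrow> r u < r v \<longleftrightarrow> f u < f v"
  using r_less[of u v] r_less[of v u] inj by (metis inj_onD less_asym linorder_neqE_linordered_idom less_irrefl)

lemma r_le_iff: "u \<in> {1..n} \<Longrightarrow> v \<in> {1..n} \<Longrightarrow> r u \<le> r v \<longleftrightarrow> f u \<le> f v"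
  using r_less_iff by (meson not_le)

lemma r_bij: "bij_betw r {1..n} {0..<n}"
proof -
  have 1: "inj_on r {1..n}"
    by (intro inj_onI inj_onD[OF inj] antisym) (simp_all flip: r_le_iff)
  have "r u < n" if "u \<in> {1..n}" for u
  proof -
    have "u \<notin> {v \<in> {1..n}. f v < f u}" by simp
    then have "{v \<in> {1..n}. f v < f u} \<subset> {1..n}" using that by blast
    then have "r u < card {1..n}" unfolding r_def by (intro psubset_card_mono) simp_all
    then show ?thesis by simp
  qed
  then have "r ` {1..n} \<subseteq> {0..<n}" by auto
  then have "r ` {1..n} = {0..<n}" by (intro card_subset_eq[of "{0..<n}"]) (use card_image[OF 1] in simp_all)
  with 1 show ?thesis by (simp add: bij_betw_def)
qed

lemma r_lt_n: "u \<in> {1..n} \<Longrightarrow> r u < n"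
  using r_bij by (meson atLeastLessThan_iff bij_betwE)

lemma card_rank_range_le: "card {u \<in> {1..n}. a \<le> r u \<and> r u < b} \<le> b - a"
proof -
  have "r ` {u \<in> {1..n}. a \<le> r u \<and> r u < b} \<subseteq> {a..<b}" by auto
  moreover have "inj_on r {u \<in> {1..n}. a \<le> r u \<and> r u < b}"
    using r_bij by (auto simp: bij_betw_def intro: inj_on_subset)
  ultimately have "card {u \<in> {1..n}. a \<le> r u \<and> r u < b} \<le> card {a..<b}"
    by (intro card_inj_on_le) auto
  then show ?thesis by simp
qed

lemma card_rank_range_ge:
  assumes "b \<le> n"
  shows "b - a \<le> card {u \<in> {1..n}. a \<le> r u \<and> r u < b}"
proof -
  have "{a..<b} \<subseteq> r ` {u \<in> {1..n}. a \<le> r u \<and> r u < b}"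
  proof
    fix z assume z: "z \<in> {a..<b}"
    then have "z \<in> r ` {1..n}" using r_bij assms by (auto simp: bij_betw_def)
    then show "z \<in> r ` {u \<in> {1..n}. a \<le> r u \<and> r u < b}" using z by auto
  qed
  from surj_card_le[OF _ this] show ?thesis by simp
qed

lemma finite_W: "finite W" by (simp add: W_def)

lemma g_lt_K: "g u < K" using bucket_bounds[OF L K] by (simp add: g_def)

lemma g_low: "u \<in> G \<Longrightarrow> g u * L \<le> r u + h"
  using bucket_bounds(2)[OF L K, of "s u"] by (auto simp: g_def W_def not_less)

lemma g_high: "u \<in> G \<Longrightarrow> g u + 1 < K \<Longrightarrow> r u < (g u + 1) * L + h"
  using bucket_bounds(3)[OF L K, of "s u"] by (auto simp: g_def W_def not_less)

text \<open>The last bucket has no upper boundary of its own; there \<open>n < (K + 1) * L\<close>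
  takes over.\<close>

lemma g_high2: assumes "u \<in> G" shows "r u < (g u + 2) * L"
proof (cases "g u + 1 < K")
  case True
  then show ?thesis using g_high[OF assms True] h8 L by (simp add: algebra_simps)
next
  case False
  then have "K + 1 = g u + 2" using g_lt_K[of u] by simp
  then show ?thesis using r_lt_n[of u] KL(2) assms by auto
qed

lemma g_eqI:
  assumes "i * L \<le> z" "z < (i + 1) * L" "i < K"
  shows "bucket L K z = i"
proof (rule ccontr)
  let ?b = "bucket L K z"
  note bb = bucket_bounds[OF L K, of z]
  assume "?b \<noteq> i"
  then consider "?b < i" | "i < ?b" by linarith
  then show False
  proof cases
    case 1
    then have "?b + 1 < K" using assms by simp
    from bb(3)[OF this] have "z < (?b + 1) * L" .
    also have "\<dots> \<le> i * L" using 1 by (intro mult_le_mono1) simp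
    finally show False using assms(1) by linarith
  next
    case 2
    then have "(i + 1) * L \<le> ?b * L" by (intro mult_le_mono1) simp
    then show False using assms(2) bb(2) by linarith
  qed
qed

text \<open>Ranks of good points exceed the bucket boundaries by at most
  \<open>h \<le> L / 8\<close>, so a whole bucket in between fixes the order. For
  \<open>L < 8\<close> the tolerance \<open>h\<close> is 0 and neighbouring buckets are already
  separated.\<close>

lemma order_of_g:
  assumes "u \<in> G" "v \<in> G" "g u + 2 \<le> g v \<or> L < 8 \<and> g u < g v"
  shows "f u < f v"
proof -
  have "g u + 1 < K \<or> L < 8 \<and> g u + 1 < K" using assms(3) g_lt_K[of v] by auto
  then have ru: "r u < (g u + 1) * L + h" using g_high[OF assms(1)] by blast
  have rv: "g v * L \<le> r v + h" using g_low[OF assms(2)] .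
  have "r u < r v"
  proof (cases "L < 8")
    case True
    then have "(g u + 1) * L \<le> g v * L" using assms(3) by (intro mult_le_mono1) auto
    moreover have "h = 0" using True by (simp add: h_def)
    ultimately show ?thesis using ru rv by linarith
  next
    case False
    then have "(g u + 2) * L \<le> g v * L" using assms(3) by (intro mult_le_mono1) auto
    then have "(g u + 1) * L + L \<le> g v * L" by (simp add: algebra_simps)
    then show ?thesis using ru rv h8 by linarith
  qed
  then show ?thesis using r_less_iff[of u v] assms(1,2) by simp
qed

section \<open>Sampling the solution at the middle ranks of the buckets\<close>

definition xs :: "nat \<Rightarrow> real" where
  "xs i = f (the_inv_into {1..n} r (i * L + L div 2))"

text \<open>Good points in the lower half of bucket \<open>i\<close>, with \<open>Up i\<close> as
  the upper half. The margin \<open>h\<close> keeps the scores inside the bucket as well. Both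
  ranges contain the middle rank, so neither is empty for \<open>L = 1\<close>.\<close>

definition Lo :: "nat \<Rightarrow> nat set" where "Lo i = {u \<in> G. i * L + h \<le> r u \<and> r u < i * L + L div 2 + 1}"
definition Up :: "nat \<Rightarrow> nat set" where "Up i = {u \<in> G. i * L + L div 2 \<le> r u \<and> r u < (i + 1) * L - h}"

lemma mid_lt: "i < K \<Longrightarrow> i * L + L div 2 < (i + 1) * L \<and> (i + 1) * L \<le> n"
proof -
  assume "i < K"
  then have "(i + 1) * L \<le> K * L" by (intro mult_le_mono1) simp
  then show ?thesis using KL(1) L by simp
qed

lemma xs_point: assumes "i < K"
  obtains p where "p \<in> {1..n}" "r p = i * L + L div 2" "xs i = f p"
proof -
  let ?m = "i * L + L div 2"
  have m: "?m \<in> r ` {1..n}" using mid_lt[OF assms] r_bij by (auto simp: bij_betw_def)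
  have "inj_on r {1..n}" using r_bij by (simp add: bij_betw_def)
  then show ?thesis
    using that[of "the_inv_into {1..n} r ?m"] the_inv_into_into[of r "{1..n}" ?m "{1..n}"] m
    by (simp add: xs_def f_the_inv_into_f)
qed

lemma xs_less: assumes "j < i" "i < K" shows "xs j < xs i"
proof -
  obtain p where p: "p \<in> {1..n}" "r p = i * L + L div 2" "xs i = f p" using xs_point assms by blast
  obtain q where q: "q \<in> {1..n}" "r q = j * L + L div 2" "xs j = f q" using xs_point[of j] assms by auto
  have "j * L < i * L" using assms L by simp
  then have "r q < r p" using p q by simp
  then show ?thesis using r_less_iff[OF q(1) p(1)] p q by simp
qed

lemma Lo_le: assumes "i < K" "u \<in> Lo i" shows "f u \<le> xs i"
proof -
  obtain p where p: "p \<in> {1..n}" "r p = i * L + L div 2" "xs i = f p" using xs_point assms by blast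
  have u: "u \<in> {1..n}" using assms by (simp add: Lo_def)
  have "r u \<le> r p" using assms p by (auto simp: Lo_def)
  then show ?thesis using r_le_iff[OF u p(1)] p by simp
qed

lemma Up_ge: assumes "i < K" "u \<in> Up i" shows "xs i \<le> f u"
proof -
  obtain p where p: "p \<in> {1..n}" "r p = i * L + L div 2" "xs i = f p" using xs_point assms by blast
  have u: "u \<in> {1..n}" using assms by (simp add: Up_def)
  have "r p \<le> r u" using assms p by (auto simp: Up_def)
  then show ?thesis using r_le_iff[OF p(1) u] p by simp
qed

lemma Lo_Up_range:
  assumes "u \<in> Lo i \<union> Up i"
  shows "u \<in> G" "i * L + h \<le> r u" "r u + h < (i + 1) * L"
proof -
  have "L > 0 \<Longrightarrow> L div 2 + h < L" using h8 L by linarith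
  then have d: "L div 2 + h < L" using L by blast
  show "u \<in> G" using assms by (auto simp: Lo_def Up_def)
  show "i * L + h \<le> r u" using assms h8 L by (auto simp: Lo_def Up_def)
  show "r u + h < (i + 1) * L" using assms d by (auto simp: Lo_def Up_def)
qed

lemma Lo_Up_g:
  assumes "i < K" "u \<in> Lo i \<union> Up i"
  shows "g u = i"
  unfolding g_def by (rule g_eqI) (use Lo_Up_range[OF assms(2)] assms(1) in \<open>auto simp: W_def not_less\<close>)

lemma Lo_Up_less:
  assumes "j < i" "u \<in> Lo i \<union> Up i" "v \<in> Lo j \<union> Up j"
  shows "f v < f u"
proof -
  have "(j + 1) * L \<le> i * L" using assms(1) by (intro mult_le_mono1) simp
  then have "r v < r u" using Lo_Up_range[OF assms(2)] Lo_Up_range[OF assms(3)] by linarith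
  then show ?thesis using r_less_iff Lo_Up_range(1)[OF assms(2)] Lo_Up_range(1)[OF assms(3)] by auto
qed

end

text \<open>Both constants are measured against the threshold \<open>1 / 128\<close>: in a box,
  violated constraints account for at most \<open>L ^ 3 / 1000\<close> triples and displaced points
  for at most \<open>27 * card W * L ^ 2\<close>.\<close>

locale good_bucketing = bucketing +
  assumes W_small: "10000 * card W \<le> L"
    and violated_small: "1000 * card (violated f T) \<le> L ^ 3"
begin

lemma card_Lo_Up: assumes "i < K" shows "L \<le> 4 * card (Lo i)" "L \<le> 4 * card (Up i)"
proof -
  note m = mid_lt[OF assms]
  have *: "card {u \<in> {1..n}. a \<le> r u \<and> r u < b} \<le> card {u \<in> G. a \<le> r u \<and> r u < b} + card W" for a b
  proof -
    have "card {u \<in> {1..n}. a \<le> r u \<and> r u < b} \<le> card ({u \<in> G. a \<le> r u \<and> r u < b} \<union> W)"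
      by (rule card_mono) (use finite_W in auto)
    then show ?thesis using card_Un_le order_trans by blast
  qed
  have "(i * L + L div 2 + 1) - (i * L + h) \<le> card (Lo i) + card W"
    unfolding Lo_def by (rule order_trans[OF card_rank_range_ge *]) (use m in simp)
  then show "L \<le> 4 * card (Lo i)" using W_small h8 by linarith
  have "((i + 1) * L - h) - (i * L + L div 2) \<le> card (Up i) + card W"
    unfolding Up_def by (rule order_trans[OF card_rank_range_ge *]) (use m in linarith)
  then show "L \<le> 4 * card (Up i)" using W_small h8 by (simp add: algebra_simps)
qed

lemma finite_Lo_Up: "finite (Lo i)" "finite (Up i)" by (auto simp: Lo_def Up_def)

lemma cube_le:
  assumes "L \<le> 4 * a" "L \<le> 4 * b" "L \<le> 4 * (c::nat)"
  shows "L ^ 3 \<le> 64 * (a * (b * c))"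
proof -
  have "L * (L * L) \<le> (4 * a) * ((4 * b) * (4 * c))" using assms by (intro mult_le_mono)
  then show ?thesis by (simp add: power3_eq_cube mult.assoc)
qed

text \<open>A triple of \<open>X\<close> that is not a vote of the box is charged to its violated
  mirror image, and \<open>1 / 64 - 1 / 1000\<close> exceeds \<open>1 / 128\<close>.\<close>

lemma box_count_ge:
  assumes X: "finite X" "L ^ 3 \<le> 64 * card X"
    and sub: "X \<subseteq> {(u, v, w) \<in> T. g u = i \<and> g v = j \<and> g w = k} \<union> (\<lambda>(u, v, w). (u, w, v)) ` violated f T"
  shows "L ^ 3 \<le> 128 * box_count T g i j k"
proof -
  have fin: "finite {(u, v, w) \<in> T. g u = i \<and> g v = j \<and> g w = k}" "finite (violated f T)"
    using finite_T by (auto simp: violated_def intro: finite_subset)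
  have "card X \<le> box_count T g i j k + card (violated f T)"
    unfolding box_count_def
    by (rule order_trans[OF card_mono[OF _ sub]])
      (intro finite_UnI finite_imageI fin order_trans[OF card_Un_le] add_mono card_image_le order_refl)+
  then show ?thesis using X(2) violated_small by linarith
qed

text \<open>By density \<open>T\<close> contains \<open>(u, v, w)\<close> or
  \<open>(u, w, v)\<close>, and by \<open>votes\<close> the latter would be violated. Up to
  violations, the whole product set votes in the box.\<close>

lemma extreme_votes:
  assumes lt: "i < K" "j < K" "k < K"
    and X: "X = Lo i \<or> X = Up i" and Y: "Y = Lo j \<or> Y = Up j" and Z: "Z = Lo k \<or> Z = Up k"
    and votes: "\<And>u v w. u \<in> X \<Longrightarrow> v \<in> Y \<Longrightarrow> w \<in> Z \<Longrightarrow> distinct [u, v, w] \<and> \<not> \<bar>f u - f w\<bar> < \<bar>f u - f v\<bar>"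
  shows "L ^ 3 \<le> 128 * box_count T g i j k"
proof (rule box_count_ge)
  have "L \<le> 4 * card X" "L \<le> 4 * card Y" "L \<le> 4 * card Z" using X Y Z card_Lo_Up lt by blast+
  from cube_le[OF this] show "L ^ 3 \<le> 64 * card (X \<times> Y \<times> Z)" by (simp add: card_cartesian_product)
  show "finite (X \<times> Y \<times> Z)" using X Y Z finite_Lo_Up by auto
  show "X \<times> Y \<times> Z \<subseteq> {(u, v, w) \<in> T. g u = i \<and> g v = j \<and> g w = k} \<union>
      (\<lambda>(u, v, w). (u, w, v)) ` violated f T"
  proof clarify
    fix u v w assume m: "u \<in> X" "v \<in> Y" "w \<in> Z" and nv: "(u, v, w) \<notin> (\<lambda>(u, v, w). (u, w, v)) ` violated f T"
    have r: "u \<in> Lo i \<union> Up i" "v \<in> Lo j \<union> Up j" "w \<in> Lo k \<union> Up k" using m X Y Z by blast+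
    have "(u, w, v) \<notin> T" using violatedI[of u w v] votes[OF m] nv by force
    moreover have "u \<in> {1..n}" "v \<in> {1..n}" "w \<in> {1..n}" using r by (auto simp: Lo_def Up_def)
    moreover have "distinct [u, w, v]" using votes[OF m] by auto
    ultimately have "(u, v, w) \<in> T" using T_total by blast
    then show "(u, v, w) \<in> T \<and> g u = i \<and> g v = j \<and> g w = k" using Lo_Up_g lt r by blast
  qed
qed

lemma feasible_xs: "feasible T g L K xs"
  unfolding feasible_def
proof (intro allI impI conjI)
  fix i j k assume ijk: "i < K" "j < K" "k < K"
  { assume up: "up_constraint T g L i j k"
    then have o: "j < i" "i < k" "128 * box_count T g i k j < L ^ 3" by (auto simp: up_constraint_def)
    show "xs i + xs i < xs j + xs k"
    proof (rule ccontr)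
      assume neg: "\<not> ?thesis"
      have "L ^ 3 \<le> 128 * box_count T g i k j"
      \<comment> \<open>If the inequality fails at the middle ranks, moving \<open>u\<close> to the
        right and \<open>v\<close>, \<open>w\<close> to the left preserves
        \<open>f v + f w \<le> 2 * f u\<close>, so all these points vote against
        \<open>up_constraint\<close>. The other orientation is the mirror image.\<close>
      proof (rule extreme_votes[where X = "Up i" and Y = "Lo k" and Z = "Lo j"])
        fix u w v assume m: "u \<in> Up i" "w \<in> Lo k" "v \<in> Lo j"
        have "f v < f u" "f u < f w" using Lo_Up_less[of j i u v] Lo_Up_less[of i k w u] o m by auto
        moreover have "f v + f w \<le> f u + f u"
          using Lo_le[of j v] Lo_le[of k w] Up_ge[of i u] m ijk neg by linarith
        ultimately show "distinct [u, w, v] \<and> \<not> \<bar>f u - f v\<bar> < \<bar>f u - f w\<bar>" by auto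
      qed (use ijk in simp_all)
      then show False using o by simp
    qed
  }
  { assume down: "down_constraint T g L i j k"
    show "xs j + xs k < xs i + xs i"
    proof (cases "j = k")
      case True
      then show ?thesis using down xs_less[of j i] ijk by (auto simp: down_constraint_def)
    next
      case False
      then have o: "j < i" "i < k" "128 * box_count T g i j k < L ^ 3"
        using down by (auto simp: down_constraint_def)
      show ?thesis
      proof (rule ccontr)
        assume neg: "\<not> ?thesis"
        have "L ^ 3 \<le> 128 * box_count T g i j k"
        proof (rule extreme_votes[where X = "Lo i" and Y = "Up j" and Z = "Up k"])
          fix u v w assume m: "u \<in> Lo i" "v \<in> Up j" "w \<in> Up k"
          have "f v < f u" "f u < f w" using Lo_Up_less[of j i u v] Lo_Up_less[of i k w u] o m by auto
          moreover have "f u + f u \<le> f v + f w"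
            using Up_ge[of j v] Up_ge[of k w] Lo_le[of i u] m ijk neg by linarith
          ultimately show "distinct [u, v, w] \<and> \<not> \<bar>f u - f w\<bar> < \<bar>f u - f v\<bar>" by auto
        qed (use ijk in simp_all)
        then show False using o by simp
      qed
    qed
  }
qed

text \<open>The ranks of good points fill a range of length at most \<open>2 * L + h\<close>, also
  in the last bucket; the displaced points come on top.\<close>

lemma card_bucket_le: "card {u \<in> {1..n}. g u = i} \<le> 3 * L"
proof -
  have "card {u \<in> {1..n}. g u = i} \<le> card ({u \<in> {1..n}. i * L - h \<le> r u \<and> r u < (i + 2) * L} \<union> W)"
  proof (rule card_mono)
    show "{u \<in> {1..n}. g u = i} \<subseteq> {u \<in> {1..n}. i * L - h \<le> r u \<and> r u < (i + 2) * L} \<union> W"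
      using g_low g_high2 by (fastforce simp: le_diff_conv)
  qed (use finite_W in auto)
  also have "\<dots> \<le> ((i + 2) * L - (i * L - h)) + card W"
    by (intro order_trans[OF card_Un_le] add_mono card_rank_range_le order_refl)
  also have "\<dots> \<le> 3 * L"
  proof -
    have "(i + 2) * L \<le> (i * L - h) + (2 * L + h)" by (simp add: algebra_simps)
    then show ?thesis using h8 W_small by linarith
  qed
  finally show ?thesis .
qed

text \<open>Too many votes for an orientation to be explained by violated constraints and displaced points.\<close>

lemma box_witness:
  assumes "L ^ 3 \<le> 128 * box_count T g i j k"
  obtains u v w where "(u, v, w) \<in> T" "(u, v, w) \<notin> violated f T" "u \<in> G" "v \<in> G" "w \<in> G"
    "g u = i" "g v = j" "g w = k"
proof (rule ccontr)
  assume no: "\<not> thesis"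
  define B where "B i = {u \<in> {1..n}. g u = i}" for i
  have fB: "finite (B i)" for i by (simp add: B_def)
  have cB: "card (B i) \<le> 3 * L" for i unfolding B_def by (rule card_bucket_le)
  \<comment> \<open>Without a witness every vote is violated or has a displaced entry. In the latter
    case the other two entries lie in buckets of at most \<open>3 * L\<close> points.\<close>
  let ?X = "violated f T \<union> (W \<times> B j \<times> B k \<union> (B i \<times> W \<times> B k \<union> B i \<times> B j \<times> W))"
  have fin: "finite (violated f T)" using finite_T by (auto simp: violated_def)
  have "box_count T g i j k \<le> card ?X"
    unfolding box_count_def
  proof (rule card_mono)
    show "{(u, v, w) \<in> T. g u = i \<and> g v = j \<and> g w = k} \<subseteq> ?X"
    proof
      fix z assume "z \<in> {(u, v, w) \<in> T. g u = i \<and> g v = j \<and> g w = k}"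
      then obtain u v w where z: "z = (u, v, w)" and uvw: "(u, v, w) \<in> T" "g u = i" "g v = j" "g w = k"
        by auto
      have V: "u \<in> {1..n}" "v \<in> {1..n}" "w \<in> {1..n}" using TD[OF uvw(1)] by auto
      then have B: "u \<in> B i" "v \<in> B j" "w \<in> B k" using uvw(2-4) unfolding B_def by blast+
      show "z \<in> ?X"
      proof (rule ccontr)
        assume nx: "z \<notin> ?X"
        then have "u \<in> G" "v \<in> G" "w \<in> G" using V B unfolding z by blast+
        moreover have "(u, v, w) \<notin> violated f T" using nx z by blast
        ultimately have thesis using that[OF uvw(1) _ _ _ _ uvw(2-4)] by blast
        with no show False by blast
      qed
    qed
  qed (use fin fB finite_W in auto)
  also have "\<dots> \<le> card (violated f T) + (card W * (card (B j) * card (B k)) +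
      (card (B i) * (card W * card (B k)) + card (B i) * (card (B j) * card W)))"
    by (intro order_trans[OF card_Un_le] add_mono order_refl) (auto simp: card_cartesian_product)
  also have "\<dots> \<le> card (violated f T) + (card W * (3 * L * (3 * L)) +
      (3 * L * (card W * (3 * L)) + 3 * L * (3 * L * card W)))"
    by (intro add_mono mult_le_mono order_refl cB)
  also have "\<dots> = card (violated f T) + 27 * (card W * (L * L))" by simp
  finally have 1: "box_count T g i j k \<le> card (violated f T) + 27 * (card W * (L * L))" .
  have 2: "10000 * (card W * (L * L)) \<le> L ^ 3"
    using mult_le_mono1[OF W_small, of "L * L"] by (simp add: power3_eq_cube mult.assoc)
  have 3: "L ^ 3 > 0" using L by simp
  \<comment> \<open>\<open>1 / 1000 + 27 / 10000 < 1 / 128\<close>.\<close>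
  show False using 1 2 3 assms violated_small by linarith
qed

section \<open>Boxes in which the comparison changes sign\<close>

definition S :: "nat \<Rightarrow> nat \<Rightarrow> nat \<Rightarrow> real" where "S u v w = 2 * f u - f v - f w"

text \<open>If \<open>u\<close> lies between \<open>v\<close> and \<open>w\<close>, the sign of
  \<open>S\<close> decides which of them is closer. A solution that is constant on buckets cannot be
  right for both signs in one box, so these triples are given up.\<close>

definition neg_cross :: triples where
  "neg_cross = {(u, v, w). u \<in> G \<and> v \<in> G \<and> w \<in> G \<and> S u v w < 0 \<and>
     (\<exists>u'\<in>G. \<exists>v'\<in>G. \<exists>w'\<in>G. g u' = g u \<and> g v' = g v \<and> g w' = g w \<and> S u' v' w' > 0)}"

definition pos_cross :: triples where
  "pos_cross = {(u, v, w). u \<in> G \<and> v \<in> G \<and> w \<in> G \<and> S u v w > 0 \<and>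
     (\<exists>u'\<in>G. \<exists>v'\<in>G. \<exists>w'\<in>G. g u' = g u \<and> g v' = g v \<and> g w' = g w \<and> S u' v' w' < 0)}"

text \<open>The bucket pairs to which \<open>order_of_g\<close> applies in one of the two
  directions.\<close>

definition far :: "nat \<Rightarrow> nat \<Rightarrow> bool" where
  "far i j \<longleftrightarrow> i + 2 \<le> j \<or> j + 2 \<le> i \<or> L < 8 \<and> i \<noteq> j"

lemma far_sym: "far i j \<longleftrightarrow> far j i" by (auto simp: far_def)

lemma far_order: "u \<in> G \<Longrightarrow> v \<in> G \<Longrightarrow> far (g u) (g v) \<Longrightarrow> g u < g v \<Longrightarrow> f u < f v"
  by (rule order_of_g) (auto simp: far_def)

text \<open>If \<open>u\<close> is on one side of both \<open>v\<close> and \<open>w\<close>, their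
  order decides, and the monotone \<open>x\<close> gets it right. If \<open>u\<close> is between
  them and \<open>x\<close> is wrong, the inequality that would have forced the right answer is
  absent from the system, so the box has at least \<open>L ^ 3 / 128\<close> opposite votes. One of
  these is satisfied by \<open>f\<close> at good points, and there \<open>S\<close> has the opposite
  sign.\<close>

lemma unsatisfied_cross:
  fixes x :: "nat \<Rightarrow> real"
  assumes x: "feasible T g L K x"
    and uvw: "(u, v, w) \<in> T" "(u, v, w) \<notin> violated f T" "u \<in> G" "v \<in> G" "w \<in> G"
    and far: "far (g u) (g v)" "far (g u) (g w)" "far (g v) (g w)"
    and unsat: "\<not> \<bar>x (g u) - x (g v)\<bar> < \<bar>x (g u) - x (g w)\<bar>"
  shows "(u, v, w) \<in> neg_cross \<union> pos_cross"
proof -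
  note nv = not_violatedD[OF uvw(1,2)]
  \<comment> \<open>Monotonicity is the degenerate case of \<open>down_constraint\<close>.\<close>
  have mono: "x i < x j" if "i < j" "j < K" for i j
  proof -
    have "down_constraint T g L j i i" using that by (simp add: down_constraint_def)
    then have "x i + x i < x j + x j"
      by (rule feasibleD(2)[OF x that(2) less_trans[OF that] less_trans[OF that]])
    then show ?thesis by simp
  qed
  have ne: "g u \<noteq> g v" "g u \<noteq> g w" "g v \<noteq> g w" using far by (auto simp: far_def)
  note sy = far[THEN far_sym[THEN iffD1]]
  note ord = far_order[OF uvw(3,4) far(1)] far_order[OF uvw(3,5) far(2)] far_order[OF uvw(4,5) far(3)]
    far_order[OF uvw(4,3) sy(1)] far_order[OF uvw(5,3) sy(2)] far_order[OF uvw(5,4) sy(3)]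
  \<comment> \<open>A satisfied opposite vote in the same box flips the sign of \<open>S\<close>,
    because far buckets fix the order of its points. Both mirror images of the order are treated at
    once.\<close>
  have crossing: "(if f v < f u then S u' v' w' > 0 else S u' v' w' < 0)"
    if "(u', w', v') \<in> T" "(u', w', v') \<notin> violated f T" "u' \<in> G" "w' \<in> G" "v' \<in> G"
      "g u' = g u" "g w' = g w" "g v' = g v"
      "f v < f u \<and> g v < g u \<and> g u < g w \<or> f u < f v \<and> g w < g u \<and> g u < g v" for u' v' w'
  proof -
    have far': "far (g u') (g v')" "far (g v') (g u')" "far (g u') (g w')" "far (g w') (g u')"
      using far sy that(6-8) by simp_all
    show ?thesis
    proof (cases "f v < f u")
      case True
      then have "g v' < g u'" "g u' < g w'" using that by auto
      then have "f v' < f u'" "f u' < f w'"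
        using far_order[OF that(5,3) far'(2)] far_order[OF that(3,4) far'(3)] by auto
      then show ?thesis using True not_violatedD[OF that(1,2)] by (simp add: S_def)
    next
      case False
      then have "g w' < g u'" "g u' < g v'" using that by auto
      then have "f w' < f u'" "f u' < f v'"
        using far_order[OF that(4,3) far'(4)] far_order[OF that(3,5) far'(1)] by auto
      then show ?thesis using False not_violatedD[OF that(1,2)] by (simp add: S_def)
    qed
  qed
  consider "g u < g v" "g u < g w" | "g v < g u" "g w < g u" | "g v < g u" "g u < g w" | "g w < g u" "g u < g v"
    using ne by linarith
  then show ?thesis
  proof cases
    case 1
    have "f v < f w" using ord(1)[OF 1(1)] ord(2)[OF 1(2)] nv by simp
    then have "g v < g w" using ord(6) ne(3) by force
    then show ?thesis using unsat mono[OF 1(1) g_lt_K] mono[of "g v" "g w", OF _ g_lt_K] by simp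
  next
    case 2
    have "f w < f v" using ord(4)[OF 2(1)] ord(5)[OF 2(2)] nv by simp
    then have "g w < g v" using ord(3) ne(3) by force
    then show ?thesis using unsat mono[OF 2(1) g_lt_K] mono[of "g w" "g v", OF _ g_lt_K] by simp
  next
    case 3
    have f: "f v < f u" "f u < f w" using ord 3 by auto
    then have neg: "S u v w < 0" using nv by (simp add: S_def)
    have "\<not> x (g u) + x (g u) < x (g v) + x (g w)"
      using unsat mono[OF 3(1) g_lt_K] mono[OF 3(2) g_lt_K] by simp
    then have "\<not> up_constraint T g L (g u) (g v) (g w)" using feasibleD(1)[OF x g_lt_K g_lt_K g_lt_K] by blast
    then have "L ^ 3 \<le> 128 * box_count T g (g u) (g w) (g v)" using 3 by (simp add: up_constraint_def)
    then obtain u' w' v' where p: "(u', w', v') \<in> T" "(u', w', v') \<notin> violated f T" "u' \<in> G" "w' \<in> G" "v' \<in> G"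
      "g u' = g u" "g w' = g w" "g v' = g v" by (rule box_witness)
    have "S u' v' w' > 0" using crossing[OF p] f 3 by simp
    then have "(u, v, w) \<in> neg_cross" using neg p(3-8) uvw(3-5) unfolding neg_cross_def by blast
    then show ?thesis by blast
  next
    case 4
    have f: "f w < f u" "f u < f v" using ord 4 by auto
    then have pos: "S u v w > 0" using nv by (simp add: S_def)
    have "\<not> x (g w) + x (g v) < x (g u) + x (g u)"
      using unsat mono[OF 4(1) g_lt_K] mono[OF 4(2) g_lt_K] by simp
    then have "\<not> down_constraint T g L (g u) (g w) (g v)" using feasibleD(2)[OF x g_lt_K g_lt_K g_lt_K] by blast
    then have "L ^ 3 \<le> 128 * box_count T g (g u) (g w) (g v)" using 4 by (simp add: down_constraint_def)
    then obtain u' w' v' where p: "(u', w', v') \<in> T" "(u', w', v') \<notin> violated f T" "u' \<in> G" "w' \<in> G" "v' \<in> G"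
      "g u' = g u" "g w' = g w" "g v' = g v" by (rule box_witness)
    have "S u' v' w' < 0" using crossing[OF p] f 4 by simp
    then have "(u, v, w) \<in> pos_cross" using pos p(3-8) uvw(3-5) unfolding pos_cross_def by blast
    then show ?thesis by blast
  qed
qed

lemma same_bucket_rank:
  assumes "u \<in> G" "u' \<in> G" "g u \<le> g u' + 1"
  shows "r u < r u' + 4 * L" "g u = g u' \<Longrightarrow> r u < r u' + 3 * L"
proof -
  have "(g u + 2) * L \<le> (g u' + 3) * L" using assms(3) by (intro mult_le_mono1) simp
  then have "r u < g u' * L + 3 * L" using g_high2[OF assms(1)] by (simp add: add_mult_distrib)
  then show "r u < r u' + 4 * L" using g_low[OF assms(2)] h8 by linarith
  assume "g u = g u'"
  then have "r u < g u' * L + 2 * L" using g_high2[OF assms(1)] by (simp add: add_mult_distrib)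
  then show "r u < r u' + 3 * L" using g_low[OF assms(2)] h8 by linarith
qed

lemma same_bucket_rank_eq: "u \<in> G \<Longrightarrow> u' \<in> G \<Longrightarrow> g u = g u' \<Longrightarrow> r u < r u' + 3 * L"
  by (rule same_bucket_rank(2)) simp_all

text \<open>A diagonal fixes \<open>r u + r v\<close> and \<open>r u + r w\<close>. There are at
  most \<open>(2 * n) ^ 2\<close> of them, and on each the triple is determined by
  \<open>r u\<close>, which takes at most \<open>3 * L\<close> values by
  \<open>diag\<close>.\<close>

lemma card_diagonal_le:
  assumes X: "X \<subseteq> {1..n} \<times> {1..n} \<times> {1..n}"
    and diag: "\<And>u v w u2 v2 w2. (u, v, w) \<in> X \<Longrightarrow> (u2, v2, w2) \<in> X \<Longrightarrow> r u + r v = r u2 + r v2 \<Longrightarrow>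
      r u + r w = r u2 + r w2 \<Longrightarrow> r u2 < r u + 3 * L"
  shows "card X \<le> 12 * (L * n\<^sup>2)"
proof -
  define F where "F = (\<lambda>(p, q). {(u, v, w) \<in> X. r u + r v = p \<and> r u + r w = q})"
  have finX: "finite X" using X by (rule finite_subset) simp
  have rinj: "inj_on r {1..n}" using r_bij by (simp add: bij_betw_def)
  have F: "card (F pq) \<le> 3 * L" for pq
  proof -
    obtain p q where pq: "pq = (p, q)" by (cases pq)
    have "F pq \<subseteq> X" by (auto simp: F_def pq)
    then have fin: "finite (F pq)" using finX finite_subset by blast
    have "inj_on (\<lambda>(u, v, w). r u) (F pq)"
    proof (rule inj_onI)
      fix a b assume m: "a \<in> F pq" "b \<in> F pq" and e: "(case a of (u, v, w) \<Rightarrow> r u) = (case b of (u, v, w) \<Rightarrow> r u)"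
      obtain u v w where a: "a = (u, v, w)" by (cases a)
      obtain u' v' w' where b: "b = (u', v', w')" by (cases b)
      have X': "(u, v, w) \<in> X" "(u', v', w') \<in> X" using m by (auto simp: F_def pq a b)
      have "r u = r u'" using e by (simp add: a b)
      moreover have "r v = r v'" "r w = r w'" using m calculation by (auto simp: F_def pq a b)
      moreover have "u \<in> {1..n} \<and> v \<in> {1..n} \<and> w \<in> {1..n}" "u' \<in> {1..n} \<and> v' \<in> {1..n} \<and> w' \<in> {1..n}"
        using X X' by blast+
      ultimately show "a = b" unfolding a b using inj_onD[OF rinj] by blast
    qed
    then have "card (F pq) = card ((\<lambda>(u, v, w). r u) ` F pq)" by (simp add: card_image)
    also have "\<dots> \<le> 3 * L"
      by (rule card_le_if_diff_less) (use fin diag in \<open>auto simp: F_def pq\<close>)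
    finally show ?thesis .
  qed
  have "X \<subseteq> (\<Union>pq\<in>{..<2 * n} \<times> {..<2 * n}. F pq)"
  proof
    fix z assume z: "z \<in> X"
    obtain u v w where uvw: "z = (u, v, w)" by (cases z)
    then have "u \<in> {1..n}" "v \<in> {1..n}" "w \<in> {1..n}" using X z by auto
    then have "r u + r v < 2 * n" "r u + r w < 2 * n" using r_lt_n[of u] r_lt_n[of v] r_lt_n[of w] by linarith+
    moreover have "z \<in> F (r u + r v, r u + r w)" using z uvw by (simp add: F_def)
    ultimately show "z \<in> (\<Union>pq\<in>{..<2 * n} \<times> {..<2 * n}. F pq)" by blast
  qed
  moreover have "finite (\<Union>pq\<in>{..<2 * n} \<times> {..<2 * n}. F pq)"
    by (rule finite_subset[OF _ finX]) (auto simp: F_def)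
  ultimately have "card X \<le> card (\<Union>pq\<in>{..<2 * n} \<times> {..<2 * n}. F pq)" by (intro card_mono)
  also have "\<dots> \<le> card ({..<2 * n} \<times> {..<2 * n}) * (3 * L)" by (intro card_UN_le_mult F) simp
  also have "\<dots> = 12 * (L * n\<^sup>2)" by (simp add: card_cartesian_product power2_eq_square)
  finally show ?thesis .
qed

lemma S_mono:
  assumes "u \<in> {1..n}" "v \<in> {1..n}" "w \<in> {1..n}" "u' \<in> {1..n}" "v' \<in> {1..n}" "w' \<in> {1..n}"
    and "r u' \<le> r u" "r v \<le> r v'" "r w \<le> r w'"
  shows "S u' v' w' \<le> S u v w"
  using assms r_le_iff[of u' u] r_le_iff[of v v'] r_le_iff[of w w'] by (simp add: S_def)

text \<open>Along a diagonal \<open>u\<close> moves up while \<open>v\<close> and \<open>w\<close> move down, so \<open>S\<close> increases: it changes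
  sign once, and the points of a box in which both signs occur are within \<open>3 * L\<close> of that place.\<close>

lemma card_cross: "card neg_cross \<le> 12 * (L * n\<^sup>2)" "card pos_cross \<le> 12 * (L * n\<^sup>2)"
proof -
  show "card neg_cross \<le> 12 * (L * n\<^sup>2)"
  proof (rule card_diagonal_le)
    fix u v w u2 v2 w2
    assume 1: "(u, v, w) \<in> neg_cross" and 2: "(u2, v2, w2) \<in> neg_cross"
      and d: "r u + r v = r u2 + r v2" "r u + r w = r u2 + r w2"
    from 1 obtain u' v' w' where p: "u' \<in> G" "v' \<in> G" "w' \<in> G" "g u' = g u" "g v' = g v" "g w' = g w"
      "S u' v' w' > 0" and G: "u \<in> G" "v \<in> G" "w \<in> G" unfolding neg_cross_def mem_Collect_eq prod.case by metis
    have G2: "u2 \<in> G" "v2 \<in> G" "w2 \<in> G" "S u2 v2 w2 < 0" using 2 unfolding neg_cross_def mem_Collect_eq prod.case by metis+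
    have "r u' < r u + 3 * L" "r v < r v' + 3 * L" "r w < r w' + 3 * L"
      by (rule same_bucket_rank_eq[OF p(1) G(1) p(4)] same_bucket_rank_eq[OF G(2) p(2) p(5)[symmetric]]
        same_bucket_rank_eq[OF G(3) p(3) p(6)[symmetric]])+
    note b = this
    show "r u2 < r u + 3 * L"
    proof (rule ccontr)
      \<comment> \<open>So far along the diagonal, \<open>(u2, v2, w2)\<close> dominates the
        positive witness from the box of the first triple, and \<open>S\<close> could not be
        negative.\<close>
      assume "\<not> r u2 < r u + 3 * L"
      then have "r u' \<le> r u2" "r v2 \<le> r v'" "r w2 \<le> r w'" using b d by linarith+
      then have "S u' v' w' \<le> S u2 v2 w2" using G2(1-3) p(1-3) by (intro S_mono) blast+
      then show False using G2(4) p(7) by linarith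
    qed
  qed (auto simp: neg_cross_def)
  show "card pos_cross \<le> 12 * (L * n\<^sup>2)"
  proof (rule card_diagonal_le)
    fix u v w u2 v2 w2
    assume 1: "(u, v, w) \<in> pos_cross" and 2: "(u2, v2, w2) \<in> pos_cross"
      and d: "r u + r v = r u2 + r v2" "r u + r w = r u2 + r w2"
    \<comment> \<open>Here the negative witness comes from the box of the second, higher triple: a
      positive first triple far below would make the witness positive.\<close>
    from 2 obtain u' v' w' where p: "u' \<in> G" "v' \<in> G" "w' \<in> G" "g u' = g u2" "g v' = g v2" "g w' = g w2"
      "S u' v' w' < 0" and G: "u2 \<in> G" "v2 \<in> G" "w2 \<in> G" unfolding pos_cross_def mem_Collect_eq prod.case by metis
    have G1: "u \<in> G" "v \<in> G" "w \<in> G" "S u v w > 0" using 1 unfolding pos_cross_def mem_Collect_eq prod.case by metis+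
    have "r u2 < r u' + 3 * L" "r v' < r v2 + 3 * L" "r w' < r w2 + 3 * L"
      by (rule same_bucket_rank_eq[OF G(1) p(1) p(4)[symmetric]] same_bucket_rank_eq[OF p(2) G(2) p(5)]
        same_bucket_rank_eq[OF p(3) G(3) p(6)])+
    note b = this
    show "r u2 < r u + 3 * L"
    proof (rule ccontr)
      assume "\<not> r u2 < r u + 3 * L"
      then have "r u \<le> r u'" "r v' \<le> r v" "r w' \<le> r w" using b d by linarith+
      then have "S u v w \<le> S u' v' w'" using G1(1-3) p(1-3) by (intro S_mono) blast+
      then show False using G1(4) p(7) by linarith
    qed
  qed (auto simp: pos_cross_def)
qed

section \<open>Counting the unsatisfied constraints\<close>

definition near :: "(nat \<times> nat) set" where
  "near = {(u, v). u \<in> {1..n} \<and> v \<in> {1..n} \<and> r u < r v + 4 * L \<and> r v < r u + 4 * L}"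

lemma card_near: "card near \<le> 8 * (L * n)" "finite near"
proof -
  have "near \<subseteq> {1..n} \<times> {1..n}" by (auto simp: near_def)
  then show fin: "finite near" by (rule finite_subset) simp
  have "near = (\<Union>u\<in>{1..n}. Pair u ` {v \<in> {1..n}. r u < r v + 4 * L \<and> r v < r u + 4 * L})"
    by (auto simp: near_def)
  also have "card \<dots> \<le> card {1..n} * (8 * L)"
  proof (rule card_UN_le_mult)
    fix u assume "u \<in> {1..n}"
    have "card (Pair u ` {v \<in> {1..n}. r u < r v + 4 * L \<and> r v < r u + 4 * L})
      \<le> card {v \<in> {1..n}. r u + 1 - 4 * L \<le> r v \<and> r v < r u + 4 * L}"
      by (rule order_trans[OF card_image_le card_mono]) auto
    also have "\<dots> \<le> (r u + 4 * L) - (r u + 1 - 4 * L)" by (rule card_rank_range_le)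
    finally show "card (Pair u ` {v \<in> {1..n}. r u < r v + 4 * L \<and> r v < r u + 4 * L}) \<le> 8 * L"
      by linarith
  qed simp
  finally show "card near \<le> 8 * (L * n)" by (simp add: mult_ac)
qed

lemma not_far_near:
  assumes "u \<in> G" "v \<in> G" "\<not> far (g u) (g v)"
  shows "(u, v) \<in> near"
proof -
  have "g u \<le> g v + 1" "g v \<le> g u + 1" using assms(3) by (auto simp: far_def)
  then show ?thesis using same_bucket_rank(1)[of u v] same_bucket_rank(1)[of v u] assms by (simp add: near_def)
qed

definition unsatisfied :: "(nat \<Rightarrow> real) \<Rightarrow> triples" where
  "unsatisfied x = {(u, v, w) \<in> T. \<not> \<bar>x (g u) - x (g v)\<bar> < \<bar>x (g u) - x (g w)\<bar>}"

text \<open>\<open>52 = 1 + 3 + 24 + 24\<close>: violated constraints, triples with a displaced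
  entry, triples with two entries of nearby rank (three pairs with 8 each), and boxes with a sign
  change (12 for either sign).\<close>

lemma card_unsatisfied:
  assumes "feasible T g L K x"
  shows "card (unsatisfied x) \<le> 52 * (L * n\<^sup>2)"
proof -
  let ?V = "{1..n}"
  let ?w = "W \<times> ?V \<times> ?V \<union> (?V \<times> W \<times> ?V \<union> ?V \<times> ?V \<times> W)"
  let ?N1 = "(\<lambda>((u, v), w). (u, v, w)) ` (near \<times> ?V)"
  let ?N2 = "(\<lambda>((u, w), v). (u, v, w)) ` (near \<times> ?V)"
  let ?N3 = "(\<lambda>((v, w), u). (u, v, w)) ` (near \<times> ?V)"
  let ?X = "violated f T \<union> (?w \<union> ((?N1 \<union> (?N2 \<union> ?N3)) \<union> (neg_cross \<union> pos_cross)))"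
  have fcross: "finite neg_cross" "finite pos_cross"
    by (rule finite_subset[of _ "?V \<times> ?V \<times> ?V"]; auto simp: neg_cross_def pos_cross_def)+
  have "card (unsatisfied x) \<le> card ?X"
  proof (rule card_mono)
    show "finite ?X" using finite_T fcross card_near(2) finite_W by (auto simp: violated_def)
    show "unsatisfied x \<subseteq> ?X"
    proof
      fix z assume z: "z \<in> unsatisfied x"
      then obtain u v w where uvw: "z = (u, v, w)" "(u, v, w) \<in> T"
        "\<not> \<bar>x (g u) - x (g v)\<bar> < \<bar>x (g u) - x (g w)\<bar>" by (auto simp: unsatisfied_def)
      have V: "u \<in> ?V" "v \<in> ?V" "w \<in> ?V" using TD[OF uvw(2)] by auto
      show "z \<in> ?X"
      proof (rule ccontr)
        assume nz: "z \<notin> ?X"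
        then have G: "u \<in> G" "v \<in> G" "w \<in> G" using V uvw(1) by blast+
        have "(u, v) \<notin> near" using nz V uvw(1) by (force simp: image_iff)
        then have 1: "far (g u) (g v)" using not_far_near G by blast
        have "(u, w) \<notin> near" using nz V uvw(1) by (force simp: image_iff)
        then have 2: "far (g u) (g w)" using not_far_near G by blast
        have "(v, w) \<notin> near" using nz V uvw(1) by (force simp: image_iff)
        then have 3: "far (g v) (g w)" using not_far_near G by blast
        have "(u, v, w) \<notin> violated f T" using nz uvw(1) by blast
        from unsatisfied_cross[OF assms uvw(2) this G 1 2 3 uvw(3)] show False using nz uvw(1) by blast
      qed
    qed
  qed
  also have "\<dots> \<le> card (violated f T) + (card ?w + ((card ?N1 + (card ?N2 + card ?N3)) + (card neg_cross + card pos_cross)))"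
    by (intro order_trans[OF card_Un_le] add_mono order_refl)
  also have "\<dots> \<le> L * n\<^sup>2 + (3 * (L * n\<^sup>2) + ((8 * (L * n\<^sup>2) + (8 * (L * n\<^sup>2) + 8 * (L * n\<^sup>2))) +
      (12 * (L * n\<^sup>2) + 12 * (L * n\<^sup>2))))"
  proof (intro add_mono card_cross)
    have "L \<le> n" using KL(1) K by (metis One_nat_def Suc_leI le_trans mult_le_mono1 nat_mult_1)
    then have "L * (L * L) \<le> L * (n * n)" by (intro mult_le_mono order_refl)
    then have "L ^ 3 \<le> L * n\<^sup>2" by (simp only: power3_eq_cube power2_eq_square mult.assoc)
    then show "card (violated f T) \<le> L * n\<^sup>2" using violated_small by linarith
    have "card ?w \<le> card W * n\<^sup>2 + (card W * n\<^sup>2 + card W * n\<^sup>2)"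
      by (intro order_trans[OF card_Un_le] add_mono) (simp_all add: card_cartesian_product power2_eq_square)
    also have "\<dots> = 3 * (card W * n\<^sup>2)" by simp
    also have "\<dots> \<le> 3 * (L * n\<^sup>2)" using W_small by simp
    finally show "card ?w \<le> 3 * (L * n\<^sup>2)" .
    have "card (near \<times> ?V) \<le> 8 * (L * n) * n"
      using card_near(1) by (simp add: card_cartesian_product)
    then have *: "card (near \<times> ?V) \<le> 8 * (L * n\<^sup>2)" by (simp add: power2_eq_square mult.assoc)
    have fin: "finite (near \<times> ?V)" using card_near(2) by simp
    show "card ?N1 \<le> 8 * (L * n\<^sup>2)" "card ?N2 \<le> 8 * (L * n\<^sup>2)" "card ?N3 \<le> 8 * (L * n\<^sup>2)"
      by (rule order_trans[OF card_image_le[OF fin] *])+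
  qed
  finally show ?thesis by simp
qed

text \<open>With \<open>L = 1\<close> and nothing displaced, \<open>g\<close> is the rank. A box
  then holds a single triple and cannot contain both signs. This covers
  \<open>\<delta> * n < 1\<close>, where no error is affordable.\<close>

lemma unsatisfied_exact:
  assumes x: "feasible T g L K x" and exact: "violated f T = {}" "W = {}" "L = 1"
  shows "unsatisfied x = {}"
proof (rule ccontr)
  assume "unsatisfied x \<noteq> {}"
  then obtain u v w where uvw: "(u, v, w) \<in> T" "\<not> \<bar>x (g u) - x (g v)\<bar> < \<bar>x (g u) - x (g w)\<bar>"
    by (auto simp: unsatisfied_def)
  have d: "u \<in> {1..n}" "v \<in> {1..n}" "w \<in> {1..n}" "u \<noteq> v" "u \<noteq> w" "v \<noteq> w" using TD[OF uvw(1)] by auto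
  have "K = n" using KL exact(3) by simp
  have "h = 0" using h8 exact(3) by linarith
  have g: "g a = r a" if "a \<in> {1..n}" for a
  proof -
    have "s a = r a" using that exact(2) \<open>h = 0\<close> unfolding W_def by force
    moreover have "bucket L K (r a) = r a"
      by (rule g_eqI) (use exact(3) \<open>K = n\<close> r_lt_n[OF that] in auto)
    ultimately show ?thesis by (simp add: g_def)
  qed
  have inj: "a = b" if "a \<in> {1..n}" "b \<in> {1..n}" "g a = g b" for a b
    using that g r_bij by (metis bij_betw_def inj_onD)
  have "L < 8" using exact(3) by simp
  then have far: "far (g u) (g v)" "far (g u) (g w)" "far (g v) (g w)"
    using inj[OF d(1,2)] inj[OF d(1,3)] inj[OF d(2,3)] d(4-6) unfolding far_def by blast+
  have "(u, v, w) \<in> neg_cross \<union> pos_cross"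
    by (rule unsatisfied_cross[OF x uvw(1) _ _ _ _ far uvw(2)]) (use d(1-3) exact(1,2) in blast)+
  then obtain u' v' w' where "u' \<in> {1..n}" "v' \<in> {1..n}" "w' \<in> {1..n}" "g u' = g u" "g v' = g v" "g w' = g w"
    "S u v w * S u' v' w' < 0"
    unfolding neg_cross_def pos_cross_def mult_less_0_iff Un_iff mem_Collect_eq prod.case by blast
  then show False using inj[of u' u] inj[of v' v] inj[of w' w] d(1-3) by (metis not_square_less_zero)
qed

end

section \<open>Pivots\<close>

text \<open>No constraint \<open>(a, a, u)\<close> exists, so the pivot is put before all other
  points by hand. For the leftmost point of an injective solution without violations the score is
  then exactly the rank, on which the case \<open>L = 1\<close> relies.\<close>

definition score :: "triples \<Rightarrow> nat \<Rightarrow> nat \<Rightarrow> nat \<Rightarrow> nat" where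
  "score T n a u = card {v. v < n + 1 \<and> (v = a \<and> u \<noteq> a \<or> (a, v, u) \<in> T)}"

text \<open>The floor of \<open>\<epsilon> powr (1/8) * n\<close>, but at least 1. Eighth powers are
  compared because the program has no roots, and it counts because a real cannot be converted to an
  integer.\<close>

definition width :: "real \<Rightarrow> nat \<Rightarrow> nat" where
  "width \<epsilon> n = max 1 (card {j. j < n + 1 \<and> 0 < j \<and> real j ^ 8 \<le> \<epsilon> * real n ^ 8})"

definition buckets :: "nat \<Rightarrow> nat \<Rightarrow> nat" where
  "buckets n L = card {j. j < n + 1 \<and> 0 < j \<and> j * L \<le> n}"

lemma buckets_eq: assumes "L > 0" shows "buckets n L = n div L"
proof -
  have "j * L \<le> n \<longleftrightarrow> j \<le> n div L" for j using assms by (simp add: less_eq_div_iff_mult_less_eq)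
  moreover have "j < n + 1" if "j \<le> n div L" for j using that div_le_dividend[of n L] by linarith
  ultimately have "{j. j < n + 1 \<and> 0 < j \<and> j * L \<le> n} = {1..n div L}" by auto
  then show ?thesis by (simp add: buckets_def)
qed

lemma buckets_bounds:
  assumes "L > 0" "L \<le> n"
  shows "buckets n L > 0" "buckets n L * L \<le> n" "n < (buckets n L + 1) * L"
proof -
  show "buckets n L > 0" using assms by (simp add: buckets_eq div_greater_zero_iff)
  show "buckets n L * L \<le> n" using assms by (simp add: buckets_eq)
  show "n < (buckets n L + 1) * L" using dividend_less_times_div[of L n] assms by (simp add: buckets_eq mult.commute)
qed

lemma width_bounds:
  assumes \<epsilon>: "\<epsilon> = \<delta> ^ 8" and \<delta>: "0 < \<delta>" "\<delta> < 1" and n: "n \<ge> 1"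
  shows "\<delta> * real n < real (width \<epsilon> n) + 1" "1 \<le> width \<epsilon> n" "width \<epsilon> n \<le> n"
    "1 \<le> \<delta> * real n \<Longrightarrow> real (width \<epsilon> n) \<le> \<delta> * real n" "\<delta> * real n < 1 \<Longrightarrow> width \<epsilon> n = 1"
proof -
  define m where "m = nat \<lfloor>\<delta> * real n\<rfloor>"
  have le: "\<delta> * real n \<le> real n" using \<delta> by (simp add: mult_le_cancel_right2)
  have nn: "0 \<le> \<delta> * real n" using \<delta> by simp
  have m: "j \<le> m \<longleftrightarrow> real j \<le> \<delta> * real n" for j
    using nn unfolding m_def by (simp add: le_nat_floor le_nat_iff le_floor_iff)
  have mn: "m \<le> n" using m[of m] le by linarith
  have *: "real j ^ 8 \<le> \<epsilon> * real n ^ 8 \<longleftrightarrow> j \<le> m" for j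
    using power_mono_iff[of "real j" "\<delta> * real n" 8] nn unfolding \<epsilon> m power_mult_distrib by simp
  have "{j. j < n + 1 \<and> 0 < j \<and> real j ^ 8 \<le> \<epsilon> * real n ^ 8} = {1..m}"
    unfolding * using mn by auto
  then have w: "width \<epsilon> n = max 1 m" by (simp add: width_def)
  have "m \<le> width \<epsilon> n" using w by simp
  then show "\<delta> * real n < real (width \<epsilon> n) + 1" using m[of "m + 1"] by simp
  show "1 \<le> width \<epsilon> n" "width \<epsilon> n \<le> n" using w n mn by simp_all
  show "real (width \<epsilon> n) \<le> \<delta> * real n" if "1 \<le> \<delta> * real n"
  proof -
    have "1 \<le> m" using m[of 1] that by simp
    then have "width \<epsilon> n = m" using w by simp
    then show ?thesis using m[of m] by simp
  qed
  show "width \<epsilon> n = 1" if "\<delta> * real n < 1"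
  proof -
    have "\<not> 1 \<le> m" using m[of 1] that by simp
    then show ?thesis using w by simp
  qed
qed

text \<open>Adding a small multiple of the identity separates all points and breaks no strict inequality.\<close>

lemma injective_solution:
  assumes fin: "finite T"
  shows "\<exists>f'. inj_on f' {1..n} \<and> lloc_satisfied f T \<subseteq> lloc_satisfied f' T"
proof -
  define F where "F t u = f u + t * real u" for t u
  have lim: "((\<lambda>t. F t u) \<longlongrightarrow> f u) (at_right 0)" for u
    unfolding F_def by (rule tendsto_eq_intros refl | simp)+
  have sat: "eventually (\<lambda>t. \<bar>F t u - F t v\<bar> < \<bar>F t u - F t w\<bar>) (at_right 0)"
    if "\<bar>f u - f v\<bar> < \<bar>f u - f w\<bar>" for u v w
  proof -
    have "((\<lambda>t. \<bar>F t u - F t w\<bar> - \<bar>F t u - F t v\<bar>) \<longlongrightarrow> \<bar>f u - f w\<bar> - \<bar>f u - f v\<bar>) (at_right 0)"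
      by (intro tendsto_intros lim)
    from order_tendstoD(1)[OF this, of 0] that show ?thesis by (simp add: eventually_mono)
  qed
  have "eventually (\<lambda>t. \<forall>(u, v, w)\<in>lloc_satisfied f T. \<bar>F t u - F t v\<bar> < \<bar>F t u - F t w\<bar>) (at_right 0)"
  proof (rule eventually_ball_finite)
    show "finite (lloc_satisfied f T)" using fin by (rule finite_subset[rotated]) (auto simp: lloc_satisfied_def)
    show "\<forall>z\<in>lloc_satisfied f T. eventually (\<lambda>t. case z of (u, v, w) \<Rightarrow> \<bar>F t u - F t v\<bar> < \<bar>F t u - F t w\<bar>) (at_right 0)"
    proof
      fix z assume "z \<in> lloc_satisfied f T"
      then obtain u v w where "z = (u, v, w)" "\<bar>f u - f v\<bar> < \<bar>f u - f w\<bar>" by (auto simp: lloc_satisfied_def)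
      then show "eventually (\<lambda>t. case z of (u, v, w) \<Rightarrow> \<bar>F t u - F t v\<bar> < \<bar>F t u - F t w\<bar>) (at_right 0)"
        using sat by simp
    qed
  qed
  moreover have "eventually (\<lambda>t. \<forall>(u, v)\<in>{1..n} \<times> {1..n}. u \<noteq> v \<longrightarrow> F t u \<noteq> F t v) (at_right 0)"
  proof (rule eventually_ball_finite, simp, clarify)
    fix u v :: nat
    show "eventually (\<lambda>t. u \<noteq> v \<longrightarrow> F t u \<noteq> F t v) (at_right 0)"
    proof (cases "f u = f v")
      case True
      have "eventually (\<lambda>t::real. t \<in> {0<..<1}) (at_right 0)" by (rule eventually_at_right_real) simp
      then show ?thesis by eventually_elim (use True in \<open>auto simp: F_def\<close>)
    next
      case False
      have "((\<lambda>t. F t u - F t v) \<longlongrightarrow> f u - f v) (at_right 0)" by (intro tendsto_intros lim)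
      from tendsto_imp_eventually_ne[OF this, of 0] False show ?thesis
        by (auto elim: eventually_mono)
    qed
  qed
  ultimately have "eventually (\<lambda>t. (\<forall>(u, v, w)\<in>lloc_satisfied f T. \<bar>F t u - F t v\<bar> < \<bar>F t u - F t w\<bar>) \<and>
      (\<forall>(u, v)\<in>{1..n} \<times> {1..n}. u \<noteq> v \<longrightarrow> F t u \<noteq> F t v)) (at_right 0)"
    by (rule eventually_conj)
  from eventually_happens'[OF trivial_limit_at_right_real this]
  obtain t where t: "\<forall>(u, v, w)\<in>lloc_satisfied f T. \<bar>F t u - F t v\<bar> < \<bar>F t u - F t w\<bar>"
    "\<forall>(u, v)\<in>{1..n} \<times> {1..n}. u \<noteq> v \<longrightarrow> F t u \<noteq> F t v" by (elim exE conjE)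
  show ?thesis
  proof (intro exI[of _ "F t"] conjI)
    show "inj_on (F t) {1..n}"
    proof (rule inj_onI, rule ccontr)
      fix u v assume "u \<in> {1..n}" "v \<in> {1..n}" "F t u = F t v" "u \<noteq> v"
      then show False using bspec[OF t(2), of "(u, v)"] by simp
    qed
    show "lloc_satisfied f T \<subseteq> lloc_satisfied (F t) T"
    proof
      fix z assume z: "z \<in> lloc_satisfied f T"
      then show "z \<in> lloc_satisfied (F t) T"
        using bspec[OF t(1) z] unfolding lloc_satisfied_def by (cases z) simp
    qed
  qed
qed

lemma abs_card_diff_le:
  assumes "finite A" "\<And>v. v \<in> A \<Longrightarrow> P v \<noteq> Q v \<Longrightarrow> v \<in> D" "finite D"
  shows "card {v \<in> A. P v} \<le> card {v \<in> A. Q v} + card D" "card {v \<in> A. Q v} \<le> card {v \<in> A. P v} + card D"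
proof -
  show "card {v \<in> A. P v} \<le> card {v \<in> A. Q v} + card D"
    by (rule order_trans[OF card_mono card_Un_le]) (use assms in auto)
  show "card {v \<in> A. Q v} \<le> card {v \<in> A. P v} + card D"
    by (rule order_trans[OF card_mono card_Un_le]) (use assms in auto)
qed

definition violated_at :: "(nat \<Rightarrow> real) \<Rightarrow> triples \<Rightarrow> nat \<Rightarrow> (nat \<times> nat) set" where
  "violated_at f T a = {(v, w). (a, v, w) \<in> violated f T}"

text \<open>Averaging: violated constraints with different first entries are distinct.\<close>

lemma exists_light_pivot:
  assumes fin: "finite (violated f T)" and A: "finite A" "A \<noteq> {}"
  shows "\<exists>a\<in>A. card A * card (violated_at f T a) \<le> card (violated f T)"
proof (rule ccontr)
  assume no: "\<not> ?thesis"
  have finv: "finite (violated_at f T a)" for a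
    by (rule finite_subset[of _ "snd ` violated f T"]) (use fin in \<open>force simp: violated_at_def\<close>)+
  have "(\<Sum>a\<in>A. card (violated_at f T a)) = card (SIGMA a:A. violated_at f T a)"
    using A finv by (simp add: card_SigmaI)
  also have "\<dots> \<le> card (violated f T)"
    by (rule card_mono[OF fin]) (auto simp: violated_at_def)
  finally have 1: "(\<Sum>a\<in>A. card (violated_at f T a)) \<le> card (violated f T)" .
  have "card A * card (violated f T) = (\<Sum>a\<in>A. card (violated f T))" by simp
  also have "\<dots> < (\<Sum>a\<in>A. card A * card (violated_at f T a))"
    by (rule sum_strict_mono) (use A no in \<open>auto simp: not_le\<close>)
  also have "\<dots> = card A * (\<Sum>a\<in>A. card (violated_at f T a))" by (simp add: sum_distrib_left)
  also have "\<dots> \<le> card A * card (violated f T)" using 1 by (intro mult_le_mono2)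
  finally show False by simp
qed

text \<open>\<open>D\<close> collects the pairs that the pivot orders differently from
  \<open>f\<close>. If neither point is left of \<open>a\<close>, the pair is a violated constraint
  at \<open>a\<close>, in one of two orders. A displaced point has at least \<open>h + 1\<close>
  such partners, and \<open>L \<le> 8 * (h + 1)\<close>.\<close>

lemma (in bucketing) displaced_bound:
  assumes a: "a \<in> {1..n}" and s: "s = score T n a"
  shows "card W * L \<le> 8 * (2 * card (violated_at f T a) + 2 * (r a * n))"
proof -
  let ?V = "{1..n}"
  let ?J = "\<lambda>v u. v = a \<and> u \<noteq> a \<or> (a, v, u) \<in> T"
  let ?left = "{u \<in> ?V. f u < f a}"
  define B where "B = violated_at f T a"
  define D where "D = {(u, v). u \<in> ?V \<and> v \<in> ?V \<and> ?J v u \<noteq> (f v < f u)}"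
  have finD: "finite D" by (rule finite_subset[of _ "?V \<times> ?V"]) (auto simp: D_def)
  have finB: "finite B"
    by (rule finite_subset[of _ "?V \<times> ?V"]) (use TD in \<open>force simp: B_def violated_at_def violated_def\<close>)+
  have "D \<subseteq> B \<union> (prod.swap ` B \<union> (?left \<times> ?V \<union> ?V \<times> ?left))"
  proof
    fix z assume "z \<in> D"
    then obtain u v where z: "z = (u, v)" "u \<in> ?V" "v \<in> ?V" "?J v u \<noteq> (f v < f u)" by (auto simp: D_def)
    show "z \<in> B \<union> (prod.swap ` B \<union> (?left \<times> ?V \<union> ?V \<times> ?left))"
    proof (cases "f u < f a \<or> f v < f a")
      case True
      then show ?thesis using z by blast
    next
      case False
      have uv: "u \<noteq> v" "u \<noteq> a" "v \<noteq> a"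
      proof -
        show "u \<noteq> a" using z TD[of a v a] False by auto
        show "u \<noteq> v" using z TD[of a u u] \<open>u \<noteq> a\<close> by auto
        show "v \<noteq> a"
        proof
          assume "v = a"
          then have "f u \<noteq> f a" using inj_onD[OF inj, of u a] z(2) a \<open>u \<noteq> a\<close> by blast
          then show False using z(4) \<open>v = a\<close> \<open>u \<noteq> a\<close> False by auto
        qed
      qed
      show ?thesis
      proof (cases "(a, v, u) \<in> T")
        case True
        then have "\<not> f v < f u" using z uv by auto
        then have "(a, v, u) \<in> violated f T" using True False by (intro violatedI) auto
        then have "(v, u) \<in> B" by (simp add: B_def violated_at_def)
        then show ?thesis unfolding z by (force simp: image_iff)
      next
        case nT: False
        then have "(a, u, v) \<in> T" using T_total[of a v u] a z(2,3) uv by auto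
        moreover have "f v < f u" using z nT uv by auto
        ultimately have "(a, u, v) \<in> violated f T" using False by (intro violatedI) auto
        then have "(u, v) \<in> B" by (simp add: B_def violated_at_def)
        then show ?thesis unfolding z by blast
      qed
    qed
  qed
  then have "card D \<le> card (B \<union> (prod.swap ` B \<union> (?left \<times> ?V \<union> ?V \<times> ?left)))"
    by (rule card_mono[rotated]) (use finB in auto)
  also have "\<dots> \<le> card B + (card B + (r a * n + n * r a))"
    by (intro order_trans[OF card_Un_le] add_mono order_refl)
      (use finB card_image_le[OF finB] in \<open>auto simp: card_cartesian_product r_def\<close>)
  finally have D: "card D \<le> 2 * card B + 2 * (r a * n)" using mult.commute[of n "r a"] by linarith
  have disp: "h + 1 \<le> card {v. (u, v) \<in> D}" if "u \<in> W" for u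
  proof -
    have u: "u \<in> ?V" using that by (simp add: W_def)
    have finDu: "finite {v. (u, v) \<in> D}" by (rule finite_subset[of _ ?V]) (auto simp: D_def)
    have "{v. v < n + 1 \<and> ?J v u} = {v \<in> ?V. ?J v u}" using TD[of a _ u] a by fastforce
    then have "s u = card {v \<in> ?V. ?J v u}" by (simp add: s score_def)
    moreover have "card {v \<in> ?V. ?J v u} \<le> card {v \<in> ?V. f v < f u} + card {v. (u, v) \<in> D}"
      "card {v \<in> ?V. f v < f u} \<le> card {v \<in> ?V. ?J v u} + card {v. (u, v) \<in> D}"
      by (rule abs_card_diff_le[OF _ _ finDu]; use u in \<open>auto simp: D_def\<close>)+
    moreover have "s u + h < r u \<or> r u + h < s u" using that by (simp add: W_def)
    ultimately show ?thesis unfolding r_def by linarith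
  qed
  have "card W * (h + 1) = (\<Sum>u\<in>W. h + 1)" by simp
  also have "\<dots> \<le> (\<Sum>u\<in>W. card {v. (u, v) \<in> D})" by (rule sum_mono) (rule disp)
  also have "\<dots> = card (SIGMA u:W. {v. (u, v) \<in> D})"
    by (rule card_SigmaI[symmetric]) (auto intro: finite_subset[of _ ?V] simp: finite_W D_def)
  also have "\<dots> \<le> card D" by (rule card_mono[OF finD]) auto
  finally have "card W * (8 * (h + 1)) \<le> 8 * card D" by (simp only: mult.left_commute[of _ 8])
  moreover have "L \<le> 8 * (h + 1)" unfolding h_def by presburger
  then have "card W * L \<le> card W * (8 * (h + 1))" by (rule mult_le_mono2)
  ultimately have "card W * L \<le> 8 * card D" by (rule order_trans[rotated])
  also have "\<dots> \<le> 8 * (2 * card B + 2 * (r a * n))" by (rule mult_le_mono2[OF D])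
  finally show ?thesis unfolding B_def .
qed

lemma instance_subset: assumes "lloc_instance n T" shows "T \<subseteq> {1..n} \<times> {1..n} \<times> {1..n}"
proof
  fix z assume "z \<in> T"
  then show "z \<in> {1..n} \<times> {1..n} \<times> {1..n}" using assms unfolding lloc_instance_def by (cases z) blast
qed

lemma card_instance_le: assumes "lloc_instance n T" shows "finite T" "card T \<le> n ^ 3"
proof -
  note sub = instance_subset[OF assms]
  then show "finite T" by (rule finite_subset) simp
  have "card T \<le> card ({1..n} \<times> {1..n} \<times> {1..n})" using sub by (intro card_mono) simp
  then show "card T \<le> n ^ 3" by (simp add: card_cartesian_product power3_eq_cube)
qed

text \<open>Every triple is in \<open>T\<close>, or its mirror image is, or it is one of at most
  \<open>3 * n ^ 2\<close> degenerate ones, which are at most half of all triples for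
  \<open>n \<ge> 6\<close>.\<close>

lemma card_instance_ge:
  assumes inst: "lloc_instance n T" and n: "n \<ge> 6"
  shows "n ^ 3 \<le> 4 * card T"
proof -
  let ?V = "{1..n}"
  let ?sw = "\<lambda>(u, v, w). (u, w, v)"
  let ?D1 = "(\<lambda>(u, w). (u, u, w)) ` (?V \<times> ?V)"
  let ?D2 = "(\<lambda>(u, w). (u, w, u)) ` (?V \<times> ?V)"
  let ?D3 = "(\<lambda>(u, w). (w, u, u)) ` (?V \<times> ?V)"
  note fin = card_instance_le(1)[OF inst]
  have "card (?V \<times> ?V \<times> ?V) \<le> card (T \<union> (?sw ` T \<union> (?D1 \<union> (?D2 \<union> ?D3))))"
  proof (rule card_mono)
    show "?V \<times> ?V \<times> ?V \<subseteq> T \<union> (?sw ` T \<union> (?D1 \<union> (?D2 \<union> ?D3)))"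
    proof
      fix z assume "z \<in> ?V \<times> ?V \<times> ?V"
      then obtain u v w where z: "z = (u, v, w)" "u \<in> ?V" "v \<in> ?V" "w \<in> ?V" by blast
      show "z \<in> T \<union> (?sw ` T \<union> (?D1 \<union> (?D2 \<union> ?D3)))"
      proof (cases "u = v \<or> u = w \<or> v = w")
        case True
        then consider "u = v" | "u = w" | "v = w" by blast
        then have "z \<in> ?D1 \<or> z \<in> ?D2 \<or> z \<in> ?D3"
        proof cases
          case 1
          then have "z \<in> ?D1" using z by (intro image_eqI[of _ _ "(u, w)"]) simp_all
          then show ?thesis by blast
        next
          case 2
          then have "z \<in> ?D2" using z by (intro image_eqI[of _ _ "(u, v)"]) simp_all
          then show ?thesis by blast
        next
          case 3
          then have "z \<in> ?D3" using z by (intro image_eqI[of _ _ "(v, u)"]) simp_all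
          then show ?thesis by blast
        qed
        then show ?thesis by blast
      next
        case False
        then have "distinct [u, v, w]" by simp
        then have "(u, v, w) \<in> T \<or> (u, w, v) \<in> T" using inst z unfolding lloc_instance_def by blast
        then show ?thesis unfolding z(1) by force
      qed
    qed
  qed (use fin in auto)
  also have "\<dots> \<le> card T + (card T + (card (?V \<times> ?V) + (card (?V \<times> ?V) + card (?V \<times> ?V))))"
    by (intro order_trans[OF card_Un_le] add_mono card_image_le order_refl) (use fin in auto)
  finally have "n * (n * n) \<le> 2 * card T + 3 * (n * n)" by (simp add: card_cartesian_product)
  moreover have "6 * (n * n) \<le> n * (n * n)" using n by (intro mult_le_mono1)
  ultimately have "n * (n * n) \<le> 4 * card T" by linarith
  then show ?thesis by (simp only: power3_eq_cube mult.assoc)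
qed

lemma exists_good_pivot:
  assumes inst: "lloc_instance n T" and n: "n \<ge> 1" and \<epsilon>: "\<epsilon> = \<delta> ^ 8" and \<delta>: "0 < \<delta>" "\<delta> \<le> 1 / 10000"
    and sol: "satisfies_fraction f0 T (1 - \<epsilon>)"
  defines "L \<equiv> width \<epsilon> n"
  defines "K \<equiv> buckets n L"
  shows "\<exists>f. \<exists>a\<in>{1..n}. good_bucketing n L K T f (score T n a) \<and>
    (1 \<le> \<delta> * real n \<or> violated f T = {} \<and> bucketing.W n L f (score T n a) = {} \<and> L = 1)"
proof -
  note finT = card_instance_le(1)[OF inst]
  obtain f where inj: "inj_on f {1..n}" and sat: "lloc_satisfied f0 T \<subseteq> lloc_satisfied f T"
    using injective_solution[OF finT] by blast
  have \<delta>1: "\<delta> < 1" using \<delta> by linarith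
  note wb = width_bounds[OF \<epsilon> \<delta>(1) \<delta>1 n, folded L_def]
  have L: "L > 0" using wb(2) by simp
  note bb = buckets_bounds[OF L wb(3), folded K_def]
  have bucketing: "bucketing n L K T f" by unfold_locales (use inst inj L bb in auto)
  \<comment> \<open>Ranks do not depend on the score, so a dummy score gives access to them before
    the pivot is chosen.\<close>
  interpret bucketing n L K T f "\<lambda>_. 0" by (rule bucketing)
  define b where "b = card (violated f T)"
  have subT: "lloc_satisfied f T \<subseteq> T" by (auto simp: lloc_satisfied_def)
  have finv: "finite (violated f T)" using finT by (simp add: violated_def)
  have b: "real b \<le> \<delta> ^ 8 * real n ^ 3"
  proof -
    have fs: "finite (lloc_satisfied f T)" using finT subT finite_subset by blast
    have "card (lloc_satisfied f0 T) \<le> card (lloc_satisfied f T)" by (rule card_mono[OF fs sat])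
    then have "(1 - \<epsilon>) * real (card T) \<le> real (card (lloc_satisfied f T))"
      using sol unfolding satisfies_fraction_def by linarith
    moreover have "b = card T - card (lloc_satisfied f T)"
      unfolding b_def violated_def by (rule card_Diff_subset[OF fs subT])
    moreover have "card (lloc_satisfied f T) \<le> card T" by (rule card_mono[OF finT subT])
    ultimately have "real b \<le> \<epsilon> * real (card T)" by (simp add: algebra_simps of_nat_diff)
    also have "\<dots> \<le> \<epsilon> * real (n ^ 3)"
      using card_instance_le(2)[OF inst] \<delta> \<epsilon> by (intro mult_left_mono) (simp_all del: of_nat_power)
    finally show ?thesis by (simp add: \<epsilon>)
  qed
  define m where "m = nat \<lceil>\<delta> ^ 4 * real n\<rceil>"
  have pos: "0 < \<delta> ^ 4 * real n" using \<delta> n by simp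
  have m: "\<delta> ^ 4 * real n \<le> real m" "real m < \<delta> ^ 4 * real n + 1" "m > 0"
    using pos unfolding m_def by linarith+
  have "\<delta> ^ 4 * real n \<le> real n" using \<delta> \<delta>1 by (simp add: mult_le_cancel_right2 power_le_one)
  then have "m \<le> n" using pos unfolding m_def by linarith
  define A where "A = {u \<in> {1..n}. 0 \<le> r u \<and> r u < m}"
  have "card A = m" using card_rank_range_ge[OF \<open>m \<le> n\<close>, of 0] card_rank_range_le[of 0 m] by (simp add: A_def)
  have "finite A" "A \<noteq> {}" using m(3) \<open>card A = m\<close> card_gt_0_iff[of A] by simp_all
  from exists_light_pivot[OF finv \<open>finite A\<close> \<open>A \<noteq> {}\<close>] obtain a where a: "a \<in> A" "m * card (violated_at f T a) \<le> b"
    unfolding \<open>card A = m\<close> b_def by blast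
  define c where "c = card (violated_at f T a)"
  have "a \<in> {1..n}" "r a < m" using a(1) by (auto simp: A_def)
  let ?W = "bucketing.W n L f (score T n a)"
  have "card ?W * L \<le> 8 * (2 * c + 2 * (r a * n))"
    unfolding c_def by (rule bucketing.displaced_bound[OF bucketing \<open>a \<in> {1..n}\<close>]) simp
  then have "real (card ?W * L) \<le> real (8 * (2 * c + 2 * (r a * n)))" by (simp only: of_nat_le_iff)
  then have W: "real (card ?W) * real L \<le> 16 * real c + 16 * (real (r a) * real n)" by simp
  have c: "real c \<le> \<delta> ^ 4 * (real n)\<^sup>2"
  proof -
    have "(\<delta> ^ 4 * real n) * real c \<le> real m * real c" using m(1) by (rule mult_right_mono) simp
    also have "\<dots> \<le> real b" using a(2) unfolding c_def by (metis of_nat_le_iff of_nat_mult)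
    also have "\<dots> \<le> (\<delta> ^ 4 * real n) * (\<delta> ^ 4 * (real n)\<^sup>2)"
      using b by (simp add: power2_eq_square power3_eq_cube mult_ac flip: power_add)
    finally show ?thesis by (simp only: mult_le_cancel_left_pos[OF pos])
  qed
  have ra: "real (r a) \<le> \<delta> ^ 4 * real n" using m(2) \<open>r a < m\<close> by linarith
  have ran: "real (r a) * real n \<le> \<delta> ^ 4 * (real n)\<^sup>2"
    using mult_right_mono[OF ra, of "real n"] by (simp add: power2_eq_square mult.assoc)
  have b': "real b \<le> \<delta> ^ 5 * (\<delta> * real n) ^ 3"
    using b by (simp add: power_mult_distrib mult.assoc[symmetric] flip: power_add)
  have d5: "\<delta> ^ 5 \<le> 1 / 10000"
    using power_decreasing[of 1 5 \<delta>] \<delta> \<delta>1 by simp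
  have d2: "\<delta>\<^sup>2 \<le> (1 / 10000)\<^sup>2" using \<delta> by (intro power_mono) auto
  show ?thesis
  proof (intro exI[of _ f] bexI[of _ a] conjI)
    have small: "10000 * card ?W \<le> L \<and> 1000 * b \<le> L ^ 3 \<and>
      (1 \<le> \<delta> * real n \<or> violated f T = {} \<and> ?W = {} \<and> L = 1)"
    proof (cases "1 \<le> \<delta> * real n")
      case True
      \<comment> \<open>The factor 2 covers the rounding of the width:
        \<open>\<delta> * n < L + 1\<close> and \<open>1 \<le> L\<close>.\<close>
      have dn: "\<delta> * real n \<le> 2 * real L" using wb(1,2) by linarith
      have "(\<delta> * real n)\<^sup>2 \<le> (2 * real L)\<^sup>2" using dn True by (intro power_mono) auto
      then have "\<delta>\<^sup>2 * (\<delta> * real n)\<^sup>2 \<le> (1 / 10000)\<^sup>2 * (2 * real L)\<^sup>2"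
        using d2 by (intro mult_mono) auto
      moreover have "\<delta> ^ 4 * (real n)\<^sup>2 = \<delta>\<^sup>2 * (\<delta> * real n)\<^sup>2"
        by (simp add: power_mult_distrib mult.assoc[symmetric] flip: power_add)
      moreover have "(1 / 10000)\<^sup>2 * (2 * real L)\<^sup>2 = 4 / 100000000 * (real L * real L)"
        by (simp add: power2_eq_square)
      ultimately have "\<delta> ^ 4 * (real n)\<^sup>2 \<le> 4 / 100000000 * (real L * real L)" by linarith
      then have "real (card ?W) * real L \<le> (128 / 100000000 * real L) * real L"
        using W c ran by simp
      then have "real (card ?W) \<le> 128 / 100000000 * real L" using L by (simp only: mult_le_cancel_right)
      then have 1: "10000 * card ?W \<le> L" by linarith
      have "(\<delta> * real n) ^ 3 \<le> (2 * real L) ^ 3" using dn True by (intro power_mono) auto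
      then have "\<delta> ^ 5 * (\<delta> * real n) ^ 3 \<le> 1 / 10000 * (2 * real L) ^ 3"
        using d5 True \<delta> by (intro mult_mono) auto
      then have "real (1000 * b) \<le> real (L ^ 3)" using b' by (simp add: power_mult_distrib)
      then have "1000 * b \<le> L ^ 3" by (simp only: of_nat_le_iff)
      with 1 True show ?thesis by blast
    next
      case False
      \<comment> \<open>In this regime the bounds on \<open>b\<close> and \<open>r a\<close> drop
        below 1, so both are 0, and with them \<open>c\<close> and the number of displaced
        points.\<close>
      have "(\<delta> * real n) ^ 3 \<le> 1" using False \<delta> by (intro power_le_one) auto
      then have "\<delta> ^ 5 * (\<delta> * real n) ^ 3 \<le> 1 / 10000 * 1"
        using d5 \<delta> by (intro mult_mono) auto
      then have b0: "b = 0" using b' by linarith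
      then have v0: "violated f T = {}" using finv by (simp add: b_def)
      then have "c = 0" by (simp add: c_def violated_at_def)
      have "\<delta> ^ 4 * real n \<le> \<delta> ^ 1 * real n" using \<delta> \<delta>1 by (intro mult_right_mono power_decreasing) auto
      then have "r a = 0" using ra False by simp
      then have "real (card ?W * L) \<le> 0" using W \<open>c = 0\<close> by simp
      then have "card ?W = 0" using L by (simp only: of_nat_le_0_iff mult_is_0) simp
      moreover have "finite ?W" by (rule bucketing.finite_W[OF bucketing])
      ultimately have "?W = {}" by simp
      then show ?thesis using b0 v0 wb(5) False by simp
    qed
    show "good_bucketing n L K T f (score T n a)"
      using small bucketing by (simp add: good_bucketing_def good_bucketing_axioms_def b_def)
    show "1 \<le> \<delta> * real n \<or> violated f T = {} \<and> ?W = {} \<and> L = 1" using small by blast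
  qed fact
qed

definition satisfied_by :: "triples \<Rightarrow> (nat \<Rightarrow> nat) \<Rightarrow> (nat \<Rightarrow> real) \<Rightarrow> triples" where
  "satisfied_by T g x = {(u, v, w) \<in> T. \<bar>x (g u) - x (g v)\<bar> < \<bar>x (g u) - x (g w)\<bar>}"

text \<open>All feasible \<open>x\<close> are covered, because the program finds some solution of
  the system and not the one sampled from \<open>f\<close>. The counting gives a loss of
  \<open>52 * 4 * \<delta>\<close>; it is relaxed to 10000, the inverse of the cutoff for
  \<open>\<delta>\<close>, beyond which the guarantee is void.\<close>

lemma good_pivot_quality:
  assumes inst: "lloc_instance n T" and n: "n \<ge> 1" and \<epsilon>: "\<epsilon> = \<delta> ^ 8" and \<delta>: "0 < \<delta>" "\<delta> \<le> 1 / 10000"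
    and sol: "satisfies_fraction f0 T (1 - \<epsilon>)"
  defines "L \<equiv> width \<epsilon> n"
  defines "K \<equiv> buckets n L"
  shows "\<exists>a\<in>{1..n}. (\<exists>z :: nat \<Rightarrow> real. feasible T (bucket L K \<circ> score T n a) L K z) \<and>
    (\<forall>x :: nat \<Rightarrow> real. feasible T (bucket L K \<circ> score T n a) L K x \<longrightarrow>
      real (card (satisfied_by T (bucket L K \<circ> score T n a) x)) \<ge> (1 - 10000 * \<delta>) * real (card T))"
proof -
  have \<delta>1: "\<delta> < 1" using \<delta> by linarith
  note wb = width_bounds[OF \<epsilon> \<delta>(1) \<delta>1 n, folded L_def]
  note finT = card_instance_le(1)[OF inst]
  obtain f a where a: "a \<in> {1..n}" and gb: "good_bucketing n L K T f (score T n a)"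
    and ex: "1 \<le> \<delta> * real n \<or> violated f T = {} \<and> bucketing.W n L f (score T n a) = {} \<and> L = 1"
    using exists_good_pivot[OF inst n \<epsilon> \<delta> sol] unfolding L_def K_def by blast
  let ?g = "bucket L K \<circ> score T n a"
  interpret good_bucketing n L K T f "score T n a" by (rule gb)
  have g: "g = ?g" by (auto simp: g_def)
  have "real (card (satisfied_by T ?g x)) \<ge> (1 - 10000 * \<delta>) * real (card T)" if x: "feasible T ?g L K x" for x :: "nat \<Rightarrow> real"
  proof -
    have fx: "feasible T g L K x" using x unfolding g .
    have sat: "satisfied_by T ?g x = T - unsatisfied x"
      unfolding unsatisfied_def satisfied_by_def g by auto
    have sub: "unsatisfied x \<subseteq> T" by (auto simp: unsatisfied_def)
    have "card (satisfied_by T ?g x) = card T - card (unsatisfied x)"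
      unfolding sat using finT sub by (meson card_Diff_subset finite_subset)
    moreover have "card (unsatisfied x) \<le> card T" by (rule card_mono[OF finT sub])
    moreover have "real (card (unsatisfied x)) \<le> 10000 * \<delta> * real (card T)"
    proof (cases "1 \<le> \<delta> * real n")
      case True
      have "real n \<ge> 6"
      proof (rule ccontr)
        assume "\<not> ?thesis"
        then have "\<delta> * real n \<le> 1 / 10000 * 6" using \<delta> by (intro mult_mono) auto
        then show False using True by simp
      qed
      then have "n ^ 3 \<le> 4 * card T" by (intro card_instance_ge[OF inst]) simp
      then have T: "real n ^ 3 \<le> 4 * real (card T)" by (metis of_nat_le_iff of_nat_mult of_nat_numeral of_nat_power)
      have "real (card (unsatisfied x)) \<le> real (52 * (L * n\<^sup>2))"
        using card_unsatisfied[OF fx] by (simp only: of_nat_le_iff)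
      also have "\<dots> = 52 * (real L * (real n)\<^sup>2)" by simp
      also have "\<dots> \<le> 52 * ((\<delta> * real n) * (real n)\<^sup>2)"
        by (intro mult_left_mono mult_right_mono wb(4)[OF True]) simp_all
      also have "\<dots> = 52 * \<delta> * real n ^ 3" by (simp add: power2_eq_square power3_eq_cube)
      also have "\<dots> \<le> 52 * \<delta> * (4 * real (card T))" using \<delta> by (intro mult_left_mono T) simp
      also have "\<dots> \<le> 10000 * \<delta> * real (card T)" using \<delta> by simp
      finally show ?thesis .
    next
      case False
      then have "unsatisfied x = {}" using unsatisfied_exact[OF fx] ex by blast
      then show ?thesis using \<delta> by simp
    qed
    ultimately show ?thesis by (simp add: algebra_simps of_nat_diff)
  qed
  moreover have "feasible T ?g L K xs" using feasible_xs unfolding g .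
  ultimately show ?thesis using a by blast
qed

section \<open>The perceptron algorithm\<close>

text \<open>Coefficients of \<open>x p + x q < x c + x d\<close>, the one shape shared by all
  inequalities. Indices may coincide, and their coefficients add up.\<close>

definition row :: "nat \<Rightarrow> nat \<Rightarrow> nat \<Rightarrow> nat \<Rightarrow> nat \<Rightarrow> int" where
  "row p q c d t = of_bool (t = c) + of_bool (t = d) - of_bool (t = p) - of_bool (t = q)"

lemma row_bounds: "\<bar>row p q c d t\<bar> \<le> 4"
  by (simp add: row_def of_bool_def)

lemma dot_row:
  assumes "p < K" "q < K" "c < K" "d < K"
  shows "dot K (row p q c d) y = y c + y d - (y p + y q)"
proof -
  have "(\<Sum>t<K. of_bool (t = a) * y t) = y a" if "a < K" for a
    using that by (subst sum.remove[of _ a]) auto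
  with assms show ?thesis
    by (simp add: dot_def row_def algebra_simps sum.distrib sum_subtractf)
qed

text \<open>The perceptron invariant after \<open>m\<close> corrections: the product with a margin-1
  solution \<open>y\<close> has grown at least linearly, the squared norm at most linearly.\<close>

definition potential :: "nat \<Rightarrow> (nat \<Rightarrow> real) \<Rightarrow> nat \<Rightarrow> (nat \<Rightarrow> int) \<Rightarrow> bool" where
  "potential K y m x \<longleftrightarrow> real m \<le> dot K x y \<and> dot K x (\<lambda>t. of_int (x t)) \<le> 16 * real m"

lemma potential_0: "(\<And>t. t < K \<Longrightarrow> x t = 0) \<Longrightarrow> potential K y 0 x"
  by (simp add: potential_def dot_def)

text \<open>A row that \<open>x\<close> violates has a nonpositive product with \<open>x\<close>, so
  the squared norm grows by at most that of the row. The latter is \<open>dot_row\<close> applied to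
  the row itself, a signed sum of four entries of size at most 4.\<close>

lemma potential_step:
  assumes P: "potential K y m x" and y: "dot K (row p q c d) y \<ge> 1"
    and bad: "\<not> x p + x q < x c + x d" and lt: "p < K" "q < K" "c < K" "d < K"
    and x': "\<And>t. t < K \<Longrightarrow> x' t = x t + row p q c d t"
  shows "potential K y (Suc m) x'"
proof -
  let ?r = "row p q c d"
  have 1: "dot K x' y = dot K x y + dot K ?r y"
    by (simp add: dot_def x' algebra_simps sum.distrib)
  have 2: "dot K x' (\<lambda>t. of_int (x' t)) = dot K x (\<lambda>t. of_int (x t)) + 2 * dot K ?r (\<lambda>t. of_int (x t))
      + dot K ?r (\<lambda>t. of_int (?r t))"
    by (simp add: dot_def x' algebra_simps sum.distrib sum_distrib_left)
  have 3: "dot K ?r (\<lambda>t. of_int (x t)) \<le> 0"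
    using bad unfolding dot_row[OF lt] by linarith
  have "real_of_int (?r c) \<le> 4" "real_of_int (?r d) \<le> 4" "- real_of_int (?r p) \<le> 4" "- real_of_int (?r q) \<le> 4"
    using row_bounds[of p q c d c] row_bounds[of p q c d d] row_bounds[of p q c d p] row_bounds[of p q c d q]
    by linarith+
  then have 4: "dot K ?r (\<lambda>t. of_int (?r t)) \<le> 16" unfolding dot_row[OF lt] by linarith
  show ?thesis using P y 1 2 3 4 unfolding potential_def by simp
qed

text \<open>Expand the square of \<open>x - 16 y\<close>.\<close>

lemma potential_bound:
  assumes P: "potential K y m x" and y: "\<And>t. t < K \<Longrightarrow> \<bar>y t\<bar> \<le> B"
  shows "real m \<le> 16 * (real K * B\<^sup>2)"
proof -
  have "0 \<le> (\<Sum>t<K. (of_int (x t) - 16 * y t)\<^sup>2)" by (intro sum_nonneg) simp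
  also have "\<dots> = dot K x (\<lambda>t. of_int (x t)) - 32 * dot K x y + 256 * (\<Sum>t<K. (y t)\<^sup>2)"
    by (simp add: dot_def power2_eq_square algebra_simps sum.distrib sum_subtractf sum_distrib_left sum_distrib_right)
  also have "\<dots> \<le> 16 * real m - 32 * real m + 256 * (\<Sum>t<K. (y t)\<^sup>2)"
    using P unfolding potential_def by linarith
  finally have "real m \<le> 16 * (\<Sum>t<K. (y t)\<^sup>2)" by simp
  also have "(\<Sum>t<K. (y t)\<^sup>2) \<le> (\<Sum>t<K. B\<^sup>2)"
    using y by (intro sum_mono) (simp add: abs_le_square_iff[symmetric] order.trans[OF _ abs_ge_self])
  finally show ?thesis by simp
qed

definition solves :: "triples \<Rightarrow> (nat \<Rightarrow> nat) \<Rightarrow> nat \<Rightarrow> nat \<Rightarrow> (nat \<Rightarrow> real) \<Rightarrow> bool" where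
  "solves T g L K y \<longleftrightarrow> (\<forall>i<K. \<forall>j<K. \<forall>k<K.
     (up_constraint T g L i j k \<longrightarrow> dot K (row i i j k) y \<ge> 1) \<and>
     (down_constraint T g L i j k \<longrightarrow> dot K (row j k i i) y \<ge> 1))"

text \<open>The finite system consists of all rows that \<open>z\<close> satisfies strictly. Adding
  the constant \<open>b\<close> makes \<open>z\<close> positive, as
  \<open>bounded_strict_solution\<close> demands, and changes no product, since the coefficients of
  a row sum to 0.\<close>

lemma bounded_feasible:
  assumes f: "feasible T g L K (z :: nat \<Rightarrow> real)"
  shows "\<exists>y. solves T g L K y \<and> (\<forall>t<K. \<bar>y t\<bar> \<le> (4 * real K) ^ K)"
proof -
  define A where "A = {row p q c d | p q c d. p < K \<and> q < K \<and> c < K \<and> d < K \<and> z p + z q < z c + z d}"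
  have "A \<subseteq> (\<lambda>(p, q, c, d). row p q c d) ` ({..<K} \<times> {..<K} \<times> {..<K} \<times> {..<K})"
    unfolding A_def by force
  then have fin: "finite A" by (rule finite_subset) simp
  define b where "b = 1 - Min (insert 0 (z ` {..<K}))"
  have pos: "z t + b > 0" if "t < K" for t
  proof -
    have "Min (insert 0 (z ` {..<K})) \<le> z t" using that by (intro Min_le) auto
    then show ?thesis by (simp add: b_def)
  qed
  have "\<exists>y. (\<forall>a\<in>A. dot K a y \<ge> 1) \<and> (\<forall>t<K. \<bar>y t\<bar> \<le> (4 * real K) ^ K)"
  proof (rule bounded_strict_solution[OF fin, where x = "\<lambda>t. z t + b"])
    fix a assume "a \<in> A"
    then show "\<bar>a t\<bar> \<le> 4" for t using row_bounds unfolding A_def by blast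
    from \<open>a \<in> A\<close> obtain p q c d where "a = row p q c d" "p < K" "q < K" "c < K" "d < K" "z p + z q < z c + z d"
      unfolding A_def by blast
    then show "dot K a (\<lambda>t. z t + b) > 0" by (simp add: dot_row)
  qed (use pos in blast)
  then obtain y where y: "\<forall>a\<in>A. dot K a y \<ge> 1" "\<forall>t<K. \<bar>y t\<bar> \<le> (4 * real K) ^ K" by blast
  have "dot K (row p q c d) y \<ge> 1" if "p < K" "q < K" "c < K" "d < K" "z p + z q < z c + z d" for p q c d
    using y(1) that unfolding A_def by blast
  then have "solves T g L K y" using feasibleD[OF f] unfolding solves_def by simp
  with y(2) show ?thesis by blast
qed

text \<open>The bound is a \<open>K\<close>-th power, so that the program can compute it with one
  loop of \<open>K\<close> passes; \<open>16 * K < 64 ^ K\<close> absorbs the leading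
  factor.\<close>

lemma mistake_bound:
  assumes "potential K y m x" "\<forall>t<K. \<bar>y t\<bar> \<le> (4 * real K) ^ K" "K > 0"
  shows "m < (1024 * (K * K)) ^ K"
proof -
  have "real m \<le> 16 * (real K * ((4 * real K) ^ K)\<^sup>2)"
    using potential_bound[OF assms(1)] assms(2) by blast
  also have "((4 * real K) ^ K)\<^sup>2 = ((4 * real K)\<^sup>2) ^ K"
    by (simp only: mult.commute flip: power_mult)
  also have "(4 * real K)\<^sup>2 = real (16 * (K * K))" by (simp add: power2_eq_square)
  also have "16 * (real K * real (16 * (K * K)) ^ K) = real (16 * (K * (16 * (K * K)) ^ K))"
    by (simp only: of_nat_mult of_nat_power of_nat_numeral)
  finally have "m \<le> 16 * (K * (16 * (K * K)) ^ K)" by linarith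
  also have "\<dots> = (16 * K) * (16 * (K * K)) ^ K" by (simp only: mult.assoc)
  also have "\<dots> < 64 ^ K * (16 * (K * K)) ^ K"
  proof (rule mult_strict_right_mono)
    have "16 * K < 16 * 2 ^ K" by simp
    also have "\<dots> \<le> 32 ^ K * 2 ^ K"
    proof (rule mult_le_mono1)
      have "(32::nat) ^ 1 \<le> 32 ^ K" using assms(3) by (intro power_increasing) simp_all
      then show "(16::nat) \<le> 32 ^ K" by simp
    qed
    also have "(32::nat) ^ K * 2 ^ K = (32 * 2) ^ K" by (rule power_mult_distrib[symmetric])
    finally show "16 * K < 64 ^ K" by simp
  qed (use assms(3) in simp)
  also have "\<dots> = (64 * (16 * (K * K))) ^ K" by (rule power_mult_distrib[symmetric])
  also have "64 * (16 * (K * K)) = 1024 * (K * K)" by simp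
  finally show ?thesis .
qed

section \<open>Program logic\<close>

text \<open>Termination is part of the claim, and since \<open>exec\<close> is deterministic, the
  run that exists is the only one.\<close>

definition runs :: "com \<Rightarrow> state \<Rightarrow> nat \<Rightarrow> (state \<Rightarrow> bool) \<Rightarrow> bool" where
  "runs c s B Q \<longleftrightarrow> (\<exists>t s'. exec c s t s' \<and> t \<le> B \<and> Q s')"

lemma runs_mono:
  "runs c s B Q \<Longrightarrow> B \<le> B' \<Longrightarrow> (\<And>s'. Q s' \<Longrightarrow> Q' s') \<Longrightarrow> runs c s B' Q'"
  unfolding runs_def by (meson order_trans)

lemma runs_Skip: "1 \<le> B \<Longrightarrow> Q s \<Longrightarrow> runs Skip s B Q"
  unfolding runs_def using exec.Skip by blast

lemma runs_ISet:
  "1 + sum_list (map icost is) + icost e \<le> B \<Longrightarrow> Q (iset a (map (ival s) is) (ival s e) s) \<Longrightarrow>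
   runs (ISet a is e) s B Q"
  unfolding runs_def using exec.ISet by blast

lemma runs_RSet:
  "1 + sum_list (map icost is) + rcost e \<le> B \<Longrightarrow> Q (rset a (map (ival s) is) (rval s e) s) \<Longrightarrow>
   runs (RSet a is e) s B Q"
  unfolding runs_def using exec.RSet by blast

lemma runs_Seq:
  assumes "runs c1 s B1 (\<lambda>s1. runs c2 s1 B2 Q)" "B1 + B2 \<le> B"
  shows "runs (Seq c1 c2) s B Q"
proof -
  from assms(1) obtain t1 s1 t2 s2 where "exec c1 s t1 s1" "t1 \<le> B1" "exec c2 s1 t2 s2" "t2 \<le> B2" "Q s2"
    unfolding runs_def by blast
  with assms(2) show ?thesis unfolding runs_def
    by (intro exI[of _ "t1 + t2"] exI[of _ s2]) (auto intro: exec.Seq)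
qed

lemma runs_If:
  assumes "bval s b \<Longrightarrow> runs c1 s B' Q" "\<not> bval s b \<Longrightarrow> runs c2 s B' Q" "1 + bcost b + B' \<le> B"
  shows "runs (If b c1 c2) s B Q"
proof (cases "bval s b")
  case True
  with assms(1) obtain t s' where "exec c1 s t s'" "t \<le> B'" "Q s'" unfolding runs_def by blast
  then have "exec (If b c1 c2) s (1 + bcost b + t) s'" "1 + bcost b + t \<le> B" "Q s'"
    using True assms(3) by (auto intro: exec.IfTrue simp del: One_nat_def plus_1_eq_Suc add_Suc add_Suc_right)
  then show ?thesis unfolding runs_def by blast
next
  case False
  with assms(2) obtain t s' where "exec c2 s t s'" "t \<le> B'" "Q s'" unfolding runs_def by blast
  then have "exec (If b c1 c2) s (1 + bcost b + t) s'" "1 + bcost b + t \<le> B" "Q s'"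
    using False assms(3) by (auto intro: exec.IfFalse simp del: One_nat_def plus_1_eq_Suc add_Suc add_Suc_right)
  then show ?thesis unfolding runs_def by blast
qed

lemma ints_iset [simp]: "ints (iset a js z s) = (ints s)(a := (ints s a)(js := z))"
  and reals_iset [simp]: "reals (iset a js z s) = reals s"
  and ints_rset [simp]: "ints (rset a js r s) = ints s"
  and reals_rset [simp]: "reals (rset a js r s) = (reals s)(a := (reals s a)(js := r))"
  by (simp_all add: iset_def rset_def)

text \<open>A syntactic upper bound on the arrays that a program can change; with
  \<open>agree\<close> it serves as a frame rule.\<close>

primrec iwrites :: "com \<Rightarrow> nat set" where
  "iwrites Skip = {}"
| "iwrites (ISet a is e) = {a}"
| "iwrites (RSet a is e) = {}"
| "iwrites (Seq c1 c2) = iwrites c1 \<union> iwrites c2"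
| "iwrites (If b c1 c2) = iwrites c1 \<union> iwrites c2"
| "iwrites (While b c) = iwrites c"

primrec rwrites :: "com \<Rightarrow> nat set" where
  "rwrites Skip = {}"
| "rwrites (ISet a is e) = {}"
| "rwrites (RSet a is e) = {a}"
| "rwrites (Seq c1 c2) = rwrites c1 \<union> rwrites c2"
| "rwrites (If b c1 c2) = rwrites c1 \<union> rwrites c2"
| "rwrites (While b c) = rwrites c"

definition agree :: "nat set \<Rightarrow> nat set \<Rightarrow> state \<Rightarrow> state \<Rightarrow> bool" where
  "agree X Y s s' \<longleftrightarrow> (\<forall>a. a \<notin> X \<longrightarrow> ints s' a = ints s a) \<and> (\<forall>a. a \<notin> Y \<longrightarrow> reals s' a = reals s a)"

lemma agreeD:
  "agree X Y s s' \<Longrightarrow> a \<notin> X \<Longrightarrow> ints s' a = ints s a"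
  "agree X Y s s' \<Longrightarrow> a \<notin> Y \<Longrightarrow> reals s' a = reals s a"
  by (auto simp: agree_def)

lemma exec_agree: "exec c s t s' \<Longrightarrow> agree (iwrites c) (rwrites c) s s'"
  by (induction rule: exec.induct) (auto simp: agree_def)

lemma runs_agree: "runs c s B Q \<Longrightarrow> runs c s B (\<lambda>s'. Q s' \<and> agree (iwrites c) (rwrites c) s s')"
  unfolding runs_def using exec_agree by blast

definition For :: "nat \<Rightarrow> bexp \<Rightarrow> com \<Rightarrow> com" where
  "For x b c = Seq (ISet x [] (IConst 0)) (While b (Seq c (ISet x [] (IAdd (IGet x []) (IConst 1)))))"

lemma iwrites_For [simp]: "iwrites (For x b c) = insert x (iwrites c)"
  and rwrites_For [simp]: "rwrites (For x b c) = rwrites c"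
  by (auto simp: For_def)

text \<open>\<open>I i\<close> describes the state after \<open>i\<close> passes and must survive
  changes of the counter, which is incremented after the body. \<open>guard\<close> abstracts from
  the limit, which is a real number in the loop over sweeps.\<close>

lemma runs_For:
  assumes x: "x \<notin> iwrites c"
    and guard: "\<And>i s'. agree (insert x (iwrites c)) (rwrites c) s s' \<Longrightarrow> ints s' x [] = int i \<Longrightarrow>
      bval s' b \<longleftrightarrow> i < N"
    and cost: "bcost b \<le> g"
    and init: "I 0 s"
    and counter: "\<And>i s' z. I i s' \<Longrightarrow> I i (iset x [] z s')"
    and step: "\<And>i s'. i < N \<Longrightarrow> agree (insert x (iwrites c)) (rwrites c) s s' \<Longrightarrow> ints s' x [] = int i \<Longrightarrow>
      I i s' \<Longrightarrow> runs c s' B (I (Suc i))"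
    and fin: "3 + g + N * (B + g + 6) \<le> B'"
  shows "runs (For x b c) s B' (\<lambda>s'. I N s' \<and> agree (insert x (iwrites c)) (rwrites c) s s')"
proof -
  let ?A = "agree (insert x (iwrites c)) (rwrites c) s"
  let ?w = "Seq c (ISet x [] (IAdd (IGet x []) (IConst 1)))"
  have loop: "runs (While b ?w) s' (1 + g + m * (B + g + 6)) (\<lambda>s'. I N s' \<and> ?A s')"
    if "m = N - i" "i \<le> N" "?A s'" "ints s' x [] = int i" "I i s'" for m i s'
    using that
  proof (induction m arbitrary: i s')
    case 0
    then have "\<not> bval s' b" using guard by simp
    then have "exec (While b ?w) s' (1 + bcost b) s'" by (rule exec.WhileFalse)
    then show ?case using 0 cost unfolding runs_def by (intro exI conjI) auto
  next
    case (Suc m)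
    then have i: "i < N" by simp
    then have b: "bval s' b" using guard[OF Suc.prems(3,4)] by simp
    have "runs c s' B (\<lambda>s'' . I (Suc i) s'' \<and> agree (iwrites c) (rwrites c) s' s'')"
      using step[OF i] Suc.prems by (intro runs_agree) auto
    then obtain t1 s1 where 1: "exec c s' t1 s1" "t1 \<le> B" "I (Suc i) s1"
      "agree (iwrites c) (rwrites c) s' s1" unfolding runs_def by auto
    have xi: "ints s1 x [] = int i" using agreeD(1)[OF 1(4) x] Suc.prems by simp
    define s2 where "s2 = iset x [] (int (Suc i)) s1"
    have "exec (ISet x [] (IAdd (IGet x []) (IConst 1))) s1 4 s2"
      using exec.ISet[of x "[]" "IAdd (IGet x []) (IConst 1)" s1] xi by (simp add: s2_def add.commute eval_nat_numeral)
    with 1(1) have body: "exec ?w s' (t1 + 4) s2" by (rule exec.Seq)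
    have "?A s2" using 1(4) Suc.prems(3) by (auto simp: agree_def s2_def)
    moreover have "I (Suc i) s2" using counter[OF 1(3)] by (simp add: s2_def)
    ultimately have "runs (While b ?w) s2 (1 + g + m * (B + g + 6)) (\<lambda>s'. I N s' \<and> ?A s')"
      using Suc.prems by (intro Suc.IH[of "Suc i"]) (auto simp: s2_def)
    then obtain t2 s3 where 2: "exec (While b ?w) s2 t2 s3" "t2 \<le> 1 + g + m * (B + g + 6)" "I N s3" "?A s3"
      unfolding runs_def by auto
    have "exec (While b ?w) s' (1 + bcost b + (t1 + 4) + t2) s3"
      by (rule exec.WhileTrue[OF b body 2(1)])
    moreover have "1 + bcost b + (t1 + 4) + t2 \<le> 1 + g + Suc m * (B + g + 6)"
      using 1(2) 2(2) cost by simp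
    ultimately show ?case using 2 unfolding runs_def by blast
  qed
  show ?thesis unfolding For_def
  proof (rule runs_Seq[where ?B1.0 = 2])
    show "runs (ISet x [] (IConst 0)) s 2 (\<lambda>s1. runs (While b ?w) s1 (1 + g + N * (B + g + 6)) (\<lambda>s'. I N s' \<and> ?A s'))"
    proof (rule runs_ISet)
      show "runs (While b ?w) (iset x (map (ival s) []) (ival s (IConst 0)) s) (1 + g + N * (B + g + 6)) (\<lambda>s'. I N s' \<and> ?A s')"
        by (rule loop[of _ 0]) (auto simp: agree_def intro: counter init)
    qed simp
  qed (use fin in simp)
qed

abbreviation "IVar x \<equiv> IGet x []"
abbreviation "below x y \<equiv> ILess (IVar x) (IVar y)"

lemma runs_For_below:
  assumes x: "x \<notin> iwrites c" "y \<noteq> x" "y \<notin> iwrites c"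
    and N: "ints s y [] = int N"
    and init: "I 0 s"
    and counter: "\<And>i s' z. I i s' \<Longrightarrow> I i (iset x [] z s')"
    and step: "\<And>i s'. i < N \<Longrightarrow> agree (insert x (iwrites c)) (rwrites c) s s' \<Longrightarrow> ints s' x [] = int i \<Longrightarrow>
      I i s' \<Longrightarrow> runs c s' B (I (Suc i))"
    and fin: "6 + N * (B + 9) \<le> B'"
  shows "runs (For x (below x y) c) s B' (\<lambda>s'. I N s' \<and> agree (insert x (iwrites c)) (rwrites c) s s')"
proof (rule runs_For[where g = 3 and N = N and B = B and I = I])
  fix i s' assume a: "agree (insert x (iwrites c)) (rwrites c) s s'" "ints s' x [] = int i"
  have "ints s' y = ints s y" by (rule agreeD(1)[OF a(1)]) (use x in auto)
  then show "bval s' (below x y) \<longleftrightarrow> i < N" using a N by simp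
qed (use assms in \<open>auto simp: add.commute\<close>)

lemma agree_trans: "agree X Y s s1 \<Longrightarrow> agree X' Y' s1 s2 \<Longrightarrow> X \<subseteq> Z \<Longrightarrow> X' \<subseteq> Z \<Longrightarrow> Y \<subseteq> Z' \<Longrightarrow> Y' \<subseteq> Z' \<Longrightarrow> agree Z Z' s s2"
  unfolding agree_def by (metis subsetD)

lemma agree_mono: "agree X Y s s1 \<Longrightarrow> X \<subseteq> Z \<Longrightarrow> Y \<subseteq> Z' \<Longrightarrow> agree Z Z' s s1"
  unfolding agree_def by blast

text \<open>Indexing the invariant by the set of visited triples hides the order of the three loops.
  Counting uses that this set is finite and that the current triple is new.\<close>

lemma runs_For3:
  assumes x: "distinct [x1, x2, x3, y]" "{x1, x2, x3, y} \<inter> iwrites c = {}"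
    and N: "ints s y [] = int N"
    and init: "I {} s"
    and counter: "\<And>X s' z x. x \<in> {x1, x2, x3} \<Longrightarrow> I X s' \<Longrightarrow> I X (iset x [] z s')"
    and step: "\<And>X i j k s'. i < N \<Longrightarrow> j < N \<Longrightarrow> k < N \<Longrightarrow> (i, j, k) \<notin> X \<Longrightarrow> finite X \<Longrightarrow>
      agree ({x1, x2, x3} \<union> iwrites c) (rwrites c) s s' \<Longrightarrow>
      ints s' x1 [] = int i \<Longrightarrow> ints s' x2 [] = int j \<Longrightarrow> ints s' x3 [] = int k \<Longrightarrow> I X s' \<Longrightarrow>
      runs c s' B (I (insert (i, j, k) X))"
    and fin: "6 + N * (6 + N * (6 + N * (B + 9) + 9) + 9) \<le> B'"
  shows "runs (For x1 (below x1 y) (For x2 (below x2 y) (For x3 (below x3 y) c))) s B'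
    (\<lambda>s'. I ({..<N} \<times> {..<N} \<times> {..<N}) s' \<and> agree ({x1, x2, x3} \<union> iwrites c) (rwrites c) s s')"
proof -
  let ?A = "agree ({x1, x2, x3} \<union> iwrites c) (rwrites c)"
  let ?S = "{..<N}"
  let ?c3 = "For x3 (below x3 y) c"
  let ?c2 = "For x2 (below x2 y) ?c3"
  let ?B3 = "6 + N * (B + 9)"
  let ?B2 = "6 + N * (?B3 + 9)"
  have y: "ints s' y [] = int N" if "?A s s'" for s'
    using agreeD(1)[OF that, of y] x N by auto
  have get: "ints s' a = ints s0 a" if "agree X Y s0 s'" "a \<notin> X" for a s' s0 X Y
    using agreeD(1)[OF that] .
  have "runs (For x1 (below x1 y) ?c2) s B'
    (\<lambda>s'. I ({..<N} \<times> ?S \<times> ?S) s' \<and> agree (insert x1 (iwrites ?c2))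
      (rwrites ?c2) s s')"
  proof (rule runs_For_below[where N = N and B = ?B2 and I = "\<lambda>i. I ({..<i} \<times> ?S \<times> ?S)"])
    fix i s1 assume i: "i < N" and a1: "agree (insert x1 (iwrites ?c2))
      (rwrites ?c2) s s1"
      and v1: "ints s1 x1 [] = int i" and I1: "I ({..<i} \<times> ?S \<times> ?S) s1"
    have A1: "?A s s1" by (rule agree_mono[OF a1]) auto
    let ?X1 = "{..<i} \<times> ?S \<times> ?S"
    have "runs ?c2 s1 ?B2
      (\<lambda>s'. I (?X1 \<union> {i} \<times> {..<N} \<times> ?S) s' \<and> agree (insert x2 (iwrites ?c3)) (rwrites ?c3) s1 s')"
    proof (rule runs_For_below[where N = N and B = ?B3 and I = "\<lambda>j. I (?X1 \<union> {i} \<times> {..<j} \<times> ?S)"])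
      fix j s2 assume j: "j < N" and a2: "agree (insert x2 (iwrites ?c3)) (rwrites ?c3) s1 s2"
        and v2: "ints s2 x2 [] = int j" and I2: "I (?X1 \<union> {i} \<times> {..<j} \<times> ?S) s2"
      have A2: "?A s s2" by (rule agree_trans[OF A1 a2]) auto
      have v12: "ints s2 x1 [] = int i" using get[OF a2, of x1] x v1 by auto
      let ?X2 = "?X1 \<union> {i} \<times> {..<j} \<times> ?S"
      have "runs ?c3 s2 ?B3
        (\<lambda>s'. I (?X2 \<union> {i} \<times> {j} \<times> {..<N}) s' \<and> agree (insert x3 (iwrites c)) (rwrites c) s2 s')"
      proof (rule runs_For_below[where N = N and B = B and I = "\<lambda>k. I (?X2 \<union> {i} \<times> {j} \<times> {..<k})"])
        fix k s3 assume k: "k < N" and a3: "agree (insert x3 (iwrites c)) (rwrites c) s2 s3"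
          and v3: "ints s3 x3 [] = int k" and I3: "I (?X2 \<union> {i} \<times> {j} \<times> {..<k}) s3"
        have "?A s s3" by (rule agree_trans[OF A2 a3]) auto
        moreover have "ints s3 x1 [] = int i" "ints s3 x2 [] = int j"
          using get[OF a3, of x1] get[OF a3, of x2] x v12 v2 by auto
        ultimately have "runs c s3 B (I (insert (i, j, k) (?X2 \<union> {i} \<times> {j} \<times> {..<k})))"
          by (intro step i j k v3 I3) auto
        moreover have "insert (i, j, k) (?X2 \<union> {i} \<times> {j} \<times> {..<k}) = ?X2 \<union> {i} \<times> {j} \<times> {..<Suc k}" by auto
        ultimately show "runs c s3 B (I (?X2 \<union> {i} \<times> {j} \<times> {..<Suc k}))" by simp
      next
        show "x3 \<notin> iwrites c" "y \<noteq> x3" "y \<notin> iwrites c" using x by auto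
        show "ints s2 y [] = int N" by (rule y[OF A2])
        show "I (?X2 \<union> {i} \<times> {j} \<times> {..<0}) s2" using I2 by simp
        show "I (?X2 \<union> {i} \<times> {j} \<times> {..<k}) (iset x3 [] z s')" if "I (?X2 \<union> {i} \<times> {j} \<times> {..<k}) s'" for k s' z
          by (rule counter[OF _ that]) simp
      qed (rule order_refl)
      note R = this
      have e: "?X2 \<union> {i} \<times> {j} \<times> {..<N} = ?X1 \<union> {i} \<times> {..<Suc j} \<times> ?S" by auto
      show "runs ?c3 s2 ?B3 (I (?X1 \<union> {i} \<times> {..<Suc j} \<times> ?S))"
        by (rule runs_mono[OF R[unfolded e] order_refl]) (erule conjunct1)
    next
      show "x2 \<notin> iwrites ?c3" "y \<noteq> x2" "y \<notin> iwrites ?c3" using x by auto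
      show "ints s1 y [] = int N" by (rule y[OF A1])
      show "I (?X1 \<union> {i} \<times> {..<0} \<times> ?S) s1" using I1 by simp
      show "I (?X1 \<union> {i} \<times> {..<j} \<times> ?S) (iset x2 [] z s')" if "I (?X1 \<union> {i} \<times> {..<j} \<times> ?S) s'" for j s' z
        by (rule counter[OF _ that]) simp
    qed (rule order_refl)
    note R = this
    have e: "?X1 \<union> {i} \<times> {..<N} \<times> ?S = {..<Suc i} \<times> ?S \<times> ?S" by auto
    show "runs ?c2 s1 ?B2 (I ({..<Suc i} \<times> ?S \<times> ?S))"
      by (rule runs_mono[OF R[unfolded e] order_refl]) (erule conjunct1)
  next
    show "x1 \<notin> iwrites ?c2" "y \<noteq> x1"
      "y \<notin> iwrites ?c2" using x by auto
    show "I ({..<0} \<times> ?S \<times> ?S) s" using init by simp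
    show "I ({..<i} \<times> ?S \<times> ?S) (iset x1 [] z s')" if "I ({..<i} \<times> ?S \<times> ?S) s'" for i s' z
      by (rule counter[OF _ that]) simp
  qed (rule N fin)+
  then show ?thesis by (rule runs_mono) (auto elim: agree_mono)
qed

abbreviation "tally acc b \<equiv> If b (ISet acc [] (IAdd (IVar acc) (IConst 1))) Skip"

lemma runs_tally:
  assumes "bval s b \<longleftrightarrow> p" "bcost b \<le> g" "ints s acc [] = int m" "g + 5 \<le> B"
  shows "runs (tally acc b) s B (\<lambda>s'. ints s' acc [] = int (m + of_bool p))"
  by (rule runs_If[where B' = 4]) (use assms in \<open>auto intro!: runs_ISet runs_Skip\<close>)

section \<open>The program\<close>

text \<open>
  Integer scalars of the program: 0 is \<open>n\<close>, 2 is \<open>n + 1\<close>, 3 the bucket width \<open>L\<close>, 4 the number \<open>K\<close> of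
  buckets, 5 the pivot, 6 to 8 points, 9 to 11 buckets, 12 the sweep, 13 a counter, 17 the number of
  constraints satisfied by the best output so far, 18 a score. Integer arrays: 1 is \<open>T\<close>, 14 the bucket of
  a point, 15 the box counts, 16 the bucket values. Real scalar 2 is the number of sweeps. Points range
  over \<open>0..n\<close>; the point 0 occurs in no constraint and is harmless, also as a pivot.
\<close>

abbreviation "BEq e1 e2 \<equiv> BAnd (BNot (ILess e1 e2)) (BNot (ILess e2 e1))"
abbreviation "BOr b1 b2 \<equiv> BNot (BAnd (BNot b1) (BNot b2))"
abbreviation "RVar x \<equiv> ROfInt (IVar x)"
abbreviation "coord p \<equiv> IGet 16 [IVar p]"

section \<open>Perceptron sweeps in the program\<close>

definition shift :: "nat \<Rightarrow> (iexp \<Rightarrow> iexp \<Rightarrow> iexp) \<Rightarrow> com" where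
  "shift p f = ISet 16 [IVar p] (f (coord p) (IConst 1))"

text \<open>One perceptron correction, guarded by \<open>b\<close>. The four entries are changed one
  after the other, so that coinciding indices accumulate as in \<open>row\<close>.\<close>

definition repair :: "bexp \<Rightarrow> nat \<Rightarrow> nat \<Rightarrow> nat \<Rightarrow> nat \<Rightarrow> com" where
  "repair b p q c d =
     If (BAnd b (BNot (ILess (IAdd (coord p) (coord q)) (IAdd (coord c) (coord d)))))
       (Seq (Seq (shift p ISub) (shift q ISub)) (Seq (shift c IAdd) (shift d IAdd))) Skip"

lemma writes_repair [simp]: "iwrites (repair b p q c d) = {16}" "rwrites (repair b p q c d) = {}"
  by (simp_all add: repair_def shift_def)

definition vec_of :: "state \<Rightarrow> nat \<Rightarrow> int" where "vec_of s t = ints s 16 [int t]"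

lemma vec_of_iset [simp]: "vec_of (iset x [] z s) = vec_of s"
  by (simp add: vec_of_def fun_eq_iff)

lemma runs_shift:
  assumes f: "f = IAdd \<and> e = 1 \<or> f = ISub \<and> e = -1" and p: "ints s p [] = int P" "p \<noteq> 16"
  shows "runs (shift p f) s 10 (\<lambda>s'. (\<forall>t. vec_of s' t = vec_of s t + e * of_bool (t = P)) \<and> (\<forall>a. a \<noteq> 16 \<longrightarrow> ints s' a = ints s a))"
  unfolding shift_def by (rule runs_ISet) (use f p in \<open>auto simp: vec_of_def\<close>)

lemma runs_repair:
  assumes p: "ints s p [] = int P" "ints s q [] = int Q" "ints s c [] = int C" "ints s d [] = int D"
    and ne: "p \<noteq> 16" "q \<noteq> 16" "c \<noteq> 16" "d \<noteq> 16"
    and b: "bval s b \<longleftrightarrow> act" "bcost b \<le> 45"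
  shows "runs (repair b p q c d) s 100 (\<lambda>s'.
    vec_of s' = (if act \<and> \<not> vec_of s P + vec_of s Q < vec_of s C + vec_of s D
      then (\<lambda>t. vec_of s t + row P Q C D t) else vec_of s) \<and> agree {16} {} s s')"
proof -
  let ?g = "\<lambda>s s' e P. (\<forall>t. vec_of s' t = vec_of s t + e * of_bool (t = P)) \<and> (\<forall>a. a \<noteq> 16 \<longrightarrow> ints s' a = ints s a)"
  let ?Q = "\<lambda>s'. vec_of s' = (\<lambda>t. vec_of s t + row P Q C D t)"
  let ?up = "Seq (shift c IAdd) (shift d IAdd)"
  have seq: "runs (Seq (Seq (shift p ISub) (shift q ISub)) ?up) s 40
      ?Q"
  proof (rule runs_Seq[where ?B1.0 = 20 and ?B2.0 = 20], rule runs_Seq[where ?B1.0 = 10 and ?B2.0 = 10])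
    show "runs (shift p ISub) s 10 (\<lambda>s1. runs (shift q ISub) s1 10 (\<lambda>s1.
        runs ?up s1 20 ?Q))"
    proof (rule runs_mono[OF runs_shift[where e = "-1" and P = P] order_refl])
      fix s1 assume 1: "?g s s1 (- 1) P"
      show "runs (shift q ISub) s1 10 (\<lambda>s1.
        runs ?up s1 20 ?Q)"
      proof (rule runs_mono[OF runs_shift[where e = "-1" and P = Q] order_refl])
        fix s2 assume 2: "?g s1 s2 (- 1) Q"
        show "runs ?up s2 20 ?Q"
        proof (rule runs_Seq[where ?B1.0 = 10 and ?B2.0 = 10], rule runs_mono[OF runs_shift[where e = 1 and P = C] order_refl])
          fix s3 assume 3: "?g s2 s3 1 C"
          show "runs (shift d IAdd) s3 10 ?Q"
            by (rule runs_mono[OF runs_shift[where e = 1 and P = D] order_refl])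
              (use 1 2 3 p ne in \<open>auto simp: row_def fun_eq_iff\<close>)
        qed (use 1 2 p ne in auto)
      qed (use 1 p ne in auto)
    qed (use p ne in auto)
  qed simp_all
  have cond: "bval s (BAnd b (BNot (ILess (IAdd (coord p) (coord q)) (IAdd (coord c) (coord d))))) \<longleftrightarrow>
      act \<and> \<not> vec_of s P + vec_of s Q < vec_of s C + vec_of s D"
    using b(1) p by (simp add: vec_of_def)
  have "runs (repair b p q c d) s 100 (\<lambda>s'.
    vec_of s' = (if act \<and> \<not> vec_of s P + vec_of s Q < vec_of s C + vec_of s D
      then (\<lambda>t. vec_of s t + row P Q C D t) else vec_of s))"
    unfolding repair_def
  proof (rule runs_If[where B' = 40], goal_cases)
    case 1
    then show ?case using seq unfolding cond by (simp only: if_True simp_thms)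
  next
    case 2
    then show ?case unfolding cond by (intro runs_Skip) (simp, simp only: if_False)
  next
    case 3
    then show ?case using b(2) by simp
  qed
  from runs_agree[OF this] show ?thesis by simp
qed

definition sat_at :: "triples \<Rightarrow> (nat \<Rightarrow> nat) \<Rightarrow> nat \<Rightarrow> (nat \<Rightarrow> int) \<Rightarrow> nat \<Rightarrow> nat \<Rightarrow> nat \<Rightarrow> bool" where
  "sat_at T g L x i j k \<longleftrightarrow>
     (up_constraint T g L i j k \<longrightarrow> x i + x i < x j + x k) \<and>
     (down_constraint T g L i j k \<longrightarrow> x j + x k < x i + x i)"

lemma feasible_sat_at: "feasible T g L K x \<longleftrightarrow> (\<forall>(i, j, k) \<in> {..<K} \<times> {..<K} \<times> {..<K}. sat_at T g L x i j k)"
  unfolding feasible_def sat_at_def by auto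

text \<open>\<open>t\<close> sweeps are complete and \<open>X\<close> is the visited part of the
  current one. Either the number \<open>m\<close> of corrections already exceeds \<open>t\<close>,
  or all of \<open>X\<close> is satisfied as it stands. Hence every sweep makes a correction or ends
  feasible. The alternative \<open>feasible\<close> carries the invariant on after success, when
  \<open>m\<close> no longer grows.\<close>

definition sweep_inv :: "triples \<Rightarrow> (nat \<Rightarrow> nat) \<Rightarrow> nat \<Rightarrow> nat \<Rightarrow> (nat \<Rightarrow> real) \<Rightarrow> nat \<Rightarrow>
    triples \<Rightarrow> (nat \<Rightarrow> int) \<Rightarrow> bool" where
  "sweep_inv T g L K y t X x \<longleftrightarrow> (\<exists>m. potential K y m x \<and>
     (t < m \<or> (t \<le> m \<or> feasible T g L K x) \<and> (\<forall>(i, j, k)\<in>X. sat_at T g L x i j k)))"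

definition repaired :: "bool \<Rightarrow> nat \<Rightarrow> nat \<Rightarrow> nat \<Rightarrow> nat \<Rightarrow> (nat \<Rightarrow> int) \<Rightarrow> nat \<Rightarrow> int" where
  "repaired act P Q C D x =
    (if act \<and> \<not> x P + x Q < x C + x D then (\<lambda>t. x t + row P Q C D t) else x)"

lemma repaired_potential:
  assumes pot: "potential K y m x" and lt: "P < K" "Q < K" "C < K" "D < K"
    and y: "act \<longrightarrow> dot K (row P Q C D) y \<ge> 1"
  shows "act \<and> \<not> x P + x Q < x C + x D \<and> potential K y (Suc m) (repaired act P Q C D x) \<or>
    (act \<longrightarrow> x P + x Q < x C + x D) \<and> repaired act P Q C D x = x"
proof (cases "act \<and> \<not> x P + x Q < x C + x D")
  case True
  then have "dot K (row P Q C D) y \<ge> 1" using y by blast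
  with True have "potential K y (Suc m) (repaired act P Q C D x)"
    by (intro potential_step[OF pot _ _ lt]) (auto simp: repaired_def)
  with True show ?thesis by blast
next
  case False
  then show ?thesis by (auto simp: repaired_def)
qed

lemma sweep_inv_step:
  assumes y: "solves T g L K y" and inv: "sweep_inv T g L K y t X x" and lt: "i < K" "j < K" "k < K"
    and x1: "x1 = repaired (up_constraint T g L i j k) i i j k x"
    and x2: "x2 = repaired (down_constraint T g L i j k) j k i i x1"
  shows "sweep_inv T g L K y t (insert (i, j, k) X) x2"
proof -
  obtain m where m: "potential K y m x"
    and c: "t < m \<or> (t \<le> m \<or> feasible T g L K x) \<and> (\<forall>(i, j, k)\<in>X. sat_at T g L x i j k)"
    using inv unfolding sweep_inv_def by blast
  have up: "up_constraint T g L i j k \<longrightarrow> dot K (row i i j k) y \<ge> 1"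
    and dn: "down_constraint T g L i j k \<longrightarrow> dot K (row j k i i) y \<ge> 1"
    using y lt unfolding solves_def by blast+
  have nf: "\<not> feasible T g L K x" if "\<not> sat_at T g L x i j k"
    using that lt unfolding feasible_sat_at by auto
  \<comment> \<open>An unsatisfied triple rules out feasibility, so \<open>t \<le> m\<close>, and a
    single correction lifts \<open>m\<close> above \<open>t\<close>. From then on nothing is claimed
    about visited triples, which a correction may have broken again.\<close>
  have progress: "t \<le> m" if "\<not> sat_at T g L x i j k" using c nf[OF that] by auto
  have more: "sweep_inv T g L K y t (insert (i, j, k) X) x2" if "potential K y m' x2" "t < m'" for m'
    using that unfolding sweep_inv_def by blast
  note s1 = repaired_potential[OF m lt(1) lt(1) lt(2) lt(3) up, folded x1]
  show ?thesis
  proof (cases "x1 = x")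
    case False
    with s1 have b: "up_constraint T g L i j k \<and> \<not> x i + x i < x j + x k \<and> potential K y (Suc m) x1" by blast
    then have bad: "\<not> sat_at T g L x i j k" unfolding sat_at_def by blast
    have m1: "potential K y (Suc m) x1" using b by blast
    from repaired_potential[OF m1 lt(2) lt(3) lt(1) lt(1) dn, folded x2]
    have "potential K y (Suc (Suc m)) x2 \<or> x2 = x1" by blast
    then show ?thesis
    proof
      assume "potential K y (Suc (Suc m)) x2"
      then show ?thesis using more[of "Suc (Suc m)"] progress[OF bad] by simp
    next
      assume "x2 = x1"
      then show ?thesis using more[of "Suc m"] m1 progress[OF bad] by simp
    qed
  next
    case same: True
    note s2 = repaired_potential[OF m lt(2) lt(3) lt(1) lt(1) dn, folded x2[unfolded same]]
    show ?thesis
    proof (cases "sat_at T g L x i j k")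
      case True
      then have "x2 = x" using s2 unfolding sat_at_def by blast
      then have "potential K y m x2" "t < m \<or> (t \<le> m \<or> feasible T g L K x2) \<and>
        (\<forall>(i', j', k')\<in>insert (i, j, k) X. sat_at T g L x2 i' j' k')" using m c True by simp_all
      then show ?thesis unfolding sweep_inv_def by blast
    next
      case False
      have up': "up_constraint T g L i j k \<longrightarrow> x i + x i < x j + x k"
      proof (rule ccontr)
        assume "\<not> ?thesis"
        \<comment> \<open>A correction is visible at \<open>j\<close>, where the row has coefficient
          1 because \<open>j < i < k\<close>.\<close>
        then have "x1 j \<noteq> x j"
          unfolding x1 repaired_def by (auto simp: row_def up_constraint_def)
        with same show False by simp
      qed
      with False have "down_constraint T g L i j k \<and> \<not> x j + x k < x i + x i" unfolding sat_at_def by blast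
      with s2 have "potential K y (Suc m) x2" by blast
      then show ?thesis using more progress[OF False] by simp
    qed
  qed
qed

text \<open>After a full sweep, either \<open>m > t\<close>, or every triple is satisfied, which is
  feasibility.\<close>

lemma sweep_inv_next:
  assumes "sweep_inv T g L K y t ({..<K} \<times> {..<K} \<times> {..<K}) x"
  shows "sweep_inv T g L K y (Suc t) {} x"
  using assms unfolding sweep_inv_def feasible_sat_at[symmetric] by (auto simp: Suc_le_eq)

definition constants :: "nat \<Rightarrow> triples \<Rightarrow> nat \<Rightarrow> nat \<Rightarrow> state \<Rightarrow> bool" where
  "constants n T L K s \<longleftrightarrow> (\<forall>u v w. 0 < ints s 1 [int u, int v, int w] \<longleftrightarrow> (u, v, w) \<in> T) \<and>
     ints s 2 [] = int (n + 1) \<and> ints s 3 [] = int L \<and> ints s 4 [] = int K"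

lemma constants_agree:
  "agree X Y s s' \<Longrightarrow> X \<inter> {1, 2, 3, 4} = {} \<Longrightarrow> constants n T L K s \<Longrightarrow> constants n T L K s'"
  using agreeD(1)[of X Y s s' 1] agreeD(1)[of X Y s s' 2] agreeD(1)[of X Y s s' 3] agreeD(1)[of X Y s s' 4]
  by (auto simp: constants_def)

definition table_ok :: "triples \<Rightarrow> (nat \<Rightarrow> nat) \<Rightarrow> nat \<Rightarrow> state \<Rightarrow> bool" where
  "table_ok T g K s \<longleftrightarrow>
    (\<forall>i<K. \<forall>j<K. \<forall>k<K. ints s 15 [int i, int j, int k] = int (box_count T g i j k))"

text \<open>Products exist only over the reals; on integer values the test is still exact.\<close>

abbreviation "few p q c \<equiv> RLess (RMul (ROfInt (IConst 128)) (ROfInt (IGet 15 [IVar p, IVar q, IVar c])))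
  (RMul (RVar 3) (RMul (RVar 3) (RVar 3)))"

abbreviation "up_test \<equiv> BAnd (BAnd (below 10 9) (below 9 11)) (few 9 11 10)"
abbreviation "down_test \<equiv> BOr (BAnd (BAnd (below 10 9) (below 9 11)) (few 9 10 11))
  (BAnd (below 10 9) (BEq (IVar 10) (IVar 11)))"

definition repair_box :: com where
  "repair_box = Seq (repair up_test 9 9 10 11) (repair down_test 10 11 9 9)"

lemma writes_repair_box [simp]: "iwrites repair_box = {16}" "rwrites repair_box = {}"
  by (simp_all add: repair_box_def)

lemma few_iff:
  assumes "ints s 3 [] = int L" "ints s 15 [ints s p [], ints s q [], ints s c []] = int b"
  shows "bval s (few p q c) \<longleftrightarrow> 128 * b < L ^ 3"
proof -
  have "bval s (few p q c) \<longleftrightarrow> real (128 * b) < real (L ^ 3)" using assms by (simp add: power3_eq_cube mult.assoc)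
  then show ?thesis by (simp only: of_nat_less_iff)
qed

lemma runs_repair_box:
  assumes L: "ints s 3 [] = int L" and tab: "table_ok T g K s" and lt: "i < K" "j < K" "k < K"
    and ijk: "ints s 9 [] = int i" "ints s 10 [] = int j" "ints s 11 [] = int k"
  shows "runs repair_box s 200 (\<lambda>s'. vec_of s' = repaired (down_constraint T g L i j k) j k i i
    (repaired (up_constraint T g L i j k) i i j k (vec_of s)))"
  unfolding repair_box_def
proof (rule runs_Seq[where ?B1.0 = 100 and ?B2.0 = 100])
  have t: "ints s 15 [int i, int k, int j] = int (box_count T g i k j)"
    "ints s 15 [int i, int j, int k] = int (box_count T g i j k)"
    using tab lt by (simp_all add: table_ok_def)
  have up: "bval s up_test \<longleftrightarrow> up_constraint T g L i j k"
    using ijk few_iff[OF L, of 9 11 10 "box_count T g i k j"] t(1)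
    by (simp add: up_constraint_def del: bval.simps(2))
  have dn: "bval s down_test \<longleftrightarrow> down_constraint T g L i j k"
    using ijk few_iff[OF L, of 9 10 11 "box_count T g i j k"] t(2)
    by (simp add: down_constraint_def del: bval.simps(2)) auto
  show "runs (repair up_test 9 9 10 11) s 100 (\<lambda>s1. runs (repair down_test 10 11 9 9) s1 100 (\<lambda>s'.
      vec_of s' = repaired (down_constraint T g L i j k) j k i i (repaired (up_constraint T g L i j k) i i j k (vec_of s))))"
  proof (rule runs_mono[OF runs_repair[OF ijk(1) ijk(1) ijk(2) ijk(3) _ _ _ _ up] order_refl])
    fix s1 assume a: "vec_of s1 = (if up_constraint T g L i j k \<and> \<not> vec_of s i + vec_of s i < vec_of s j + vec_of s k
      then \<lambda>t. vec_of s t + row i i j k t else vec_of s) \<and> agree {16} {} s s1"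
    have same: "ints s1 a = ints s a" if "a \<noteq> 16" for a using agreeD(1)[OF conjunct2[OF a], of a] that by simp
    have v: "vec_of s1 = repaired (up_constraint T g L i j k) i i j k (vec_of s)" using a by (simp add: repaired_def)
    \<comment> \<open>The tests do not read array 16, so the first correction leaves the second test
      unchanged.\<close>
    have dn1: "bval s1 down_test \<longleftrightarrow> down_constraint T g L i j k" using dn by (simp add: same)
    show "runs (repair down_test 10 11 9 9) s1 100 (\<lambda>s'. vec_of s' = repaired (down_constraint T g L i j k) j k i i
        (repaired (up_constraint T g L i j k) i i j k (vec_of s)))"
    proof (rule runs_mono[OF runs_repair[where P = j and Q = k and C = i and D = i, OF _ _ _ _ _ _ _ _ dn1] order_refl])
      fix s2 assume "vec_of s2 = (if down_constraint T g L i j k \<and> \<not> vec_of s1 j + vec_of s1 k < vec_of s1 i + vec_of s1 i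
        then \<lambda>t. vec_of s1 t + row j k i i t else vec_of s1) \<and> agree {16} {} s1 s2"
      then have "vec_of s2 = repaired (down_constraint T g L i j k) j k i i (vec_of s1)" by (simp only: repaired_def)
      then show "vec_of s2 = repaired (down_constraint T g L i j k) j k i i
        (repaired (up_constraint T g L i j k) i i j k (vec_of s))" by (simp only: v)
    qed (use ijk in \<open>simp_all add: same\<close>)
  qed simp_all
qed simp

definition sweeps :: com where
  "sweeps = Seq (For 9 (below 9 4) (ISet 16 [IVar 9] (IConst 0)))
    (For 12 (RLess (RVar 12) (RGet 2 []))
      (For 9 (below 9 4) (For 10 (below 10 4) (For 11 (below 11 4) repair_box))))"

lemma writes_sweeps [simp]: "iwrites sweeps = {9, 10, 11, 12, 16}" "rwrites sweeps = {}"
  by (auto simp: sweeps_def)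

text \<open>A bad pivot may give an infeasible system. The number of sweeps is therefore fixed in
  advance: the time bound is unconditional, and only the result depends on solvability.\<close>

lemma runs_sweeps:
  assumes con: "constants n T L K s" and tab: "table_ok T g K s" and K: "K > 0"
    and M: "reals s 2 [] = real M" "(1024 * (K * K)) ^ K \<le> M"
  shows "runs sweeps s (20 + K * 20 + M * (6 + K * (6 + K * (6 + K * 209 + 9) + 9) + 11))
    (\<lambda>s'. ((\<exists>z :: nat \<Rightarrow> real. feasible T g L K z) \<longrightarrow> feasible T g L K (vec_of s')) \<and>
      agree {9, 10, 11, 12, 16} {} s s')"
proof -
  let ?good = "\<lambda>y. solves T g L K y \<and> (\<forall>t<K. \<bar>y t\<bar> \<le> (4 * real K) ^ K)"
  let ?ex = "\<exists>z :: nat \<Rightarrow> real. feasible T g L K z"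
  obtain y where y: "?ex \<Longrightarrow> ?good y" using bounded_feasible by metis
  let ?B = "6 + K * (6 + K * (6 + K * 209 + 9) + 9)"
  have K4: "ints s 4 [] = int K" and L3: "ints s 3 [] = int L" using con by (auto simp: constants_def)
  have "runs sweeps s (20 + K * 20 + M * (?B + 11))
    (\<lambda>s'. ?ex \<longrightarrow> feasible T g L K (vec_of s'))"
    unfolding sweeps_def
  proof (rule runs_Seq[where ?B1.0 = "6 + K * 20" and ?B2.0 = "14 + M * (?B + 11)"])
    show "runs (For 9 (below 9 4) (ISet 16 [IVar 9] (IConst 0))) s (6 + K * 20)
      (\<lambda>s1. runs (For 12 (RLess (RVar 12) (RGet 2 [])) (For 9 (below 9 4) (For 10 (below 10 4) (For 11 (below 11 4) repair_box))))
         s1 (14 + M * (?B + 11)) (\<lambda>s'. ?ex \<longrightarrow> feasible T g L K (vec_of s')))"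
    proof (rule runs_mono[OF runs_For_below[where N = K and B = 11 and I = "\<lambda>i s'. \<forall>t<i. vec_of s' t = 0"] order_refl])
      fix i s' assume "\<forall>t<i. vec_of s' t = 0" "ints s' 9 [] = int i"
      then show "runs (ISet 16 [IVar 9] (IConst 0)) s' 11 (\<lambda>s'. \<forall>t<Suc i. vec_of s' t = 0)"
        by (intro runs_ISet) (auto simp: vec_of_def)
    next
      fix s1 assume "(\<forall>t<K. vec_of s1 t = 0) \<and> agree (insert 9 (iwrites (ISet 16 [IVar 9] (IConst 0))))
        (rwrites (ISet 16 [IVar 9] (IConst 0))) s s1"
      then have v0: "\<forall>t<K. vec_of s1 t = 0" and a1: "agree {9, 16} {} s s1" by auto
      let ?inner = "For 9 (below 9 4) (For 10 (below 10 4) (For 11 (below 11 4) repair_box))"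
      show "runs (For 12 (RLess (RVar 12) (RGet 2 [])) ?inner) s1 (14 + M * (?B + 11))
        (\<lambda>s'. ?ex \<longrightarrow> feasible T g L K (vec_of s'))"
      proof (rule runs_mono[OF runs_For[where N = M and B = ?B and g = 5 and I = "\<lambda>t s'. ?ex \<longrightarrow> sweep_inv T g L K y t {} (vec_of s')"] order_refl])
        have "potential K y 0 (vec_of s1)" using v0 by (intro potential_0) blast
        then show "?ex \<longrightarrow> sweep_inv T g L K y 0 {} (vec_of s1)" unfolding sweep_inv_def by blast
      next
        fix t s' assume "agree (insert 12 (iwrites ?inner)) (rwrites ?inner) s1 s'" "ints s' 12 [] = int t"
        moreover have "reals s' 2 [] = real M"
          using agreeD(2)[OF calculation(1), of 2] agreeD(2)[OF a1, of 2] M by simp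
        ultimately show "bval s' (RLess (RVar 12) (RGet 2 [])) \<longleftrightarrow> t < M" by simp
      next
        fix t s' assume a2: "agree (insert 12 (iwrites ?inner)) (rwrites ?inner) s1 s'"
          and I: "?ex \<longrightarrow> sweep_inv T g L K y t {} (vec_of s')"
        have a: "agree {9, 10, 11, 12, 16} {} s s'" by (rule agree_trans[OF a1 a2]) auto
        show "runs ?inner s' ?B (\<lambda>s'. ?ex \<longrightarrow> sweep_inv T g L K y (Suc t) {} (vec_of s'))"
        proof (rule runs_mono[OF runs_For3[where N = K and B = 200 and I = "\<lambda>X s'. ?ex \<longrightarrow> sweep_inv T g L K y t X (vec_of s')"] order_refl])
          show "ints s' 4 [] = int K" using agreeD(1)[OF a, of 4] K4 by simp
        next
          fix X i j k s2
          assume lt: "i < K" "j < K" "k < K" and a3: "agree ({9, 10, 11} \<union> iwrites repair_box) (rwrites repair_box) s' s2"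
            and ijk: "ints s2 9 [] = int i" "ints s2 10 [] = int j" "ints s2 11 [] = int k"
            and I2: "?ex \<longrightarrow> sweep_inv T g L K y t X (vec_of s2)"
          have a4: "agree {9, 10, 11, 12, 16} {} s s2" by (rule agree_trans[OF a a3]) auto
          have "ints s2 3 [] = int L" using agreeD(1)[OF a4, of 3] L3 by simp
          moreover have "table_ok T g K s2" using agreeD(1)[OF a4, of 15] tab by (simp add: table_ok_def)
          ultimately show "runs repair_box s2 200 (\<lambda>s'. ?ex \<longrightarrow> sweep_inv T g L K y t (insert (i, j, k) X) (vec_of s'))"
            by (rule runs_mono[OF runs_repair_box[OF _ _ lt ijk] order_refl])
              (use I2 y lt in \<open>auto intro!: sweep_inv_step[OF _ _ lt refl]\<close>)
        next
          fix s3 assume "(?ex \<longrightarrow> sweep_inv T g L K y t ({..<K} \<times> {..<K} \<times> {..<K}) (vec_of s3)) \<and>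
            agree ({9, 10, 11} \<union> iwrites repair_box) (rwrites repair_box) s' s3"
          then show "?ex \<longrightarrow> sweep_inv T g L K y (Suc t) {} (vec_of s3)" using sweep_inv_next by blast
        qed (use I in simp_all)
      next
        fix s' assume fin: "(?ex \<longrightarrow> sweep_inv T g L K y M {} (vec_of s')) \<and> agree (insert 12 (iwrites ?inner)) (rwrites ?inner) s1 s'"
        show "?ex \<longrightarrow> feasible T g L K (vec_of s')"
        proof
          assume ex: ?ex
          then obtain m where m: "potential K y m (vec_of s')" "M \<le> m \<or> feasible T g L K (vec_of s')"
            using fin unfolding sweep_inv_def by (auto dest: less_imp_le)
          \<comment> \<open>An infeasible result would mean \<open>M \<le> m\<close>, more
            corrections than the mistake bound allows.\<close>
          have "m < (1024 * (K * K)) ^ K" by (rule mistake_bound[OF m(1) _ K]) (use y[OF ex] in blast)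
          then show "feasible T g L K (vec_of s')" using m(2) M(2) by auto
        qed
      qed simp_all
    qed (use K4 in simp_all)
  qed simp
  from runs_agree[OF this] show ?thesis by (simp only: writes_sweeps)
qed

section \<open>Counting loops: buckets, box counts and evaluation\<close>

abbreviation "recount x y acc b \<equiv> Seq (ISet acc [] (IConst 0)) (For x (below x y) (tally acc b))"
abbreviation "recount3 x1 x2 x3 y acc b \<equiv> Seq (ISet acc [] (IConst 0))
  (For x1 (below x1 y) (For x2 (below x2 y) (For x3 (below x3 y) (tally acc b))))"

lemma runs_fresh_count:
  assumes x: "distinct [x, y, acc]" and N: "ints s y [] = int N"
    and b: "\<And>i s'. i < N \<Longrightarrow> agree {x, acc} {} s s' \<Longrightarrow> ints s' x [] = int i \<Longrightarrow> bval s' b \<longleftrightarrow> P i"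
    and g: "bcost b \<le> g" and fin: "8 + N * (g + 14) \<le> B"
  shows "runs (recount x y acc b) s B (\<lambda>s'. ints s' acc [] = int (card {i. i < N \<and> P i}) \<and> agree {x, acc} {} s s')"
proof -
  let ?s = "iset acc (map (ival s) []) (ival s (IConst 0)) s"
  have a: "agree {x, acc} {} s ?s" by (simp add: agree_def)
  have "runs (recount x y acc b) s B (\<lambda>s'. ints s' acc [] = int (card {i. i < N \<and> P i}))"
  proof (rule runs_Seq[where ?B1.0 = 2], rule runs_ISet)
    show "runs (For x (below x y) (tally acc b)) ?s (6 + N * (g + 14)) (\<lambda>s'. ints s' acc [] = int (card {i. i < N \<and> P i}))"
    proof (rule runs_mono[OF runs_For_below[where N = N and B = "g + 5" and
          I = "\<lambda>j s'. ints s' acc [] = int (card {i. i < j \<and> P i})"] order_refl])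
      fix i s' assume i: "i < N" "agree (insert x (iwrites (tally acc b))) (rwrites (tally acc b)) ?s s'"
        "ints s' x [] = int i" "ints s' acc [] = int (card {j. j < i \<and> P j})"
      have eq: "{j. j < Suc i \<and> P j} = (if P i then insert i {j. j < i \<and> P j} else {j. j < i \<and> P j})"
        by (auto simp: less_Suc_eq)
      have "card {j. j < Suc i \<and> P j} = card {j. j < i \<and> P j} + of_bool (P i)"
        unfolding eq by simp
      moreover have "agree {x, acc} {} s s'" by (rule agree_trans[OF a i(2)]) auto
      ultimately show "runs (tally acc b) s' (g + 5) (\<lambda>s'. ints s' acc [] = int (card {j. j < Suc i \<and> P j}))"
        using runs_tally[OF b[OF i(1) _ i(3)] g i(4), of "g + 5"] by simp
    qed (use x N in \<open>auto simp: ac_simps\<close>)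
  qed (use fin in simp_all)
  from runs_agree[OF this] show ?thesis by (rule runs_mono) (auto elim: agree_mono)
qed

lemma runs_fresh_count3:
  assumes x: "distinct [x1, x2, x3, y, acc]" and N: "ints s y [] = int N"
    and b: "\<And>i j k s'. i < N \<Longrightarrow> j < N \<Longrightarrow> k < N \<Longrightarrow> agree {x1, x2, x3, acc} {} s s' \<Longrightarrow>
      ints s' x1 [] = int i \<Longrightarrow> ints s' x2 [] = int j \<Longrightarrow> ints s' x3 [] = int k \<Longrightarrow> bval s' b \<longleftrightarrow> P i j k"
    and g: "bcost b \<le> g" and fin: "8 + N * (6 + N * (6 + N * (g + 14) + 9) + 9) \<le> B"
  shows "runs (recount3 x1 x2 x3 y acc b) s B
    (\<lambda>s'. ints s' acc [] = int (card {(i, j, k). i < N \<and> j < N \<and> k < N \<and> P i j k}) \<and> agree {x1, x2, x3, acc} {} s s')"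
proof -
  let ?s = "iset acc (map (ival s) []) (ival s (IConst 0)) s"
  let ?c = "\<lambda>X. card {p \<in> X. case p of (i, j, k) \<Rightarrow> P i j k}"
  have a: "agree {x1, x2, x3, acc} {} s ?s" by (simp add: agree_def)
  have "runs (recount3 x1 x2 x3 y acc b) s B (\<lambda>s'. ints s' acc [] = int (?c ({..<N} \<times> {..<N} \<times> {..<N})))"
  proof (rule runs_Seq[where ?B1.0 = 2], rule runs_ISet)
    show "runs (For x1 (below x1 y) (For x2 (below x2 y) (For x3 (below x3 y) (tally acc b)))) ?s
      (6 + N * (6 + N * (6 + N * (g + 14) + 9) + 9)) (\<lambda>s'. ints s' acc [] = int (?c ({..<N} \<times> {..<N} \<times> {..<N})))"
    proof (rule runs_mono[OF runs_For3[where N = N and B = "g + 5" and I = "\<lambda>X s'. ints s' acc [] = int (?c X)"] order_refl])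
      fix X i j k s'
      assume i: "i < N" "j < N" "k < N" "(i, j, k) \<notin> X" "finite X"
        "agree ({x1, x2, x3} \<union> iwrites (tally acc b)) (rwrites (tally acc b)) ?s s'"
        "ints s' x1 [] = int i" "ints s' x2 [] = int j" "ints s' x3 [] = int k" "ints s' acc [] = int (?c X)"
      have eq: "{p \<in> insert (i, j, k) X. case p of (i, j, k) \<Rightarrow> P i j k} =
        (if P i j k then insert (i, j, k) {p \<in> X. case p of (i, j, k) \<Rightarrow> P i j k}
         else {p \<in> X. case p of (i, j, k) \<Rightarrow> P i j k})"
        by auto
      have "?c (insert (i, j, k) X) = ?c X + of_bool (P i j k)"
        unfolding eq using i(4,5) by simp
      moreover have "agree {x1, x2, x3, acc} {} s s'" by (rule agree_trans[OF a i(6)]) auto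
      ultimately show "runs (tally acc b) s' (g + 5) (\<lambda>s'. ints s' acc [] = int (?c (insert (i, j, k) X)))"
        using runs_tally[OF b[OF i(1-3) _ i(7-9)] g i(10), of "g + 5"] by simp
    qed (use x N in \<open>auto simp: ac_simps\<close>)
  qed (use fin in simp_all)
  moreover have "{p \<in> {..<N} \<times> {..<N} \<times> {..<N}. case p of (i, j, k) \<Rightarrow> P i j k} =
      {(i, j, k). i < N \<and> j < N \<and> k < N \<and> P i j k}" by auto
  ultimately have "runs (recount3 x1 x2 x3 y acc b) s B
    (\<lambda>s'. ints s' acc [] = int (card {(i, j, k). i < N \<and> j < N \<and> k < N \<and> P i j k}))" by simp
  from runs_agree[OF this] show ?thesis by (rule runs_mono) (auto elim: agree_mono)
qed

abbreviation "is_constraint p q c \<equiv> ILess (IConst 0) (IGet 1 [IVar p, IVar q, IVar c])"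

lemma is_constraint_iff:
  "constants n T L K s \<Longrightarrow> ints s p [] = int u \<Longrightarrow> ints s q [] = int v \<Longrightarrow> ints s c [] = int w \<Longrightarrow>
   bval s (is_constraint p q c) \<longleftrightarrow> (u, v, w) \<in> T"
  by (simp add: constants_def)

abbreviation "score_test \<equiv> BOr (BAnd (BEq (IVar 7) (IVar 5)) (BNot (BEq (IVar 6) (IVar 5)))) (is_constraint 5 7 6)"
abbreviation "bucket_test \<equiv> BAnd (ILess (IConst 0) (IVar 10)) (BNot (RLess (RVar 18) (RMul (RVar 10) (RVar 3))))"

definition assign :: com where
  "assign = For 6 (below 6 2) (Seq (recount 7 2 18 score_test) (Seq (recount 10 4 13 bucket_test) (ISet 14 [IVar 6] (IVar 13))))"

lemma writes_assign [simp]: "iwrites assign = {6, 7, 10, 13, 14, 18}" "rwrites assign = {}"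
  by (auto simp: assign_def)

definition pivot_buckets :: "nat \<Rightarrow> triples \<Rightarrow> nat \<Rightarrow> nat \<Rightarrow> nat \<Rightarrow> nat \<Rightarrow> nat" where
  "pivot_buckets n T L K a = bucket L K \<circ> score T n a"

definition buckets_ok :: "nat \<Rightarrow> (nat \<Rightarrow> nat) \<Rightarrow> state \<Rightarrow> bool" where
  "buckets_ok N g s \<longleftrightarrow> (\<forall>u<N. ints s 14 [int u] = int (g u))"

lemma real_product_le_iff: "real z < real j * real L \<longleftrightarrow> \<not> j * L \<le> z"
  by (simp flip: of_nat_mult add: not_le)

lemma runs_assign:
  assumes con: "constants n T L K s" and a: "ints s 5 [] = int a"
  shows "runs assign s (6 + (n + 1) * (50 + (n + 1) * 60 + K * 40))
    (\<lambda>s'. buckets_ok (n + 1) (pivot_buckets n T L K a) s' \<and> agree {6, 7, 10, 13, 14, 18} {} s s')"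
proof -
  let ?g = "pivot_buckets n T L K a"
  let ?c = "Seq (recount 7 2 18 score_test) (Seq (recount 10 4 13 bucket_test) (ISet 14 [IVar 6] (IVar 13)))"
  have "runs assign s (6 + (n + 1) * (50 + (n + 1) * 60 + K * 40))
    (\<lambda>s'. buckets_ok (n + 1) ?g s' \<and> agree (insert 6 (iwrites ?c)) (rwrites ?c) s s')"
    unfolding assign_def
  proof (rule runs_For_below[where N = "n + 1" and B = "30 + (n + 1) * 60 + K * 40" and I = "\<lambda>i. buckets_ok i ?g"])
    fix i s1 assume i: "i < n + 1" and a1: "agree (insert 6 (iwrites ?c)) (rwrites ?c) s s1"
      and v: "ints s1 6 [] = int i" and I: "buckets_ok i ?g s1"
    have con1: "constants n T L K s1" by (rule constants_agree[OF a1 _ con]) auto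
    have a1': "ints s1 5 [] = int a" using agreeD(1)[OF a1, of 5] a by simp
    show "runs ?c s1 (30 + (n + 1) * 60 + K * 40) (buckets_ok (Suc i) ?g)"
    proof (rule runs_Seq[where ?B1.0 = "8 + (n + 1) * 60" and ?B2.0 = "22 + K * 40"],
        rule runs_mono[OF runs_fresh_count[where N = "n + 1" and g = 46 and
          P = "\<lambda>v. v = a \<and> i \<noteq> a \<or> (a, v, i) \<in> T"] order_refl])
      show "ints s1 2 [] = int (n + 1)" using con1 by (simp add: constants_def)
    next
      fix v s2 assume 2: "agree {7, 18} {} s1 s2" "ints s2 7 [] = int v"
      have "constants n T L K s2" by (rule constants_agree[OF 2(1) _ con1]) auto
      moreover have "ints s2 5 [] = int a" "ints s2 6 [] = int i"
        using agreeD(1)[OF 2(1), of 5] agreeD(1)[OF 2(1), of 6] a1' v by auto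
      ultimately show "bval s2 score_test \<longleftrightarrow> v = a \<and> i \<noteq> a \<or> (a, v, i) \<in> T"
        using is_constraint_iff[of n T L K s2 5 a 7 v 6 i] 2(2) by simp linarith
    next
      fix s2 assume s2: "ints s2 18 [] = int (card {v. v < n + 1 \<and> (v = a \<and> i \<noteq> a \<or> (a, v, i) \<in> T)}) \<and> agree {7, 18} {} s1 s2"
      then have sc: "ints s2 18 [] = int (score T n a i)" by (simp only: score_def)
      have a2: "agree {7, 18} {} s1 s2" using s2 by blast
      have con2: "constants n T L K s2" by (rule constants_agree[OF a2 _ con1]) auto
      show "runs (Seq (recount 10 4 13 bucket_test) (ISet 14 [IVar 6] (IVar 13))) s2 (22 + K * 40) (buckets_ok (Suc i) ?g)"
      proof (rule runs_Seq[where ?B1.0 = "8 + K * 40" and ?B2.0 = 10],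
          rule runs_mono[OF runs_fresh_count[where N = K and g = 26 and P = "\<lambda>j. 0 < j \<and> j * L \<le> score T n a i"] order_refl])
        show "ints s2 4 [] = int K" using con2 by (simp add: constants_def)
      next
        fix j s3 assume 3: "agree {10, 13} {} s2 s3" "ints s3 10 [] = int j"
        have "constants n T L K s3" by (rule constants_agree[OF 3(1) _ con2]) auto
        then have "ints s3 3 [] = int L" by (simp add: constants_def)
        moreover have "ints s3 18 [] = int (score T n a i)" using agreeD(1)[OF 3(1), of 18] sc by simp
        ultimately show "bval s3 bucket_test \<longleftrightarrow> 0 < j \<and> j * L \<le> score T n a i"
          using 3(2) by (simp add: real_product_le_iff)
      next
        fix s3 assume s3: "ints s3 13 [] = int (card {j. j < K \<and> 0 < j \<and> j * L \<le> score T n a i}) \<and> agree {10, 13} {} s2 s3"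
        have "{j. j < K \<and> 0 < j \<and> j * L \<le> score T n a i} = {j. 0 < j \<and> j < K \<and> j * L \<le> score T n a i}" by auto
        with s3 have "ints s3 13 [] = int (?g i)" by (simp add: pivot_buckets_def bucket_def)
        moreover have a3: "agree {10, 13} {} s2 s3" using s3 by blast
        have "ints s3 6 [] = int i" using agreeD(1)[OF a2, of 6] agreeD(1)[OF a3, of 6] v by simp
        moreover have "buckets_ok i ?g s3"
          using I agreeD(1)[OF a2, of 14] agreeD(1)[OF a3, of 14] by (simp add: buckets_ok_def)
        ultimately show "runs (ISet 14 [IVar 6] (IVar 13)) s3 10 (buckets_ok (Suc i) ?g)"
          by (intro runs_ISet) (auto simp: buckets_ok_def less_Suc_eq)
      qed simp_all
    qed simp_all
  next
    show "ints s 2 [] = int (n + 1)" using con by (simp add: constants_def)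
    show "6 + (n + 1) * (30 + (n + 1) * 60 + K * 40 + 9) \<le> 6 + (n + 1) * (50 + (n + 1) * 60 + K * 40)"
      by (intro add_left_mono mult_le_mono2) simp
  qed (auto simp: buckets_ok_def)
  then show ?thesis by (rule runs_mono) (auto elim!: agree_mono)
qed

abbreviation "box_test \<equiv> BAnd (is_constraint 6 7 8) (BAnd (BEq (IGet 14 [IVar 6]) (IVar 9))
  (BAnd (BEq (IGet 14 [IVar 7]) (IVar 10)) (BEq (IGet 14 [IVar 8]) (IVar 11))))"

abbreviation "count_box \<equiv> Seq (recount3 6 7 8 2 13 box_test) (ISet 15 [IVar 9, IVar 10, IVar 11] (IVar 13))"

definition count_boxes :: com where
  "count_boxes = For 9 (below 9 4) (For 10 (below 10 4) (For 11 (below 11 4) count_box))"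

lemma card_triples:
  fixes n :: nat
  assumes "T \<subseteq> {1..n} \<times> {1..n} \<times> {1..n}"
  shows "card {(u, v, w). u < n + 1 \<and> v < n + 1 \<and> w < n + 1 \<and> ((u, v, w) \<in> T \<and> Q u v w)} =
    card {(u, v, w) \<in> T. Q u v w}"
proof -
  have "u < n + 1 \<and> v < n + 1 \<and> w < n + 1" if "(u, v, w) \<in> T" for u v w
  proof -
    have "(u, v, w) \<in> {1..n} \<times> {1..n} \<times> {1..n}" using assms that by (rule subsetD)
    then show ?thesis by auto
  qed
  then have "{(u, v, w). u < n + 1 \<and> v < n + 1 \<and> w < n + 1 \<and> ((u, v, w) \<in> T \<and> Q u v w)} =
    {(u, v, w) \<in> T. Q u v w}" by blast
  then show ?thesis by (rule arg_cong)
qed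

definition triple_loop_cost :: "nat \<Rightarrow> nat \<Rightarrow> nat" where
  "triple_loop_cost N b = 8 + N * (6 + N * (6 + N * (b + 14) + 9) + 9)"

text \<open>A constant cost outside the loops is charged to the innermost body, so that storing the
  count keeps the bound in the same form.\<close>

lemma triple_loop_cost_add:
  assumes "N > 0"
  shows "d + triple_loop_cost N b \<le> triple_loop_cost N (b + d)"
proof -
  have *: "d + N * x \<le> N * y" if "d + x \<le> y" for x y
  proof -
    have "1 * d \<le> N * d" using assms by (intro mult_le_mono1) simp
    then have "d + N * x \<le> N * (d + x)" by (simp add: add_mult_distrib2)
    also have "\<dots> \<le> N * y" using that by (rule mult_le_mono2)
    finally show ?thesis .
  qed
  have "d + N * (b + 14) \<le> N * (b + d + 14)" by (rule *) simp
  then have "d + N * (6 + N * (b + 14) + 9) \<le> N * (6 + N * (b + d + 14) + 9)" by (intro *) simp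
  then have "d + N * (6 + N * (6 + N * (b + 14) + 9) + 9) \<le> N * (6 + N * (6 + N * (b + d + 14) + 9) + 9)"
    by (intro *) simp
  then show ?thesis by (simp add: triple_loop_cost_def)
qed

lemma runs_count_boxes:
  assumes con: "constants n T L K s" and g: "buckets_ok (n + 1) g s"
    and T: "T \<subseteq> {1..n} \<times> {1..n} \<times> {1..n}"
  shows "runs count_boxes s (triple_loop_cost K (triple_loop_cost (n + 1) 60))
    (\<lambda>s'. table_ok T g K s' \<and> agree {6, 7, 8, 9, 10, 11, 13, 15} {} s s')"
proof -
  let ?B = "triple_loop_cost (n + 1) 50"
  let ?I = "\<lambda>X s'. \<forall>(i, j, k)\<in>X. ints s' 15 [int i, int j, int k] = int (box_count T g i j k)"
  have "runs count_boxes s (triple_loop_cost K (triple_loop_cost (n + 1) 60))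
    (\<lambda>s'. ?I ({..<K} \<times> {..<K} \<times> {..<K}) s' \<and> agree ({9, 10, 11} \<union> iwrites count_box) (rwrites count_box) s s')"
    unfolding count_boxes_def
  proof (rule runs_For3[where N = K and B = "10 + ?B" and I = ?I])
    fix X i j k s1
    assume a1: "agree ({9, 10, 11} \<union> iwrites count_box) (rwrites count_box) s s1"
      and ijk: "ints s1 9 [] = int i" "ints s1 10 [] = int j" "ints s1 11 [] = int k"
      and I: "?I X s1"
    have con1: "constants n T L K s1" by (rule constants_agree[OF a1 _ con]) auto
    have g1: "buckets_ok (n + 1) g s1" using g agreeD(1)[OF a1, of 14] by (simp add: buckets_ok_def)
    show "runs count_box s1 (10 + ?B) (?I (insert (i, j, k) X))"
    proof (rule runs_Seq[where ?B1.0 = ?B and ?B2.0 = 10],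
        rule runs_mono[OF runs_fresh_count3[where N = "n + 1" and g = 50 and
          P = "\<lambda>u v w. (u, v, w) \<in> T \<and> (g u = i \<and> g v = j \<and> g w = k)"] order_refl])
      show "ints s1 2 [] = int (n + 1)" using con1 by (simp add: constants_def)
    next
      fix u v w s2 assume u: "u < n + 1" "v < n + 1" "w < n + 1" and a2: "agree {6, 7, 8, 13} {} s1 s2"
        and uvw: "ints s2 6 [] = int u" "ints s2 7 [] = int v" "ints s2 8 [] = int w"
      have "constants n T L K s2" by (rule constants_agree[OF a2 _ con1]) auto
      note t = is_constraint_iff[OF this uvw]
      have "ints s2 9 [] = int i" "ints s2 10 [] = int j" "ints s2 11 [] = int k"
        using agreeD(1)[OF a2, of 9] agreeD(1)[OF a2, of 10] agreeD(1)[OF a2, of 11] ijk by auto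
      moreover have "ints s2 14 [int u] = int (g u)" "ints s2 14 [int v] = int (g v)" "ints s2 14 [int w] = int (g w)"
        using g1 u agreeD(1)[OF a2, of 14] by (simp_all add: buckets_ok_def)
      ultimately show "bval s2 box_test \<longleftrightarrow> (u, v, w) \<in> T \<and> (g u = i \<and> g v = j \<and> g w = k)"
        using t uvw by simp linarith
    next
      fix s2 assume s2: "ints s2 13 [] = int (card {(u, v, w). u < n + 1 \<and> v < n + 1 \<and> w < n + 1 \<and>
        ((u, v, w) \<in> T \<and> (g u = i \<and> g v = j \<and> g w = k))}) \<and> agree {6, 7, 8, 13} {} s1 s2"
      then have c: "ints s2 13 [] = int (box_count T g i j k)" unfolding box_count_def card_triples[OF T] by blast
      have a2: "agree {6, 7, 8, 13} {} s1 s2" using s2 by blast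
      have "ints s2 9 [] = int i" "ints s2 10 [] = int j" "ints s2 11 [] = int k"
        using agreeD(1)[OF a2, of 9] agreeD(1)[OF a2, of 10] agreeD(1)[OF a2, of 11] ijk by auto
      moreover have "?I X s2" using I agreeD(1)[OF a2, of 15] by simp
      ultimately show "runs (ISet 15 [IVar 9, IVar 10, IVar 11] (IVar 13)) s2 10 (?I (insert (i, j, k) X))"
        using c by (intro runs_ISet) (auto simp: split_beta)
    next
      show "distinct [6, 7, 8, 2, 13::nat]" by simp
      show "bcost box_test \<le> 50" by simp
      show "8 + (n + 1) * (6 + (n + 1) * (6 + (n + 1) * (50 + 14) + 9) + 9) \<le> ?B"
        by (simp only: triple_loop_cost_def)
    qed simp
  next
    show "ints s 4 [] = int K" using con by (simp add: constants_def)
    show "6 + K * (6 + K * (6 + K * (10 + ?B + 9) + 9) + 9) \<le> triple_loop_cost K (triple_loop_cost (n + 1) 60)"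
    proof -
      have "10 + ?B \<le> triple_loop_cost (n + 1) 60" using triple_loop_cost_add[of "n + 1" 10 50] by simp
      then show ?thesis unfolding triple_loop_cost_def[of K] by (intro add_mono mult_le_mono order_refl) simp_all
    qed
  qed auto
  then show ?thesis by (rule runs_mono) (auto simp: table_ok_def elim!: agree_mono)
qed

abbreviation "value_of p \<equiv> ROfInt (IGet 16 [IGet 14 [IVar p]])"
abbreviation "gap p q \<equiv> RSub (value_of p) (value_of q)"
text \<open>Expressions offer no absolute value, so squares of the gaps are compared.\<close>

abbreviation "sat_test \<equiv> BAnd (is_constraint 6 7 8) (RLess (RMul (gap 6 7) (gap 6 7)) (RMul (gap 6 8) (gap 6 8)))"

definition evaluate :: com where "evaluate = recount3 6 7 8 2 13 sat_test"

definition real_vec :: "state \<Rightarrow> nat \<Rightarrow> real" where "real_vec s i = of_int (vec_of s i)"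

lemma feasible_real_vec: "feasible T g L K (vec_of s) \<Longrightarrow> feasible T g L K (real_vec s)"
  unfolding feasible_def real_vec_def of_int_add[symmetric] of_int_less_iff by blast

lemma square_less_iff_abs: "(x :: real) * x < y * y \<longleftrightarrow> \<bar>x\<bar> < \<bar>y\<bar>"
  by (metis abs_le_square_iff linorder_not_le power2_eq_square)

lemma runs_evaluate:
  assumes con: "constants n T L K s" and g: "buckets_ok (n + 1) g s"
    and T: "T \<subseteq> {1..n} \<times> {1..n} \<times> {1..n}"
  shows "runs evaluate s (triple_loop_cost (n + 1) 60)
    (\<lambda>s'. ints s' 13 [] = int (card (satisfied_by T g (real_vec s))) \<and> agree {6, 7, 8, 13} {} s s')"
  unfolding evaluate_def
proof (rule runs_mono[OF runs_fresh_count3[where N = "n + 1" and g = 60 and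
      P = "\<lambda>u v w. (u, v, w) \<in> T \<and> \<bar>real_vec s (g u) - real_vec s (g v)\<bar> < \<bar>real_vec s (g u) - real_vec s (g w)\<bar>"] order_refl])
  show "ints s 2 [] = int (n + 1)" using con by (simp add: constants_def)
next
  fix u v w s2 assume u: "u < n + 1" "v < n + 1" "w < n + 1" and a2: "agree {6, 7, 8, 13} {} s s2"
    and uvw: "ints s2 6 [] = int u" "ints s2 7 [] = int v" "ints s2 8 [] = int w"
  have "constants n T L K s2" by (rule constants_agree[OF a2 _ con]) auto
  note t = is_constraint_iff[OF this uvw]
  have "ints s2 14 [int u] = int (g u)" "ints s2 14 [int v] = int (g v)" "ints s2 14 [int w] = int (g w)"
    using g u agreeD(1)[OF a2, of 14] by (simp_all add: buckets_ok_def)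
  then have "rval s2 (value_of 6) = real_vec s (g u)" "rval s2 (value_of 7) = real_vec s (g v)"
    "rval s2 (value_of 8) = real_vec s (g w)"
    using uvw agreeD(1)[OF a2, of 16] by (simp_all add: real_vec_def vec_of_def)
  then show "bval s2 sat_test \<longleftrightarrow> (u, v, w) \<in> T \<and>
      \<bar>real_vec s (g u) - real_vec s (g v)\<bar> < \<bar>real_vec s (g u) - real_vec s (g w)\<bar>"
    unfolding bval.simps(4) t unfolding bval.simps(2) rval.simps(4,5) square_less_iff_abs by simp
next
  show "8 + (n + 1) * (6 + (n + 1) * (6 + (n + 1) * (60 + 14) + 9) + 9) \<le> triple_loop_cost (n + 1) 60"
    by (simp only: triple_loop_cost_def)
  show "bcost sat_test \<le> 60" by simp
next
  fix s' assume "ints s' 13 [] = int (card {(u, v, w). u < n + 1 \<and> v < n + 1 \<and> w < n + 1 \<and> ((u, v, w) \<in> T \<and>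
      \<bar>real_vec s (g u) - real_vec s (g v)\<bar> < \<bar>real_vec s (g u) - real_vec s (g w)\<bar>)}) \<and> agree {6, 7, 8, 13} {} s s'"
  then show "ints s' 13 [] = int (card (satisfied_by T g (real_vec s))) \<and> agree {6, 7, 8, 13} {} s s'"
    unfolding satisfied_by_def card_triples[OF T] .
qed simp

definition keep :: com where
  "keep = If (below 17 13) (Seq (ISet 17 [] (IVar 13)) (For 6 (below 6 2) (RSet 1 [IVar 6] (value_of 6)))) Skip"

text \<open>The initial value \<open>-1\<close> is below every count, so the first pivot is always
  recorded.\<close>

definition record_ok :: "triples \<Rightarrow> state \<Rightarrow> bool" where
  "record_ok T s \<longleftrightarrow> ints s 17 [] = - 1 \<or> ints s 17 [] = int (card (lloc_satisfied (lloc_output s) T))"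

lemma satisfied_output:
  assumes T: "T \<subseteq> {1..n} \<times> {1..n} \<times> {1..n}" and out: "\<And>u. u < n + 1 \<Longrightarrow> lloc_output s u = x (g u)"
  shows "lloc_satisfied (lloc_output s) T = satisfied_by T g x"
proof -
  have "lloc_output s u = x (g u) \<and> lloc_output s v = x (g v) \<and> lloc_output s w = x (g w)" if "(u, v, w) \<in> T" for u v w
  proof -
    have "(u, v, w) \<in> {1..n} \<times> {1..n} \<times> {1..n}" using T that by (rule subsetD)
    then show ?thesis using out by auto
  qed
  then show ?thesis unfolding lloc_satisfied_def satisfied_by_def by auto
qed

lemma runs_keep:
  assumes con: "constants n T L K s" and g: "buckets_ok (n + 1) g s" and T: "T \<subseteq> {1..n} \<times> {1..n} \<times> {1..n}"
    and m: "ints s 13 [] = int (card (satisfied_by T g (real_vec s)))" and rec: "record_ok T s"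
  shows "runs keep s (20 + (n + 1) * 20)
    (\<lambda>s'. record_ok T s' \<and> ints s 17 [] \<le> ints s' 17 [] \<and> int (card (satisfied_by T g (real_vec s))) \<le> ints s' 17 [])"
    (is "runs _ _ _ ?Q")
  unfolding keep_def
proof (rule runs_If[where B' = "10 + (n + 1) * 20"])
  assume better: "bval s (below 17 13)"
  let ?c = "RSet 1 [IVar 6] (value_of 6)"
  show "runs (Seq (ISet 17 [] (IVar 13)) (For 6 (below 6 2) ?c)) s (10 + (n + 1) * 20) ?Q"
  proof (rule runs_Seq[where ?B1.0 = 4 and ?B2.0 = "6 + (n + 1) * 20"], rule runs_ISet)
    let ?s = "iset 17 (map (ival s) []) (ival s (IVar 13)) s"
    show "runs (For 6 (below 6 2) ?c) ?s (6 + (n + 1) * 20) ?Q"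
    proof (rule runs_mono[OF runs_For_below[where N = "n + 1" and B = 11 and
          I = "\<lambda>i s'. \<forall>u<i. lloc_output s' u = real_vec s (g u)"] order_refl])
      show "ints ?s 2 [] = int (n + 1)" using con by (simp add: constants_def)
    next
      fix i s1 assume i: "i < n + 1" "ints s1 6 [] = int i" "agree (insert 6 (iwrites ?c)) (rwrites ?c) ?s s1"
        and I: "\<forall>u<i. lloc_output s1 u = real_vec s (g u)"
      have "ints s1 14 [int i] = int (g i)" using g i(1) agreeD(1)[OF i(3), of 14] by (simp add: buckets_ok_def)
      then have "rval s1 (value_of 6) = real_vec s (g i)"
        using i(2) agreeD(1)[OF i(3), of 16] by (simp add: real_vec_def vec_of_def)
      then show "runs ?c s1 11 (\<lambda>s'. \<forall>u<Suc i. lloc_output s' u = real_vec s (g u))"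
        using i(2) I by (intro runs_RSet) (auto simp: lloc_output_def less_Suc_eq)
    next
      fix s' assume s': "(\<forall>u<n + 1. lloc_output s' u = real_vec s (g u)) \<and> agree (insert 6 (iwrites ?c)) (rwrites ?c) ?s s'"
      then have "lloc_satisfied (lloc_output s') T = satisfied_by T g (real_vec s)" by (intro satisfied_output[OF T]) blast
      moreover have "ints s' 17 [] = ints s 13 []" using agreeD(1)[OF conjunct2[OF s'], of 17] by simp
      ultimately show "record_ok T s' \<and> ints s 17 [] \<le> ints s' 17 [] \<and> int (card (satisfied_by T g (real_vec s))) \<le> ints s' 17 []"
        using m better by (simp add: record_ok_def)
    qed (auto simp: lloc_output_def)
  qed simp_all
next
  assume "\<not> bval s (below 17 13)"
  then show "runs Skip s (10 + (n + 1) * 20) ?Q"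
    using rec m by (intro runs_Skip) simp_all
qed simp

definition try_pivot :: com where
  "try_pivot = Seq assign (Seq count_boxes (Seq sweeps (Seq evaluate keep)))"

definition sweeps_cost :: "nat \<Rightarrow> nat \<Rightarrow> nat" where
  "sweeps_cost K M = 20 + K * 20 + M * (6 + K * (6 + K * (6 + K * 209 + 9) + 9) + 11)"

definition pivot_cost :: "nat \<Rightarrow> nat \<Rightarrow> nat \<Rightarrow> nat" where
  "pivot_cost N K M = (6 + N * (50 + N * 60 + K * 40)) + (triple_loop_cost K (triple_loop_cost N 60) +
     (sweeps_cost K M + (triple_loop_cost N 60 + (20 + N * 20))))"

text \<open>The vector found for pivot \<open>a\<close> is overwritten by the next pivot, hence the
  existential. The property persists because integer scalar 17 never decreases.\<close>

definition explored :: "nat \<Rightarrow> triples \<Rightarrow> nat \<Rightarrow> nat \<Rightarrow> state \<Rightarrow> nat \<Rightarrow> bool" where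
  "explored n T L K s a \<longleftrightarrow> (\<exists>x :: nat \<Rightarrow> real.
     ((\<exists>z :: nat \<Rightarrow> real. feasible T (pivot_buckets n T L K a) L K z) \<longrightarrow> feasible T (pivot_buckets n T L K a) L K x) \<and>
     int (card (satisfied_by T (pivot_buckets n T L K a) x)) \<le> ints s 17 [])"

lemma runs_try_pivot:
  assumes con: "constants n T L K s" and a: "ints s 5 [] = int a" and K: "K > 0"
    and T: "T \<subseteq> {1..n} \<times> {1..n} \<times> {1..n}" and rec: "record_ok T s"
    and M: "reals s 2 [] = real M" "(1024 * (K * K)) ^ K \<le> M"
  shows "runs try_pivot s (pivot_cost (n + 1) K M)
    (\<lambda>s'. record_ok T s' \<and> ints s 17 [] \<le> ints s' 17 [] \<and> explored n T L K s' a)"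
    (is "runs _ _ _ ?Q")
  unfolding try_pivot_def pivot_cost_def
proof (rule runs_Seq[OF runs_mono[OF runs_assign[OF con a] order_refl] order_refl])
  let ?g = "pivot_buckets n T L K a"
  fix s1 assume s1: "buckets_ok (n + 1) ?g s1 \<and> agree {6, 7, 10, 13, 14, 18} {} s s1"
  then have g1: "buckets_ok (n + 1) ?g s1" and a1: "agree {6, 7, 10, 13, 14, 18} {} s s1" by auto
  have con1: "constants n T L K s1" by (rule constants_agree[OF a1 _ con]) auto
  show "runs (Seq count_boxes (Seq sweeps (Seq evaluate keep))) s1
     (triple_loop_cost K (triple_loop_cost (n + 1) 60) +
     (sweeps_cost K M + (triple_loop_cost (n + 1) 60 + (20 + (n + 1) * 20)))) ?Q"
  proof (rule runs_Seq[OF runs_mono[OF runs_count_boxes[OF con1 g1 T] order_refl] order_refl])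
    fix s2 assume s2: "table_ok T ?g K s2 \<and> agree {6, 7, 8, 9, 10, 11, 13, 15} {} s1 s2"
    then have t2: "table_ok T ?g K s2" and a2: "agree {6, 7, 8, 9, 10, 11, 13, 15} {} s1 s2" by auto
    have con2: "constants n T L K s2" by (rule constants_agree[OF a2 _ con1]) auto
    have M2: "reals s2 2 [] = real M" using M(1) agreeD(2)[OF a1, of 2] agreeD(2)[OF a2, of 2] by simp
    show "runs (Seq sweeps (Seq evaluate keep)) s2 (sweeps_cost K M + (triple_loop_cost (n + 1) 60 + (20 + (n + 1) * 20))) ?Q"
    proof (rule runs_Seq[OF runs_mono[OF runs_sweeps[OF con2 t2 K M2 M(2), folded sweeps_cost_def] order_refl] order_refl])
      let ?ex = "\<exists>z :: nat \<Rightarrow> real. feasible T ?g L K z"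
      fix s3 assume s3: "(?ex \<longrightarrow> feasible T ?g L K (vec_of s3)) \<and> agree {9, 10, 11, 12, 16} {} s2 s3"
      then have f3: "?ex \<longrightarrow> feasible T ?g L K (real_vec s3)" and a3: "agree {9, 10, 11, 12, 16} {} s2 s3"
        using feasible_real_vec by blast+
      have con3: "constants n T L K s3" by (rule constants_agree[OF a3 _ con2]) auto
      have g3: "buckets_ok (n + 1) ?g s3"
        using g1 agreeD(1)[OF a2, of 14] agreeD(1)[OF a3, of 14] by (simp add: buckets_ok_def)
      show "runs (Seq evaluate keep) s3 (triple_loop_cost (n + 1) 60 + (20 + (n + 1) * 20)) ?Q"
      proof (rule runs_Seq[OF runs_mono[OF runs_evaluate[OF con3 g3 T] order_refl] order_refl])
        fix s4 assume s4: "ints s4 13 [] = int (card (satisfied_by T ?g (real_vec s3))) \<and> agree {6, 7, 8, 13} {} s3 s4"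
        then have a4: "agree {6, 7, 8, 13} {} s3 s4" by blast
        have con4: "constants n T L K s4" by (rule constants_agree[OF a4 _ con3]) auto
        have g4: "buckets_ok (n + 1) ?g s4" using g3 agreeD(1)[OF a4, of 14] by (simp add: buckets_ok_def)
        have v4: "real_vec s4 = real_vec s3"
          using agreeD(1)[OF a4, of 16] by (simp add: real_vec_def vec_of_def fun_eq_iff)
        have same: "ints s4 17 = ints s 17" "reals s4 1 = reals s 1"
          using agreeD(1)[OF a1, of 17] agreeD(1)[OF a2, of 17] agreeD(1)[OF a3, of 17] agreeD(1)[OF a4, of 17]
            agreeD(2)[OF a1, of 1] agreeD(2)[OF a2, of 1] agreeD(2)[OF a3, of 1] agreeD(2)[OF a4, of 1] by simp_all
        then have "lloc_output s4 = lloc_output s" by (simp add: lloc_output_def fun_eq_iff)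
        then have "record_ok T s4" using rec same by (simp add: record_ok_def)
        moreover have "ints s4 13 [] = int (card (satisfied_by T ?g (real_vec s4)))" using s4 v4 by simp
        ultimately have "runs keep s4 (20 + (n + 1) * 20)
          (\<lambda>s'. record_ok T s' \<and> ints s4 17 [] \<le> ints s' 17 [] \<and> int (card (satisfied_by T ?g (real_vec s4))) \<le> ints s' 17 [])"
          by (intro runs_keep[OF con4 g4 T])
        then show "runs keep s4 (20 + (n + 1) * 20) ?Q"
          by (rule runs_mono) (use f3 v4 same in \<open>auto simp: explored_def\<close>)
      qed
    qed
  qed
qed

abbreviation "square e \<equiv> RMul e e"
abbreviation "eighth e \<equiv> square (square (square e))"
abbreviation "width_test \<equiv> BAnd (ILess (IConst 0) (IVar 10))
  (BNot (RLess (RMul (RGet 0 []) (eighth (RVar 0))) (eighth (RVar 10))))"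
abbreviation "fits_test \<equiv> BAnd (ILess (IConst 0) (IVar 10)) (BNot (RLess (RVar 0) (RMul (RVar 10) (RVar 3))))"

definition set_width :: com where
  "set_width = Seq (recount 10 2 13 width_test)
     (If (ILess (IVar 13) (IConst 1)) (ISet 3 [] (IConst 1)) (ISet 3 [] (IVar 13)))"

text \<open>The number of sweeps is kept as a real because only reals can be multiplied.\<close>

definition set_sweeps :: com where
  "set_sweeps = Seq (RSet 2 [] (ROfInt (IConst 1)))
     (For 9 (below 9 4) (RSet 2 [] (RMul (RGet 2 []) (RMul (ROfInt (IConst 1024)) (square (RVar 4))))))"

definition setup_scalars :: com where
  "setup_scalars = Seq (ISet 2 [] (IAdd (IVar 0) (IConst 1))) (Seq set_width
     (Seq (recount 10 2 4 fits_test) (Seq set_sweeps (ISet 17 [] (IConst (- 1))))))"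

lemma runs_set_width:
  assumes "ints s 0 [] = int n" "ints s 2 [] = int (n + 1)" "reals s 0 [] = \<epsilon>"
  shows "runs set_width s (30 + (n + 1) * 80) (\<lambda>s'. ints s' 3 [] = int (width \<epsilon> n) \<and> agree {3, 10, 13} {} s s')"
proof -
  let ?P = "\<lambda>j. 0 < j \<and> real j ^ 8 \<le> \<epsilon> * real n ^ 8"
  have "runs set_width s (30 + (n + 1) * 80) (\<lambda>s'. ints s' 3 [] = int (width \<epsilon> n))"
    unfolding set_width_def
  proof (rule runs_Seq[where ?B1.0 = "8 + (n + 1) * 80" and ?B2.0 = 20],
      rule runs_mono[OF runs_fresh_count[where N = "n + 1" and g = 60 and P = ?P] order_refl])
    fix j s' assume s': "agree {10, 13} {} s s'" "ints s' 10 [] = int j"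
    have "ints s' 0 [] = int n" "reals s' 0 [] = \<epsilon>"
      using assms agreeD(1)[OF s'(1), of 0] agreeD(2)[OF s'(1), of 0] by auto
    moreover have e: "z * z * (z * z) * (z * z * (z * z)) = z ^ 8" for z :: real
      by (simp add: eval_nat_numeral mult.assoc)
    ultimately show "bval s' width_test \<longleftrightarrow> ?P j" using s'(2) by (simp add: not_less e)
  next
    fix s1 assume "ints s1 13 [] = int (card {j. j < n + 1 \<and> ?P j}) \<and> agree {10, 13} {} s s1"
    then obtain c where "ints s1 13 [] = int c" "width \<epsilon> n = max 1 c" by (simp only: width_def)
    then show "runs (If (ILess (IVar 13) (IConst 1)) (ISet 3 [] (IConst 1)) (ISet 3 [] (IVar 13))) s1 20
      (\<lambda>s'. ints s' 3 [] = int (width \<epsilon> n))"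
      by (intro runs_If[where B' = 10] runs_ISet) auto
  qed (use assms in simp_all)
  from runs_agree[OF this] show ?thesis
    by (rule runs_mono) (auto simp: set_width_def elim!: agree_mono)
qed

lemma runs_set_sweeps:
  assumes "ints s 4 [] = int K"
  shows "runs set_sweeps s (10 + K * 30)
    (\<lambda>s'. reals s' 2 [] = real ((1024 * (K * K)) ^ K) \<and> agree {9} {2} s s')"
proof -
  let ?c = "RSet 2 [] (RMul (RGet 2 []) (RMul (ROfInt (IConst 1024)) (square (RVar 4))))"
  have "runs set_sweeps s (10 + K * 30) (\<lambda>s'. reals s' 2 [] = real ((1024 * (K * K)) ^ K))"
    unfolding set_sweeps_def
  proof (rule runs_Seq[where ?B1.0 = 4 and ?B2.0 = "6 + K * 30"], rule runs_RSet)
    let ?s = "rset 2 (map (ival s) []) (rval s (ROfInt (IConst 1))) s"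
    show "runs (For 9 (below 9 4) ?c) ?s (6 + K * 30) (\<lambda>s'. reals s' 2 [] = real ((1024 * (K * K)) ^ K))"
    proof (rule runs_mono[OF runs_For_below[where N = K and B = 21 and
          I = "\<lambda>i s'. reals s' 2 [] = real ((1024 * (K * K)) ^ i)"] order_refl])
      fix i s1 assume "agree (insert 9 (iwrites ?c)) (rwrites ?c) ?s s1" "reals s1 2 [] = real ((1024 * (K * K)) ^ i)"
      moreover have "ints s1 4 [] = int K" using agreeD(1)[OF calculation(1), of 4] assms by simp
      ultimately show "runs ?c s1 21 (\<lambda>s'. reals s' 2 [] = real ((1024 * (K * K)) ^ Suc i))"
        by (intro runs_RSet) simp_all
    qed (use assms in simp_all)
  qed simp_all
  from runs_agree[OF this] show ?thesis
    by (rule runs_mono) (auto simp: set_sweeps_def elim!: agree_mono)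
qed

lemma runs_setup:
  assumes n: "ints s 0 [] = int n" and \<epsilon>: "reals s 0 [] = \<epsilon>"
    and T: "\<And>u v w. 0 < ints s 1 [int u, int v, int w] \<longleftrightarrow> (u, v, w) \<in> T"
  defines "L \<equiv> width \<epsilon> n"
  defines "K \<equiv> buckets n L"
  shows "runs setup_scalars s (70 + (n + 1) * 130 + K * 30)
    (\<lambda>s'. constants n T L K s' \<and> reals s' 2 [] = real ((1024 * (K * K)) ^ K) \<and> ints s' 17 [] = - 1)"
    (is "runs _ _ _ ?Q")
  unfolding setup_scalars_def
proof (rule runs_Seq[where ?B1.0 = 5 and ?B2.0 = "65 + (n + 1) * 130 + K * 30"], rule runs_ISet)
  let ?s = "iset 2 (map (ival s) []) (ival s (IAdd (IVar 0) (IConst 1))) s"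
  have s0: "ints ?s 0 [] = int n" "ints ?s 2 [] = int (n + 1)" "reals ?s 0 [] = \<epsilon>" using n \<epsilon> by simp_all
  show "runs (Seq set_width (Seq (recount 10 2 4 fits_test) (Seq set_sweeps (ISet 17 [] (IConst (- 1)))))) ?s
     (65 + (n + 1) * 130 + K * 30) ?Q"
  proof (rule runs_Seq[where ?B2.0 = "35 + (n + 1) * 50 + K * 30", OF runs_mono[OF runs_set_width[OF s0] order_refl]])
    fix s1 assume s1: "ints s1 3 [] = int (width \<epsilon> n) \<and> agree {3, 10, 13} {} ?s s1"
    then have L1: "ints s1 3 [] = int L" and a1: "agree {3, 10, 13} {} ?s s1" by (auto simp: L_def)
    have n1: "ints s1 0 [] = int n" "ints s1 2 [] = int (n + 1)"
      using s0 agreeD(1)[OF a1, of 0] agreeD(1)[OF a1, of 2] by auto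
    have T1: "ints s1 1 = ints s 1" using agreeD(1)[OF a1, of 1] by simp
    show "runs (Seq (recount 10 2 4 fits_test) (Seq set_sweeps (ISet 17 [] (IConst (- 1))))) s1
      (35 + (n + 1) * 50 + K * 30) ?Q"
    proof (rule runs_Seq[where ?B1.0 = "8 + (n + 1) * 50" and ?B2.0 = "27 + K * 30"],
        rule runs_mono[OF runs_fresh_count[where N = "n + 1" and g = 30 and P = "\<lambda>j. 0 < j \<and> j * L \<le> n"] order_refl])
      fix j s' assume s': "agree {10, 4} {} s1 s'" "ints s' 10 [] = int j"
      have "ints s' 0 [] = int n" "ints s' 3 [] = int L"
        using n1 L1 agreeD(1)[OF s'(1), of 0] agreeD(1)[OF s'(1), of 3] by auto
      then show "bval s' fits_test \<longleftrightarrow> 0 < j \<and> j * L \<le> n" using s'(2) by (simp add: real_product_le_iff)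
    next
      fix s2 assume s2: "ints s2 4 [] = int (card {j. j < n + 1 \<and> (0 < j \<and> j * L \<le> n)}) \<and> agree {10, 4} {} s1 s2"
      then have K2: "ints s2 4 [] = int K" and a2: "agree {10, 4} {} s1 s2" by (auto simp: K_def buckets_def)
      have con2: "constants n T L K s2"
        using T T1 n1 L1 K2 agreeD(1)[OF a2, of 1] agreeD(1)[OF a2, of 2] agreeD(1)[OF a2, of 3]
        by (simp add: constants_def)
      show "runs (Seq set_sweeps (ISet 17 [] (IConst (- 1)))) s2 (27 + K * 30) ?Q"
      proof (rule runs_Seq[where ?B2.0 = 10, OF runs_mono[OF runs_set_sweeps[OF K2] order_refl]])
        fix s3 assume s3: "reals s3 2 [] = real ((1024 * (K * K)) ^ K) \<and> agree {9} {2} s2 s3"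
        have "constants n T L K s3" by (rule constants_agree[OF conjunct2[OF s3] _ con2]) auto
        then show "runs (ISet 17 [] (IConst (- 1))) s3 10 ?Q"
          using s3 by (intro runs_ISet) (auto simp: constants_def)
      qed simp
    qed (use n1 in simp_all)
  qed simp
qed simp_all

definition main_loop :: com where "main_loop = For 5 (below 5 2) try_pivot"

lemma runs_main_loop:
  assumes con: "constants n T L K s" and K: "K > 0"
    and T: "T \<subseteq> {1..n} \<times> {1..n} \<times> {1..n}" and best: "ints s 17 [] = - 1"
    and M: "reals s 2 [] = real M" "(1024 * (K * K)) ^ K \<le> M"
  shows "runs main_loop s (6 + (n + 1) * (pivot_cost (n + 1) K M + 9))
    (\<lambda>s'. record_ok T s' \<and> (\<forall>a<n + 1. explored n T L K s' a))"
proof -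
  have ir: "iwrites try_pivot = {6, 7, 8, 9, 10, 11, 12, 13, 14, 15, 16, 17, 18}" "rwrites try_pivot = {1}"
    by (auto simp: try_pivot_def count_boxes_def evaluate_def keep_def)
  have out: "record_ok T (iset 5 [] z s') = record_ok T s'" for z s'
    by (simp add: record_ok_def lloc_output_def[abs_def])
  show ?thesis
    unfolding main_loop_def
  proof (rule runs_mono[OF runs_For_below[where N = "n + 1" and B = "pivot_cost (n + 1) K M" and
        I = "\<lambda>i s'. record_ok T s' \<and> (\<forall>a<i. explored n T L K s' a)"] order_refl])
    show "5 \<notin> iwrites try_pivot" "2 \<notin> iwrites try_pivot" by (simp_all add: ir)
    show "ints s 2 [] = int (n + 1)" using con by (simp add: constants_def)
    show "record_ok T s \<and> (\<forall>a<0. explored n T L K s a)" using best by (simp add: record_ok_def)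
    show "record_ok T (iset 5 [] z s') \<and> (\<forall>a<i. explored n T L K (iset 5 [] z s') a)"
      if "record_ok T s' \<and> (\<forall>a<i. explored n T L K s' a)" for i s' z
      using that by (simp add: out explored_def)
  next
    fix a s' assume a: "a < n + 1" and ag: "agree (insert 5 (iwrites try_pivot)) (rwrites try_pivot) s s'"
      and v: "ints s' 5 [] = int a" and I: "record_ok T s' \<and> (\<forall>b<a. explored n T L K s' b)"
    have con': "constants n T L K s'" by (rule constants_agree[OF ag _ con]) (simp add: ir)
    have M': "reals s' 2 [] = real M" using agreeD(2)[OF ag, of 2] M(1) by (simp add: ir)
    show "runs try_pivot s' (pivot_cost (n + 1) K M) (\<lambda>s'. record_ok T s' \<and> (\<forall>b<Suc a. explored n T L K s' b))"
    proof (rule runs_mono[OF runs_try_pivot[OF con' v K T conjunct1[OF I] M' M(2)] order_refl])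
      fix s2 assume s2: "record_ok T s2 \<and> ints s' 17 [] \<le> ints s2 17 [] \<and> explored n T L K s2 a"
      have "explored n T L K s2 b" if "b < a" for b
        using I that s2 unfolding explored_def by (meson order_trans)
      then show "record_ok T s2 \<and> (\<forall>b<Suc a. explored n T L K s2 b)" using s2 by (simp add: less_Suc_eq)
    qed
  qed auto
qed

section \<open>Running time\<close>

text \<open>If \<open>10000 ^ 8 * \<epsilon> \<ge> 1\<close>, then the guarantee \<open>1 - 10000 * \<epsilon> powr (1/8)\<close> is void, and any output will do.\<close>

definition lloc_program :: com where
  "lloc_program = If (RLess (RMul (RGet 0 []) (ROfInt (IConst (10 ^ 32)))) (ROfInt (IConst 1)))
     (Seq setup_scalars main_loop) Skip"

definition total_cost :: "nat \<Rightarrow> nat \<Rightarrow> nat" where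
  "total_cost n K = 80 + (n + 1) * 130 + K * 30 + (6 + (n + 1) * (pivot_cost (n + 1) K ((1024 * (K * K)) ^ K) + 9))"

text \<open>Collapses the cost of a loop into one monomial. Applied once per nesting level, it lets
  the coefficient grow only additively.\<close>

lemma loop_cost_le: "B \<le> c * Z \<Longrightarrow> Z \<ge> 1 \<Longrightarrow> N \<ge> 1 \<Longrightarrow> d + N * (B + e) \<le> (c + d + e) * (N * Z)" for N :: nat
proof -
  assume a: "B \<le> c * Z" "Z \<ge> 1" "N \<ge> 1"
  have 1: "1 \<le> N * Z" using a by simp
  have "d * 1 \<le> d * (N * Z)" by (intro mult_le_mono2 1)
  moreover have "e * 1 \<le> e * Z" by (intro mult_le_mono2 a(2))
  then have "N * (B + e) \<le> N * (c * Z + e * Z)" using a(1) by (intro mult_le_mono2 add_mono) simp_all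
  ultimately have "d + N * (B + e) \<le> d * (N * Z) + N * (c * Z + e * Z)" by linarith
  then show ?thesis by (simp add: algebra_simps)
qed

lemma pivot_cost_le:
  assumes "N \<ge> 1" "K \<ge> 1" "M \<ge> 1"
  shows "pivot_cost N K M \<le> 1000 * (N ^ 3 * K ^ 3 * M)"
proof -
  let ?Z = "N ^ 3 * K ^ 3 * M"
  have N3: "1 \<le> N ^ 3" and K3: "1 \<le> K ^ 3" using assms by simp_all
  have triple: "triple_loop_cost P b \<le> (b + 52) * P ^ 3" if "P \<ge> 1" for P b
  proof -
    have "6 + P * (b + 14) \<le> (b + 20) * (P * 1)"
      using loop_cost_le[of b b 1 P 6 14] that by (simp add: add.commute add.left_commute)
    then have "6 + P * (6 + P * (b + 14) + 9) \<le> (b + 20 + 6 + 9) * (P * (P * 1))"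
      by (rule loop_cost_le) (use that in simp_all)
    then have "8 + P * (6 + P * (6 + P * (b + 14) + 9) + 9) \<le> (b + 20 + 6 + 9 + 8 + 9) * (P * (P * (P * 1)))"
      by (rule loop_cost_le) (use that in simp_all)
    then show ?thesis by (simp add: triple_loop_cost_def power3_eq_cube add.commute)
  qed
  have t1: "triple_loop_cost N 60 \<le> 112 * N ^ 3" using triple[OF assms(1), of 60] by simp
  have NM: "N ^ 3 * 1 \<le> N ^ 3 * (K ^ 3 * M)" using K3 assms(3) by (intro mult_le_mono2) simp
  have "112 * (N ^ 3 * 1) \<le> 112 * (N ^ 3 * (K ^ 3 * M))" by (rule mult_le_mono2[OF NM])
  then have "112 * N ^ 3 \<le> 112 * ?Z" by (simp only: mult.assoc mult_1_right)
  with t1 have t1': "triple_loop_cost N 60 \<le> 112 * ?Z" by (rule order_trans)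
  have t2: "triple_loop_cost K (triple_loop_cost N 60) \<le> 164 * ?Z"
  proof -
    have "triple_loop_cost K (triple_loop_cost N 60) \<le> (triple_loop_cost N 60 + 52) * K ^ 3"
      by (rule triple[OF assms(2)])
    also have "\<dots> \<le> (164 * N ^ 3) * K ^ 3" using t1 N3 by (intro mult_le_mono1) simp
    also have "\<dots> \<le> (164 * N ^ 3) * K ^ 3 * M" using assms(3) by simp
    finally show ?thesis by (simp add: mult.assoc)
  qed
  have KM: "K ^ 3 * M \<le> ?Z" using N3 by simp
  have t3: "sweeps_cost K M \<le> 296 * ?Z"
  proof -
    have "6 + K * 209 \<le> 215 * (K * 1)" using assms by simp
    then have "6 + K * (6 + K * 209 + 9) \<le> (215 + 6 + 9) * (K * (K * 1))"
      by (rule loop_cost_le) (use assms in simp_all)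
    then have "6 + K * (6 + K * (6 + K * 209 + 9) + 9) \<le> (215 + 6 + 9 + 6 + 9) * (K * (K * (K * 1)))"
      by (rule loop_cost_le) (use assms in simp_all)
    then have "0 + M * (6 + K * (6 + K * (6 + K * 209 + 9) + 9) + 11) \<le>
        (215 + 6 + 9 + 6 + 9 + 0 + 11) * (M * (K * (K * (K * 1))))"
      by (rule loop_cost_le) (use assms in simp_all)
    moreover have Y: "M * (K * (K * (K * 1))) = K ^ 3 * M" by (simp add: power3_eq_cube)
    ultimately have 1: "M * (6 + K * (6 + K * (6 + K * 209 + 9) + 9) + 11) \<le> 256 * (K ^ 3 * M)"
      unfolding Y by simp
    have "K * 1 \<le> K * (K * K * M)" using assms by (intro mult_le_mono2) simp
    then have 2: "K \<le> K ^ 3 * M" by (simp only: power3_eq_cube mult.assoc mult_1_right)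
    have "20 + K * 20 \<le> 40 * K" using assms(2) by simp
    with 1 2 have "sweeps_cost K M \<le> 296 * (K ^ 3 * M)" unfolding sweeps_cost_def by linarith
    then show ?thesis using KM by (meson mult_le_mono2 order_trans)
  qed
  have NZ: "N \<le> ?Z"
  proof -
    have "N * 1 \<le> N * (N * N * (K ^ 3 * M))" using assms K3 by (intro mult_le_mono2) simp
    then show ?thesis by (simp only: power3_eq_cube[of N] mult.assoc mult_1_right)
  qed
  have t4: "6 + N * (50 + N * 60 + K * 40) \<le> 156 * ?Z"
  proof -
    have "N * K \<ge> 1" using assms by simp
    moreover have "N \<le> N * K" "K \<le> N * K" using assms by simp_all
    ultimately have "50 + N * 60 + K * 40 \<le> 150 * (N * K)" by linarith
    then have "6 + N * (50 + N * 60 + K * 40 + 0) \<le> (150 + 6 + 0) * (N * (N * K))"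
      by (rule loop_cost_le) (use assms in simp_all)
    moreover have "N * (N * K) * 1 \<le> N * (N * K) * (N * (K * K * M))" using assms by (intro mult_le_mono2) simp
    moreover have "N * (N * K) * (N * (K * K * M)) = ?Z" by (simp add: power3_eq_cube)
    ultimately have "6 + N * (50 + N * 60 + K * 40) \<le> 156 * (N * (N * K))" "N * (N * K) \<le> ?Z" by simp_all
    then show ?thesis by linarith
  qed
  have "1 \<le> ?Z" using N3 K3 assms by simp
  then show ?thesis unfolding pivot_cost_def using t1' t2 t3 t4 NZ by linarith
qed

lemma total_cost_le:
  assumes "n \<ge> 1" "K \<ge> 1"
  shows "total_cost n K \<le> 20800 * (n ^ 4 * (K ^ 3 * (1024 * (K * K)) ^ K))"
proof -
  let ?N = "n + 1"
  define M where "M = (1024 * (K * K)) ^ K"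
  have M: "M \<ge> 1" using assms unfolding M_def by simp
  define Z where "Z = ?N ^ 3 * K ^ 3 * M"
  have N3: "1 \<le> ?N ^ 3" and K3: "1 \<le> K ^ 3" using assms by simp_all
  have Z1: "Z \<ge> 1" using N3 K3 M by (simp add: Z_def)
  have KZ: "K \<le> Z"
  proof -
    have "K * 1 \<le> K * (K * K * (?N ^ 3 * M))" using assms M N3 by (intro mult_le_mono2) simp
    moreover have "K * (K * K * (?N ^ 3 * M)) = Z" by (simp only: Z_def power3_eq_cube[of K] ac_simps)
    ultimately have "K * 1 \<le> Z" by (simp only:)
    then show ?thesis by simp
  qed
  have e: "x * (x ^ 3 * K ^ 3 * M) = x ^ 4 * (K ^ 3 * M)" for x by (simp add: eval_nat_numeral)
  define P where "P = ?N * Z"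
  have 1: "6 + ?N * (pivot_cost ?N K M + 9) \<le> (1000 + 6 + 9) * P"
    unfolding Z_def P_def by (rule loop_cost_le[OF pivot_cost_le]) (use assms M Z1 in \<open>simp_all add: Z_def\<close>)
  have 2: "?N * 1 \<le> P" unfolding P_def by (rule mult_le_mono2[OF Z1])
  have 3: "Z \<le> P" by (simp add: P_def)
  have 4: "80 + ?N * 130 + K * 30 \<le> 240 * P" using 2 3 KZ Z1 by linarith
  have "total_cost n K \<le> 240 * P + (1000 + 6 + 9) * P"
    unfolding total_cost_def using add_mono[OF 4 1] by (simp only: M_def)
  also have "\<dots> \<le> 1300 * P" by simp
  finally have "total_cost n K \<le> 1300 * P" .
  then have "total_cost n K \<le> 1300 * (?N * Z)" by (simp only: P_def)
  also have "?N * Z = ?N ^ 4 * (K ^ 3 * M)" unfolding Z_def by (rule e)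
  \<comment> \<open>\<open>n + 1 \<le> 2 * n\<close>, and
    \<open>1300 * 2 ^ 4 = 20800\<close>.\<close>
  also have "1300 * (?N ^ 4 * (K ^ 3 * M)) \<le> 1300 * ((2 * n) ^ 4 * (K ^ 3 * M))"
    using assms by (intro mult_le_mono2 mult_le_mono1 power_mono) simp_all
  also have "\<dots> = 20800 * (n ^ 4 * (K ^ 3 * M))" by (simp add: power_mult_distrib)
  finally show ?thesis by (simp only: M_def)
qed

text \<open>The split is at \<open>X = n ^ 3\<close>: up to there the product is at most
  \<open>n ^ 7\<close>, and beyond it one factor \<open>n ^ 3\<close> is replaced by
  \<open>X\<close>.\<close>

lemma mixed_product_le: "n ^ 4 * X \<le> n ^ 7 + X\<^sup>2 * n" for n X :: nat
proof (cases "X \<le> n ^ 3")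
  case True
  then have "n ^ 4 * X \<le> n ^ 4 * n ^ 3" by (rule mult_le_mono2)
  also have "\<dots> = n ^ 7" by (simp flip: power_add)
  finally show ?thesis by simp
next
  case False
  then have "n ^ 3 * (n * X) \<le> X * (n * X)" by (intro mult_le_mono1) simp
  then have "n ^ 4 * X \<le> X\<^sup>2 * n" by (simp add: eval_nat_numeral mult_ac)
  then show ?thesis by simp
qed

text \<open>\<open>D\<close> stands for \<open>1 / \<delta>\<close>; being at least 10000, its extra
  powers absorb the numeric factors. The exponent is
  \<open>10 + 6 * K \<le> 10 + 12 * D \<le> 16 * D\<close>, and
  \<open>16 * D = 8 * (2 / \<delta>)\<close> later becomes the exponent \<open>2 / \<delta>\<close>
  over the base \<open>1 / \<delta> ^ 8\<close>.\<close>

lemma sweeps_le_powr: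
  assumes D: "D \<ge> 10000" and K: "real K \<le> 2 * D"
  shows "20800 * (real (K ^ 3 * (1024 * (K * K)) ^ K))\<^sup>2 \<le> D powr (16 * D)"
proof -
  have D1: "1 \<le> D" "0 \<le> D" "0 < D" using D by simp_all
  have a: "real K ^ 3 \<le> D ^ 4"
  proof -
    have "real K ^ 3 \<le> (2 * D) ^ 3" using K by (intro power_mono) simp_all
    also have "\<dots> = 8 * D ^ 3" by (simp add: power_mult_distrib)
    also have "\<dots> \<le> D * D ^ 3" using D by (intro mult_right_mono) simp_all
    finally show ?thesis by (simp add: eval_nat_numeral)
  qed
  have b: "1024 * (real K * real K) \<le> D ^ 3"
  proof -
    have "real K * real K \<le> (2 * D) * (2 * D)" using K D1 by (intro mult_mono) simp_all
    then have "1024 * (real K * real K) \<le> 4096 * (D * D)" by simp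
    also have "\<dots> \<le> D * (D * D)" using D by (intro mult_right_mono) simp_all
    finally show ?thesis by (simp add: power3_eq_cube)
  qed
  have "real (K ^ 3 * (1024 * (K * K)) ^ K) = real K ^ 3 * (1024 * (real K * real K)) ^ K" by simp
  also have "\<dots> \<le> D ^ 4 * (D ^ 3) ^ K" using a b D1 by (intro mult_mono power_mono) simp_all
  also have "\<dots> = D ^ (4 + 3 * K)" by (simp add: power_add power_mult)
  finally have "(real (K ^ 3 * (1024 * (K * K)) ^ K))\<^sup>2 \<le> (D ^ (4 + 3 * K))\<^sup>2" by (intro power_mono) simp_all
  moreover have "20800 \<le> D\<^sup>2"
  proof -
    have "(10000::real)\<^sup>2 \<le> D\<^sup>2" using D by (intro power_mono) simp_all
    then show ?thesis by simp
  qed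
  ultimately have "20800 * (real (K ^ 3 * (1024 * (K * K)) ^ K))\<^sup>2 \<le> D\<^sup>2 * (D ^ (4 + 3 * K))\<^sup>2"
    by (intro mult_mono) simp_all
  also have "\<dots> = D ^ (2 + (4 + 3 * K) * 2)" by (simp only: power_add power_mult)
  also have "\<dots> = D powr real (2 + (4 + 3 * K) * 2)" using D1(3) by (rule powr_realpow[symmetric])
  also have "\<dots> \<le> D powr (16 * D)" using K D by (intro powr_mono) simp_all
  finally show ?thesis .
qed

lemma total_cost_bound:
  assumes n: "n \<ge> 1" and K: "K \<ge> 1" "real K \<le> 2 / \<delta>" and \<delta>: "0 < \<delta>" "\<delta> \<le> 1 / 10000"
  shows "real (total_cost n K) \<le> 20800 * real n ^ 7 + (1 / \<delta> ^ 8) powr (2 / \<delta>) * real n"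
proof -
  let ?X = "K ^ 3 * (1024 * (K * K)) ^ K"
  define D where "D = 1 / \<delta>"
  have D: "D \<ge> 10000" using \<delta> by (simp add: D_def field_simps)
  have "total_cost n K \<le> 20800 * (n ^ 4 * ?X)" by (rule total_cost_le[OF n K(1)])
  also have "\<dots> \<le> 20800 * (n ^ 7 + ?X\<^sup>2 * n)" by (intro mult_le_mono2 mixed_product_le)
  finally have "real (total_cost n K) \<le> real (20800 * (n ^ 7 + ?X\<^sup>2 * n))" by (simp only: of_nat_le_iff)
  also have "\<dots> = 20800 * real n ^ 7 + 20800 * (real ?X)\<^sup>2 * real n" by (simp only: of_nat_mult of_nat_add of_nat_power of_nat_numeral distrib_left mult.assoc)
  also have "20800 * (real ?X)\<^sup>2 * real n \<le> D powr (16 * D) * real n"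
    using sweeps_le_powr[OF D, of K] K(2) by (intro mult_right_mono) (simp_all add: D_def)
  also have "D powr (16 * D) = (D powr 8) powr (2 / \<delta>)" by (simp add: powr_powr D_def)
  also have "D powr 8 = 1 / \<delta> ^ 8"
  proof -
    have "D powr real (8::nat) = D ^ 8" using D by (intro powr_realpow) simp
    then show ?thesis by (simp add: D_def power_one_over)
  qed
  finally show ?thesis by simp
qed

text \<open>The pivot of \<open>good_pivot_quality\<close> is among those tried, and its system is
  feasible, so the vector found for it is good. The recorded output satisfies at least as many
  constraints.\<close>

lemma lloc_program_correct:
  assumes inst: "lloc_instance n T" and n: "n \<ge> 1" and \<delta>: "0 < \<delta>" "\<delta> < 1"
    and sol: "satisfies_fraction f T (1 - \<delta> ^ 8)"
  shows "\<exists>t s. exec lloc_program (lloc_input (\<delta> ^ 8) n T) t s \<and> satisfies_fraction (lloc_output s) T (1 - 10000 * \<delta>) \<and>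
    real t \<le> 20800 * real n ^ 7 + (1 / \<delta> ^ 8) powr (2 / \<delta>) * real n"
proof -
  let ?\<epsilon> = "\<delta> ^ 8"
  let ?s = "lloc_input ?\<epsilon> n T"
  let ?b = "RLess (RMul (RGet 0 []) (ROfInt (IConst (10 ^ 32)))) (ROfInt (IConst 1))"
  have b: "bval ?s ?b \<longleftrightarrow> \<delta> < 1 / 10000"
  proof -
    have "bval ?s ?b \<longleftrightarrow> (10000 * \<delta>) ^ 8 < 1 ^ 8" by (simp add: lloc_input_def power_mult_distrib mult.commute)
    also have "\<dots> \<longleftrightarrow> 10000 * \<delta> < 1" using \<delta> power_mono_iff[of 1 "10000 * \<delta>" 8] by (simp add: not_le[symmetric])
    finally show ?thesis by auto
  qed
  show ?thesis
  proof (cases "\<delta> < 1 / 10000")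
    case False
    then have "exec lloc_program ?s (1 + bcost ?b + 1) ?s"
      unfolding lloc_program_def using b by (intro exec.IfFalse exec.Skip) simp
    moreover have "satisfies_fraction (lloc_output ?s) T (1 - 10000 * \<delta>)"
    proof -
      have "(1 - 10000 * \<delta>) * real (card T) \<le> 0" using False by (intro mult_nonpos_nonneg) simp_all
      then show ?thesis unfolding satisfies_fraction_def by linarith
    qed
    moreover have "1 \<le> real n ^ 7" using n by simp
    then have "real (1 + bcost ?b + 1) \<le> 20800 * real n ^ 7" by simp
    then have "real (1 + bcost ?b + 1) \<le> 20800 * real n ^ 7 + (1 / \<delta> ^ 8) powr (2 / \<delta>) * real n"
      by (simp add: add_increasing2)
    ultimately show ?thesis by blast
  next
    case True
    then have \<delta>': "\<delta> \<le> 1 / 10000" by simp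
    define L where "L = width ?\<epsilon> n"
    define K where "K = buckets n L"
    note wb = width_bounds[OF refl \<delta> n, folded L_def]
    have "L > 0" using wb(2) by simp
    note bb = buckets_bounds[OF this wb(3), folded K_def]
    let ?M = "(1024 * (K * K)) ^ K"
    note T = instance_subset[OF inst]
    have scalars: "runs setup_scalars ?s (70 + (n + 1) * 130 + K * 30)
      (\<lambda>s'. constants n T L K s' \<and> reals s' 2 [] = real ?M \<and> ints s' 17 [] = - 1)"
      unfolding K_def L_def by (rule runs_setup) (auto simp: lloc_input_def)
    have "runs (Seq setup_scalars main_loop) ?s
      (70 + (n + 1) * 130 + K * 30 + (6 + (n + 1) * (pivot_cost (n + 1) K ?M + 9)))
      (\<lambda>s'. record_ok T s' \<and> (\<forall>a<n + 1. explored n T L K s' a))"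
      by (rule runs_Seq[OF runs_mono[OF scalars order_refl] order_refl]) (use runs_main_loop bb(1) T in blast)
    then have "runs lloc_program ?s (total_cost n K) (\<lambda>s'. record_ok T s' \<and> (\<forall>a<n + 1. explored n T L K s' a))"
      unfolding lloc_program_def by (rule runs_If) (use b True in \<open>simp_all add: total_cost_def\<close>)
    then obtain t s where t: "exec lloc_program ?s t s" "t \<le> total_cost n K"
      and s: "record_ok T s" "\<forall>a<n + 1. explored n T L K s a" unfolding runs_def by blast
    obtain a where a: "a \<in> {1..n}" "\<exists>z :: nat \<Rightarrow> real. feasible T (pivot_buckets n T L K a) L K z"
      and q: "\<And>x :: nat \<Rightarrow> real. feasible T (pivot_buckets n T L K a) L K x \<Longrightarrow>
        (1 - 10000 * \<delta>) * real (card T) \<le> real (card (satisfied_by T (pivot_buckets n T L K a) x))"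
      using good_pivot_quality[OF inst n refl \<delta>(1) \<delta>' sol] unfolding K_def L_def pivot_buckets_def by blast
    have "explored n T L K s a" using s(2) a(1) by simp
    then obtain x :: "nat \<Rightarrow> real" where x: "feasible T (pivot_buckets n T L K a) L K x"
      "int (card (satisfied_by T (pivot_buckets n T L K a) x)) \<le> ints s 17 []"
      using a(2) unfolding explored_def by blast
    \<comment> \<open>A count is at least 0, which excludes the initial value
      \<open>-1\<close>.\<close>
    then have "ints s 17 [] = int (card (lloc_satisfied (lloc_output s) T))" using s(1) unfolding record_ok_def by linarith
    then have "card (satisfied_by T (pivot_buckets n T L K a) x) \<le> card (lloc_satisfied (lloc_output s) T)"
      using x(2) by simp
    then have "satisfies_fraction (lloc_output s) T (1 - 10000 * \<delta>)"
      using q[OF x(1)] unfolding satisfies_fraction_def by linarith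
    moreover have "real K \<le> 2 / \<delta>"
    proof -
      have "\<delta> * real n \<le> 2 * real L" using wb(1,2) by linarith
      then have "real K * (\<delta> * real n) \<le> 2 * real (K * L)"
        using mult_left_mono[of "\<delta> * real n" "2 * real L" "real K"] by simp
      also have "\<dots> \<le> 2 * real n" using bb(2) by (simp only: of_nat_le_iff mult_le_cancel_left_pos)
      finally have "(real K * \<delta>) * real n \<le> 2 * real n" by (simp add: mult.assoc)
      then have "real K * \<delta> \<le> 2" using n by simp
      then show ?thesis using \<delta> by (simp add: pos_le_divide_eq)
    qed
    then have "real (total_cost n K) \<le> 20800 * real n ^ 7 + (1 / \<delta> ^ 8) powr (2 / \<delta>) * real n"
      using bb(1) by (intro total_cost_bound[OF n _ _ \<delta>(1) \<delta>']) simp_all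
    then have "real t \<le> 20800 * real n ^ 7 + (1 / \<delta> ^ 8) powr (2 / \<delta>) * real n" using t(2) by linarith
    ultimately show ?thesis using t(1) by blast
  qed
qed

theorem theorem1:
  "\<exists>(P :: com) (C0 :: real) (C1 :: real) (C2 :: real). \<forall>(\<epsilon> :: real) (n :: nat) (T :: (nat \<times> nat \<times> nat) set).
     0 < \<epsilon> \<and> \<epsilon> < 1 \<and> n \<ge> 1 \<and> lloc_instance n T \<and>
     (\<exists>f :: nat \<Rightarrow> real. satisfies_fraction f T (1 - \<epsilon>)) \<longrightarrow>
     (\<exists>t s. exec P (lloc_input \<epsilon> n T) t s \<and>
        satisfies_fraction (lloc_output s) T (1 - C0 * \<epsilon> powr (1/8)) \<and>
        real t \<le> C1 * real n ^ 7 + (1 / \<epsilon>) powr (C2 / \<epsilon> powr (1/8)) * real n)"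
proof (rule exI[of _ lloc_program], rule exI[of _ 10000], rule exI[of _ 20800], rule exI[of _ 2], intro allI impI)
  fix \<epsilon> :: real and n :: nat and T :: "(nat \<times> nat \<times> nat) set"
  assume "0 < \<epsilon> \<and> \<epsilon> < 1 \<and> n \<ge> 1 \<and> lloc_instance n T \<and> (\<exists>f :: nat \<Rightarrow> real. satisfies_fraction f T (1 - \<epsilon>))"
  then obtain f :: "nat \<Rightarrow> real" where *: "0 < \<epsilon>" "\<epsilon> < 1" "n \<ge> 1" "lloc_instance n T" "satisfies_fraction f T (1 - \<epsilon>)"
    by blast
  define \<delta> where "\<delta> = \<epsilon> powr (1/8)"
  have "\<delta> ^ 8 = \<delta> powr real (8::nat)" using *(1) by (intro powr_realpow[symmetric]) (simp add: \<delta>_def)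
  then have e: "\<delta> ^ 8 = \<epsilon>" using *(1) by (simp add: \<delta>_def powr_powr)
  have "0 < \<delta>" "\<delta> < 1" using *(1,2) powr_less_mono2[of "1/8" \<epsilon> 1] by (simp_all add: \<delta>_def)
  from lloc_program_correct[OF *(4) *(3) this, of f, unfolded e, OF *(5)]
  show "\<exists>t s. exec lloc_program (lloc_input \<epsilon> n T) t s \<and>
        satisfies_fraction (lloc_output s) T (1 - 10000 * \<epsilon> powr (1/8)) \<and>
        real t \<le> 20800 * real n ^ 7 + (1 / \<epsilon>) powr (2 / \<epsilon> powr (1/8)) * real n"
    by (simp only: \<delta>_def)
qed

end
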